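(* Let $L$ be a simple pseudoline arrangement (with contact points) and $\chi$ a cut of $L$. For any positive integers $a$ and $b$, $\Gamma_\chi^{a+b}(L)=\Gamma_\chi^b(\Gamma_\chi^a(L))$. Consequently, for every positive integer $k$, $\Gamma_\chi^k(L)$ equals $\Gamma_\chi^1$ applied $k$ times to $L$.
   Context: Setting: pseudoline arrangements with contact points in the Möbius strip $\mathcal M=\mathbb R^2/\tau$, $\tau(x,y)=(x+\pi,-y)$ (finite sets of pseudolines, i.e. projections of graphs of continuous $\pi$-antiperiodic functions, any two with exactly one crossing point and possibly contact points; simple). Support = union of pseudolines; the first level is the boundary of the external face of the complement of the support, the $j$th level inductively the first level of the support minus the first $j-1$ levels. The $k$-kernel $\mathcal S^k$ of $L$ is its support minus its first $k$ levels; $V^k$ is the set of contact points of $L$ lying in $\mathcal S^k$. A $k$-pseudotriangulation of $L$ is a pseudoline arrangement whose support is $\mathcal S^k$ and whose set of contact points contains $V^k$. Flip: replacing a contact point $v$ of two pseudolines by their crossing point $w$ (i.e. passing to the arrangement with same support and contact set $(V\setminus\{v\})\cup\{w\}$). Cut: with $\bar{\mathcal S}=\pi^{-1}(\mathcal S)$ oriented by increasing abscissa and path order $\preceq$, a filter is a nonempty proper upward-closed set $F$ of its vertices, defining a cut $\chi$ (a vertical curve separating $F$ from its complement, projected to $\mathcal M$); a cut of $L$ is also a cut of each of its kernels. For vertices $v,w$ of a support, $v\preceq_\chi w$ iff their unique preimages in $F\setminus\tau(F)$ are comparable by $\preceq$ in this order. A flip of $v$ (crossing point $w$) is $\chi$-increasing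 if $v\prec_\chi w$. For a support $\mathcal S$ and vertex set $V$, the graph of $\chi$-increasing flips on arrangements supported by $\mathcal S$ with contact set containing $V$ has (when nonempty) a unique source $\Gamma_\chi(\mathcal S\mid V)$. The $\chi$-greedy $k$-pseudotriangulation of $L$ is $\Gamma_\chi^k(L):=\Gamma_\chi(\mathcal S^k\mid V^k)$. *)

theory Defs
  imports "HOL-Analysis.Analysis"
begin

section \<open>The Moebius strip\<close>

definition tau :: "real \<times> real \<Rightarrow> real \<times> real" where
  "tau p = (fst p + pi, - snd p)"

text \<open>Two points lie in one orbit of the group generated by the bijection \<^const>\<open>tau\<close>
  iff some forward iterates of them agree.\<close>

definition tau_rel :: "real \<times> real \<Rightarrow> real \<times> real \<Rightarrow> bool" where
  "tau_rel p q \<longleftrightarrow> (\<exists>m n. (tau ^^ m) p = (tau ^^ n) q)"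

quotient_type mobius = "real \<times> real" / tau_rel
proof (rule equivpI)
  show "reflp tau_rel"
    by (auto simp: reflp_def tau_rel_def)
  show "symp tau_rel"
    unfolding symp_def tau_rel_def by (blast intro: sym)
  show "transp tau_rel"
  proof (rule transpI)
    fix p q r
    assume "tau_rel p q" "tau_rel q r"
    then obtain k l m n
      where pq: "(tau ^^ k) p = (tau ^^ l) q" and qr: "(tau ^^ m) q = (tau ^^ n) r"
      unfolding tau_rel_def by blast
    have "(tau ^^ (m + k)) p = (tau ^^ (m + l)) q"
      by (simp add: funpow_add pq)
    also have "\<dots> = (tau ^^ (l + n)) r"
      by (subst add.commute) (simp add: funpow_add qr)
    finally show "tau_rel p r"
      unfolding tau_rel_def by blast
  qed
qed

abbreviation mproj :: "real \<times> real \<Rightarrow> mobius" where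
  "mproj \<equiv> abs_mobius"

instantiation mobius :: topological_space
begin

definition open_mobius :: "mobius set \<Rightarrow> bool" where
  "open_mobius U \<longleftrightarrow> open (mproj -` U)"

instance
proof
  show "open (UNIV :: mobius set)"
    by (simp add: open_mobius_def)
  show "open (U \<inter> V)" if "open U" "open V" for U V :: "mobius set"
    using that by (simp add: open_mobius_def open_Int)
  show "open (\<Union>K)" if "\<forall>U\<in>K. open U" for K :: "mobius set set"
    unfolding open_mobius_def vimage_Union
    using that by (intro open_UN) (simp add: open_mobius_def)
qed

end


section \<open>Pseudoline arrangements with contact points\<close>

definition antiperiodic :: "(real \<Rightarrow> real) \<Rightarrow> bool" where
  "antiperiodic f \<longleftrightarrow> continuous_on UNIV f \<and> (\<forall>x. f (x + pi) = - f x)"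

definition curve :: "(real \<Rightarrow> real) \<Rightarrow> mobius set" where
  "curve f = range (\<lambda>x. mproj (x, f x))"

definition pseudoline :: "mobius set \<Rightarrow> bool" where
  "pseudoline l \<longleftrightarrow> (\<exists>f. antiperiodic f \<and> l = curve f)"

definition crossing_point :: "mobius set \<Rightarrow> mobius set \<Rightarrow> mobius \<Rightarrow> bool" where
  "crossing_point l m p \<longleftrightarrow>
     (\<exists>f g x. antiperiodic f \<and> antiperiodic g \<and> l = curve f \<and> m = curve g \<and>
        p = mproj (x, f x) \<and> f x = g x \<and>
        (\<forall>\<^sub>F h in at_right 0. (f (x - h) - g (x - h)) * (f (x + h) - g (x + h)) < 0))"

definition contact_point :: "mobius set \<Rightarrow> mobius set \<Rightarrow> mobius \<Rightarrow> bool" where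
  "contact_point l m p \<longleftrightarrow>
     (\<exists>f g x. antiperiodic f \<and> antiperiodic g \<and> l = curve f \<and> m = curve g \<and>
        p = mproj (x, f x) \<and> f x = g x \<and>
        (\<forall>\<^sub>F h in at_right 0. (f (x - h) - g (x - h)) * (f (x + h) - g (x + h)) > 0))"

definition arrangement :: "mobius set set \<Rightarrow> bool" where
  "arrangement L \<longleftrightarrow> finite L \<and> (\<forall>l\<in>L. pseudoline l) \<and>
     (\<forall>l\<in>L. \<forall>m\<in>L. l \<noteq> m \<longrightarrow> finite (l \<inter> m) \<and> (\<exists>!p. crossing_point l m p))"

definition simple_arrangement :: "mobius set set \<Rightarrow> bool" where
  "simple_arrangement L \<longleftrightarrow> arrangement L \<and>
     (\<forall>l\<in>L. \<forall>m\<in>L. \<forall>n\<in>L. l \<noteq> m \<longrightarrow> l \<noteq> n \<longrightarrow> m \<noteq> n \<longrightarrow> l \<inter> m \<inter> n = {})"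

abbreviation support :: "mobius set set \<Rightarrow> mobius set" where
  "support L \<equiv> \<Union>L"

definition vertices :: "mobius set set \<Rightarrow> mobius set" where
  "vertices L = {p. \<exists>l\<in>L. \<exists>m\<in>L. l \<noteq> m \<and> p \<in> l \<inter> m}"

definition contacts :: "mobius set set \<Rightarrow> mobius set" where
  "contacts L = {p. \<exists>l\<in>L. \<exists>m\<in>L. l \<noteq> m \<and> contact_point l m p}"


section \<open>Levels and kernels\<close>

text \<open>The external face is the unbounded one, that is, the one contained in no compact
  subset of the strip.\<close>

definition external_face :: "mobius set \<Rightarrow> mobius set" where
  "external_face S = \<Union>{C \<in> components (- S). \<not> (\<exists>K. compact K \<and> C \<subseteq> K)}"

definition first_level :: "mobius set \<Rightarrow> mobius set" where
  "first_level S = frontier (external_face S)"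

text \<open>Removing a level removes its edges.  Since a level also passes through isolated points
  of the remaining curves (its vertices shared with the next level), the set difference
  is completed by taking the closure, so that the kernel is again a union of closed curves.\<close>

fun kernel :: "nat \<Rightarrow> mobius set \<Rightarrow> mobius set" where
  "kernel 0 S = S"
| "kernel (Suc k) S = closure (kernel k S - first_level (kernel k S))"

definition level :: "nat \<Rightarrow> mobius set \<Rightarrow> mobius set" where
  "level j S = first_level (kernel (j - 1) S)"

text \<open>A contact point shared by the levels \<open>k\<close> and \<open>k + 1\<close> is a point, but not a vertex, of the
  \<open>k\<close>-kernel, and is therefore excluded here.\<close>

definition kernel_contacts :: "nat \<Rightarrow> mobius set set \<Rightarrow> mobius set" where
  "kernel_contacts k L = contacts L \<inter> (support L - (\<Union>j\<in>{1..k}. level j (support L)))"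


section \<open>Cuts and increasing flips\<close>

text \<open>Directed paths in the lift of \<open>S\<close> to the plane, oriented by increasing abscissa, are the
  graphs over intervals of continuous functions.\<close>

definition path_le :: "mobius set \<Rightarrow> real \<times> real \<Rightarrow> real \<times> real \<Rightarrow> bool" where
  "path_le S p q \<longleftrightarrow> fst p \<le> fst q \<and>
     (\<exists>g. continuous_on {fst p..fst q} g \<and> g (fst p) = snd p \<and> g (fst q) = snd q \<and>
        (\<forall>x\<in>{fst p..fst q}. mproj (x, g x) \<in> S))"

text \<open>A cut is represented by its filter.\<close>

definition cut_of :: "mobius set set \<Rightarrow> (real \<times> real) set \<Rightarrow> bool" where
  "cut_of L F \<longleftrightarrow> F \<noteq> {} \<and> F \<subset> mproj -` vertices L \<and>
     (\<forall>p\<in>F. \<forall>q\<in>mproj -` vertices L. path_le (support L) p q \<longrightarrow> q \<in> F)"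

text \<open>The cut of a kernel induced by a cut \<open>F\<close> of \<open>L\<close> is the restriction of \<open>F\<close> to the lifted
  vertices of the kernel.  This does not change the representatives of these vertices
  in \<open>F - tau ` F\<close>, so the same \<open>F\<close> is used below for all kernels of \<open>L\<close>.\<close>

definition cut_less :: "(real \<times> real) set \<Rightarrow> mobius set \<Rightarrow> mobius \<Rightarrow> mobius \<Rightarrow> bool" where
  "cut_less F S v w \<longleftrightarrow> v \<noteq> w \<and>
     (\<exists>p\<in>F - tau ` F. \<exists>q\<in>F - tau ` F. mproj p = v \<and> mproj q = w \<and> path_le S p q)"

definition flip :: "mobius set set \<Rightarrow> mobius \<Rightarrow> mobius \<Rightarrow> mobius set set \<Rightarrow> bool" where
  "flip A v w B \<longleftrightarrow>
     (\<exists>l\<in>A. \<exists>m\<in>A. l \<noteq> m \<and> contact_point l m v \<and> crossing_point l m w) \<and>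
     simple_arrangement B \<and> support B = support A \<and> contacts B = (contacts A - {v}) \<union> {w}"

definition arrangements_on :: "mobius set \<Rightarrow> mobius set \<Rightarrow> mobius set set set" where
  "arrangements_on S V = {A. simple_arrangement A \<and> support A = S \<and> V \<subseteq> contacts A}"

definition increasing_flip ::
    "(real \<times> real) set \<Rightarrow> mobius set \<Rightarrow> mobius set set \<Rightarrow> mobius set set \<Rightarrow> bool" where
  "increasing_flip F S A B \<longleftrightarrow> (\<exists>v w. flip A v w B \<and> cut_less F S v w)"

definition is_source ::
    "(real \<times> real) set \<Rightarrow> mobius set \<Rightarrow> mobius set \<Rightarrow> mobius set set \<Rightarrow> bool" where
  "is_source F S V B \<longleftrightarrow> B \<in> arrangements_on S V \<and>
     (\<forall>A\<in>arrangements_on S V. \<not> increasing_flip F S A B)"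

definition greedy_on ::
    "(real \<times> real) set \<Rightarrow> mobius set \<Rightarrow> mobius set \<Rightarrow> mobius set set" where
  "greedy_on F S V = (THE B. is_source F S V B)"

definition greedy :: "(real \<times> real) set \<Rightarrow> nat \<Rightarrow> mobius set set \<Rightarrow> mobius set set" where
  "greedy F k L = greedy_on F (kernel k (support L)) (kernel_contacts k L)"

end

theory Submission
  imports Defs
begin

text \<open>The levels of the arrangement cut a sweep of the strip into a comparator network: the vertices
  joining the levels \<open>j\<close> and \<open>j + 1\<close> act as adjacent transpositions, a pseudoline arrangement with a
  given support is a choice of crossings such that every two wires cross exactly once per period,
  and passing to the \<open>k\<close>-kernel deletes the \<open>k\<close> outermost levels on both sides.

  A source of the graph of increasing flips is greedy: sweeping the window between the cut and its
  translate from right to left, a contact outside the prescribed set \<open>V\<close> only occurs between wires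
  that have crossed already (otherwise their contact and their crossing could be exchanged).  Hence the
  crossings of the source are found by running the vertices outside \<open>V\<close> as comparators, which
  makes the source unique.  The composition law holds since a vertex rejected by the outer network of
  comparators is also rejected by the inner one: whenever two wires of the outer network have
  crossed, the inner network has sorted the labels on the same two levels.\<close>

section \<open>Comparator networks\<close>

text \<open>The second greedy step has to keep more contacts than the direct one: the first step
  creates contacts, and those lying in the deeper kernel are prescribed from then on. A source for
  the larger set is not a priori one for the smaller set, so every added contact has to be shown
  greedy in the inner arrangement. This compares two sorting networks on the same labels, the inner
  one running a subset of the transpositions of the outer one, and is settled by induction on the
  number of swept columns; it relies on the outer network being reduced, that is, exchanging no pair
  of labels twice. Greediness is only derived as a necessary property of a source, which suffices
  for uniqueness. The definite description in \<open>greedy_on\<close> needs a source to exist as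
  well: the comparators on the inner levels end in the full reversal and thus give an admissible
  arrangement on the kernel, and an admissible arrangement whose contacts in the window have the
  least sum of columns cannot be reached by an increasing flip.\<close>

definition sparse :: "nat set \<Rightarrow> bool" where
  "sparse D \<longleftrightarrow> (\<forall>j\<in>D. Suc j \<notin> D)"

text \<open>The product of the transpositions of \<open>a\<close> and \<open>a + 1\<close> for
  \<open>a\<close> in \<open>D\<close>. It is a permutation only for \<open>sparse\<close> sets,
  since otherwise the first branch takes precedence.\<close>

definition swaps :: "nat set \<Rightarrow> nat \<Rightarrow> nat" where
  "swaps D j = (if j \<in> D then Suc j else if 0 < j \<and> j - 1 \<in> D then j - 1 else j)"

lemma swaps_swaps: "sparse D \<Longrightarrow> swaps D (swaps D j) = j"
  unfolding sparse_def swaps_def by (cases j) auto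

lemma swaps_inj: "sparse D \<Longrightarrow> swaps D i = swaps D j \<Longrightarrow> i = j"
  by (metis swaps_swaps)

lemma swaps_less:
  assumes "sparse D" "i < j" "\<not> (i \<in> D \<and> j = Suc i)"
  shows "swaps D i < swaps D j"
proof -
  consider "j = Suc i" | "j = Suc (Suc i)" | "Suc (Suc i) < j"
    using assms(2) by linarith
  then show ?thesis
  proof cases
    case 2
    then show ?thesis
      using assms by (auto simp: swaps_def sparse_def)
  qed (use assms in \<open>auto simp: swaps_def\<close>)
qed

lemma swaps_less_iff:
  assumes "sparse D" "i \<noteq> j" "\<not> (\<exists>a\<in>D. {i, j} = {a, Suc a})"
  shows "swaps D i < swaps D j \<longleftrightarrow> i < j"
proof -
  have "\<not> (i \<in> D \<and> j = Suc i)" "\<not> (j \<in> D \<and> i = Suc j)"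
    using assms(3) by auto
  then show ?thesis
    using swaps_less[OF assms(1), of i j] swaps_less[OF assms(1), of j i] assms(2) by fastforce
qed

text \<open>The label found on a level after the first \<open>u\<close> layers, when the labels
  start as level numbers. A new layer acts on the argument, so \<open>state\<close> maps levels to
  labels; its inverse, from labels to levels, is \<open>level_of\<close>.\<close>

primrec state :: "(nat \<Rightarrow> nat set) \<Rightarrow> nat \<Rightarrow> nat \<Rightarrow> nat" where
  "state D 0 j = j"
| "state D (Suc u) j = state D u (swaps (D u) j)"

lemma state_inj:
  assumes "\<And>u. sparse (D u)"
  shows "state D u i = state D u j \<Longrightarrow> i = j"
  by (induction u arbitrary: i j) (auto dest!: swaps_inj[OF assms])

lemma state_cong: "(\<And>v. v < u \<Longrightarrow> D v = D' v) \<Longrightarrow> state D u j = state D' u j"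
  by (induction u arbitrary: j) auto

lemma swaps_range:
  assumes "D \<subseteq> {j. k \<le> j \<and> Suc j < m}" "k \<le> j" "j < m"
  shows "k \<le> swaps D j \<and> swaps D j < m"
  using assms unfolding swaps_def by (cases j) auto

lemma state_range:
  assumes "\<And>u. D u \<subseteq> {j. k \<le> j \<and> Suc j < m}" "k \<le> j" "j < m"
  shows "k \<le> state D u j \<and> state D u j < m"
  using assms(2,3) by (induction u arbitrary: j) (auto dest: swaps_range[OF assms(1)])

text \<open>\<open>A\<close> is a reduced network, and \<open>B\<close> runs those transpositions of \<open>A\<close> that lie within the levels
  \<open>k..<m\<close> as comparators.\<close>

lemma state_inverted_mono:
  assumes spA: "\<And>u. sparse (A u)"
    and ordA: "\<And>u j. j \<in> A u \<Longrightarrow> state A u j < state A u (Suc j)"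
    and B: "\<And>u j. j \<in> B u \<longleftrightarrow> j \<in> A u \<and> k \<le> j \<and> Suc j < m \<and> state B u j < state B u (Suc j)"
    and "k \<le> i" "i < j" "j < m" "state A u j < state A u i"
  shows "state B u j < state B u i"
  using assms(4-)
proof (induction u arbitrary: i j)
  case 0
  then show ?case by simp
next
  case (Suc u)
  have spB: "sparse (B v)" for v
    using spA[of v] by (simp add: sparse_def B)
  have neB: "state B u a \<noteq> state B u b" if "a \<noteq> b" for a b
    using state_inj[of B u a b] spB that by auto
  have memB: "a \<in> B u \<longleftrightarrow> a \<in> A u \<and> k \<le> a \<and> Suc a < m \<and> state B u a < state B u (Suc a)" for a
    by (rule B)
  have nadj: "Suc a \<notin> A u" if "a \<in> A u" for a
    using spA[of u] that by (auto simp: sparse_def)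
  show ?case
  \<comment> \<open>If \<open>A\<close> exchanges the pair in this very layer, the comparator of
    \<open>B\<close> on it leaves the larger label on the lower level, whether or not it has to
    act.\<close>
  proof (cases "i \<in> A u \<and> j = Suc i")
    case True
    then show ?thesis
      using Suc.prems neB[of i "Suc i"] nadj[of i] memB[of i] memB[of "i - 1"] memB[of "Suc i"]
        nadj[of "i - 1"]
      by (cases i) (auto simp: swaps_def)
  next
    case False
    \<comment> \<open>Level \<open>z\<close> before the layer stands in for level \<open>i\<close>
      after it: its label is not smaller in \<open>A\<close> and not larger in \<open>B\<close>.
      With the dual level \<open>z'\<close> for \<open>j\<close>, the induction hypothesis for
      \<open>z < z'\<close> yields the claim.\<close>
    have "\<exists>z. k \<le> z \<and> z < m \<and> state A (Suc u) i \<le> state A u z \<and> state B u z \<le> state B (Suc u) i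
        \<and> (z \<le> i \<or> z = Suc i \<and> i \<in> A u)"
    proof -
      consider "i \<in> A u" | a where "i \<notin> A u" "i = Suc a" "a \<in> A u"
        | "i \<notin> A u" "\<not> (0 < i \<and> i - 1 \<in> A u)"
        by (cases i) auto
      then show ?thesis
      proof cases
        case 1
        with False Suc.prems have "Suc i < m"
          by auto
        \<comment> \<open>\<open>B\<close> has a comparator on the levels \<open>i\<close> and
          \<open>i + 1\<close>, so level \<open>i\<close> afterwards carries the larger of their two
          labels, hence at least the label found on \<open>i + 1\<close>.\<close>
        with 1 Suc.prems memB[of i] memB[of "i - 1"] nadj[of "i - 1"] neB[of i "Suc i"]
        show ?thesis
          by (intro exI[of _ "Suc i"]) (cases i; auto simp: swaps_def)
      next
        case 2
        \<comment> \<open>Reducedness enters here: \<open>A\<close> moves the smaller label up to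
          \<open>i\<close>, so \<open>i\<close> itself is an admissible choice of \<open>z\<close>
          when \<open>B\<close> does not act.\<close>
        have lt: "state A u a < state A u i"
          using ordA[OF 2(3)] 2(2) by simp
        have ni: "i \<notin> B u"
          using 2 memB by blast
        have sA: "state A (Suc u) i = state A u a"
          using 2 by (simp add: swaps_def)
        show ?thesis
        proof (cases "a \<in> B u")
          case True
          then show ?thesis
            using 2 ni lt Suc.prems memB[of a] sA by (intro exI[of _ a]) (auto simp: swaps_def)
        next
          case False
          then show ?thesis
            using 2 ni lt Suc.prems sA by (intro exI[of _ i]) (auto simp: swaps_def)
        qed
      next
        case 3
        then have "i \<notin> B u" "\<not> (0 < i \<and> i - 1 \<in> B u)"
          using memB by auto
        with 3 Suc.prems show ?thesis
          by (intro exI[of _ i]) (auto simp: swaps_def)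
      qed
    qed
    then obtain z where z: "k \<le> z" "z < m" "state A (Suc u) i \<le> state A u z"
      "state B u z \<le> state B (Suc u) i" "z \<le> i \<or> z = Suc i \<and> i \<in> A u"
      by blast
    have "\<exists>z. k \<le> z \<and> z < m \<and> state A u z \<le> state A (Suc u) j \<and> state B (Suc u) j \<le> state B u z
        \<and> (j \<le> z \<or> j = Suc z \<and> z \<in> A u)"
    proof -
      consider "j \<in> A u" | a where "j \<notin> A u" "j = Suc a" "a \<in> A u"
        | "j \<notin> A u" "\<not> (0 < j \<and> j - 1 \<in> A u)"
        by (cases j) auto
      then show ?thesis
      proof cases
        case 1
        have lt: "state A u j < state A u (Suc j)"
          using ordA[OF 1] .
        have sA: "state A (Suc u) j = state A u (Suc j)"
          using 1 by (simp add: swaps_def)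
        have nj: "\<not> (0 < j \<and> j - 1 \<in> B u)"
          using memB[of "j - 1"] nadj[of "j - 1"] 1 by (cases j) auto
        show ?thesis
        proof (cases "j \<in> B u")
          case True
          then show ?thesis
            using 1 lt Suc.prems memB[of j] sA by (intro exI[of _ "Suc j"]) (auto simp: swaps_def)
        next
          case False
          then show ?thesis
            using 1 nj lt Suc.prems sA by (intro exI[of _ j]) (auto simp: swaps_def)
        qed
      next
        case 2
        with False Suc.prems have "k \<le> a"
          by auto
        with 2 Suc.prems memB[of a] memB[of j] neB[of a "Suc a"] show ?thesis
          by (intro exI[of _ a]) (auto simp: swaps_def)
      next
        case 3
        then have "j \<notin> B u" "\<not> (0 < j \<and> j - 1 \<in> B u)"
          using memB by auto
        with 3 Suc.prems show ?thesis
          by (intro exI[of _ j]) (auto simp: swaps_def)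
      qed
    qed
    then obtain z' where z': "k \<le> z'" "z' < m" "state A u z' \<le> state A (Suc u) j"
      "state B (Suc u) j \<le> state B u z'" "j \<le> z' \<or> j = Suc z' \<and> z' \<in> A u"
      by blast
    \<comment> \<open>Each of \<open>z\<close> and \<open>z'\<close> moves at most one level towards
      the other. Sparseness and the excluded case that \<open>A\<close> exchanges \<open>i\<close>
      and \<open>j\<close> themselves keep them from meeting or passing.\<close>
    have "z < z'"
      using z(5) z'(5) False Suc.prems(2) nadj[of i]
      by (cases "z' = i"; cases "z' = Suc i"; auto)
    then have "state B u z' < state B u z"
      using Suc.IH[of z z'] Suc.prems(4) z z' by simp
    with z z' show ?thesis
      by simp
  qed
qed

section \<open>Wirings of a periodic network\<close>

lemma periodic_dvd:
  fixes r :: int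
  assumes "\<And>i. P (i + r) \<longleftrightarrow> P i" "r dvd i - p"
  shows "P i \<longleftrightarrow> P p"
proof -
  obtain m where m: "i = p + r * m"
    using assms(2) by (metis add.commute diff_add_cancel dvdE)
  have "P (p + r * m) \<longleftrightarrow> P p"
  proof (induction m rule: int_induct[where k = 0])
    case (step1 m)
    then show ?case using assms(1)[of "p + r * m"] by (simp add: algebra_simps)
  next
    case (step2 m)
    then show ?case using assms(1)[of "p + r * (m - 1)"] by (simp add: algebra_simps)
  qed simp
  with m show ?thesis by simp
qed

definition crosses_at :: "(int \<Rightarrow> nat) \<Rightarrow> (int \<Rightarrow> nat) \<Rightarrow> int \<Rightarrow> bool" where
  "crosses_at \<alpha> \<beta> i \<longleftrightarrow> (\<alpha> (i - 1) < \<beta> (i - 1)) \<noteq> (\<alpha> i < \<beta> i)"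

text \<open>Only the rising wire is recorded; the falling one is forced, because every level is
  occupied exactly once (\<open>step_swaps\<close>).\<close>

definition crossings :: "(int \<Rightarrow> nat) set \<Rightarrow> (int \<times> nat) set" where
  "crossings \<Lambda> = {(i, j). \<exists>\<alpha>\<in>\<Lambda>. \<alpha> (i - 1) = j \<and> \<alpha> i = Suc j}"

text \<open>The combinatorial model: column \<open>i\<close> of an \<open>n\<close>-level network carries the vertices joining
  the levels \<open>j\<close> and \<open>j + 1\<close> with \<open>(i, j) \<in> W\<close>, and the translation by \<open>r\<close> columns together
  with the reflection of the levels plays the role of tau.  A wire \<open>\<alpha>\<close> runs on
  level \<open>\<alpha> i\<close> between the columns \<open>i\<close> and \<open>i + 1\<close>.\<close>

locale network =
  fixes n :: nat and r :: int and W :: "(int \<times> nat) set"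
  assumes r_pos: "0 < r"
    and W_less: "(i, j) \<in> W \<Longrightarrow> Suc j < n"
    and W_sparse: "(i, j) \<in> W \<Longrightarrow> (i, Suc j) \<notin> W"
    and W_shift: "Suc j < n \<Longrightarrow> (i + r, n - 2 - j) \<in> W \<longleftrightarrow> (i, j) \<in> W"
begin

definition prewiring :: "nat \<Rightarrow> (int \<Rightarrow> nat) set \<Rightarrow> bool" where
  "prewiring k \<Lambda> \<longleftrightarrow>
    (\<forall>\<alpha>\<in>\<Lambda>. \<forall>i. k \<le> \<alpha> i \<and> \<alpha> i < n - k \<and> \<alpha> (i + r) = n - 1 - \<alpha> i) \<and>
    (\<forall>\<alpha>\<in>\<Lambda>. \<forall>i. \<alpha> i = \<alpha> (i - 1) \<or> \<alpha> i = Suc (\<alpha> (i - 1)) \<and> (i, \<alpha> (i - 1)) \<in> W \<or>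
        \<alpha> (i - 1) = Suc (\<alpha> i) \<and> (i, \<alpha> i) \<in> W) \<and>
    (\<forall>i j. k \<le> j \<and> j < n - k \<longrightarrow> (\<exists>!\<alpha>. \<alpha> \<in> \<Lambda> \<and> \<alpha> i = j))"

definition wiring :: "nat \<Rightarrow> (int \<Rightarrow> nat) set \<Rightarrow> bool" where
  "wiring k \<Lambda> \<longleftrightarrow> prewiring k \<Lambda> \<and>
    (\<forall>\<alpha>\<in>\<Lambda>. \<forall>\<beta>\<in>\<Lambda>. \<alpha> \<noteq> \<beta> \<longrightarrow> (\<exists>c. \<forall>i. crosses_at \<alpha> \<beta> i \<longleftrightarrow> r dvd i - c))"

definition vertices_in :: "nat \<Rightarrow> (int \<times> nat) set" where
  "vertices_in k = {(i, j) \<in> W. k \<le> j \<and> Suc j < n - k}"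

definition wcontacts :: "nat \<Rightarrow> (int \<Rightarrow> nat) set \<Rightarrow> (int \<times> nat) set" where
  "wcontacts k \<Lambda> = vertices_in k - crossings \<Lambda>"

end

text \<open>The consequences of the local conditions are kept apart from the crossing condition: for
  an arrangement of curves the latter can be read off only after its wires are known to trace the
  curves.\<close>

locale prewires = network +
  fixes k :: nat and \<Lambda> :: "(int \<Rightarrow> nat) set"
  assumes prewiring: "prewiring k \<Lambda>"
begin

lemma range: "\<alpha> \<in> \<Lambda> \<Longrightarrow> k \<le> \<alpha> i \<and> \<alpha> i < n - k"
  and shift: "\<alpha> \<in> \<Lambda> \<Longrightarrow> \<alpha> (i + r) = n - 1 - \<alpha> i"
  and step: "\<alpha> \<in> \<Lambda> \<Longrightarrow> \<alpha> i = \<alpha> (i - 1) \<or> \<alpha> i = Suc (\<alpha> (i - 1)) \<and> (i, \<alpha> (i - 1)) \<in> W \<or>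
        \<alpha> (i - 1) = Suc (\<alpha> i) \<and> (i, \<alpha> i) \<in> W"
  and wire_ex1: "k \<le> j \<Longrightarrow> j < n - k \<Longrightarrow> \<exists>!\<alpha>. \<alpha> \<in> \<Lambda> \<and> \<alpha> i = j"
  using prewiring unfolding prewiring_def by blast+

lemma wire_unique: "\<alpha> \<in> \<Lambda> \<Longrightarrow> \<beta> \<in> \<Lambda> \<Longrightarrow> \<alpha> i = \<beta> i \<Longrightarrow> \<alpha> = \<beta>"
  using wire_ex1[of "\<alpha> i" i] range[of \<alpha> i] by metis

lemma wire_neq: "\<alpha> \<in> \<Lambda> \<Longrightarrow> \<beta> \<in> \<Lambda> \<Longrightarrow> \<alpha> i \<noteq> \<beta> i \<Longrightarrow> \<alpha> i' \<noteq> \<beta> i'"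
  using wire_unique by blast

lemma obtain_wire:
  assumes "k \<le> j" "j < n - k"
  obtains \<alpha> where "\<alpha> \<in> \<Lambda>" "\<alpha> i = j"
  using wire_ex1[OF assms, of i] by blast

lemma shift_min:
  assumes "\<alpha> \<in> \<Lambda>" "\<beta> \<in> \<Lambda>" "\<alpha> i = Suc (\<beta> i) \<or> \<beta> i = Suc (\<alpha> i)"
  shows "min (\<alpha> (i + r)) (\<beta> (i + r)) = n - 2 - min (\<alpha> i) (\<beta> i)"
    "\<alpha> (i + r) = Suc (\<beta> (i + r)) \<or> \<beta> (i + r) = Suc (\<alpha> (i + r))"
  using shift[OF assms(1)] shift[OF assms(2)] range[OF assms(1), of i] range[OF assms(2), of i] assms(3)
  by (auto simp: min_def)

lemma crosses_at_sym:
  "\<alpha> \<in> \<Lambda> \<Longrightarrow> \<beta> \<in> \<Lambda> \<Longrightarrow> \<alpha> \<noteq> \<beta> \<Longrightarrow> crosses_at \<beta> \<alpha> i \<longleftrightarrow> crosses_at \<alpha> \<beta> i"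
  using wire_unique[of \<alpha> \<beta> i] wire_unique[of \<alpha> \<beta> "i - 1"] unfolding crosses_at_def by linarith

lemma crossing_steps:
  assumes "\<alpha> \<in> \<Lambda>" "\<beta> \<in> \<Lambda>" "\<alpha> (i - 1) < \<beta> (i - 1)" "\<beta> i < \<alpha> i"
  shows "\<alpha> i = Suc (\<beta> i)" "\<alpha> (i - 1) = \<beta> i" "\<beta> (i - 1) = \<alpha> i" "(i, \<beta> i) \<in> W"
proof -
  have "\<alpha> i = Suc (\<beta> i) \<and> \<alpha> (i - 1) = \<beta> i \<and> \<beta> (i - 1) = \<alpha> i \<and> (i, \<beta> i) \<in> W"
    using step[OF assms(1), of i] step[OF assms(2), of i] assms(3,4) by (elim disjE conjE; simp)
  then show "\<alpha> i = Suc (\<beta> i)" "\<alpha> (i - 1) = \<beta> i" "\<beta> (i - 1) = \<alpha> i" "(i, \<beta> i) \<in> W"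
    by blast+
qed

lemma crosses_at_steps:
  assumes "\<alpha> \<in> \<Lambda>" "\<beta> \<in> \<Lambda>" "crosses_at \<alpha> \<beta> i"
  shows "\<alpha> i = \<beta> (i - 1)" "\<beta> i = \<alpha> (i - 1)" "\<alpha> i = Suc (\<beta> i) \<or> \<beta> i = Suc (\<alpha> i)"
    "(i, min (\<alpha> i) (\<beta> i)) \<in> W"
proof -
  have "\<alpha> \<noteq> \<beta>"
    using assms(3) by (auto simp: crosses_at_def)
  then have "\<alpha> i \<noteq> \<beta> i" "\<alpha> (i - 1) \<noteq> \<beta> (i - 1)"
    using wire_unique[OF assms(1,2)] by blast+
  then consider "\<alpha> (i - 1) < \<beta> (i - 1)" "\<beta> i < \<alpha> i" | "\<beta> (i - 1) < \<alpha> (i - 1)" "\<alpha> i < \<beta> i"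
    using assms(3) unfolding crosses_at_def by linarith
  then have "\<alpha> i = \<beta> (i - 1) \<and> \<beta> i = \<alpha> (i - 1) \<and> (\<alpha> i = Suc (\<beta> i) \<or> \<beta> i = Suc (\<alpha> i)) \<and>
    (i, min (\<alpha> i) (\<beta> i)) \<in> W"
    by cases (use crossing_steps[OF assms(1,2), of i] crossing_steps[OF assms(2,1), of i] in \<open>simp_all add: min_def\<close>)
  then show "\<alpha> i = \<beta> (i - 1)" "\<beta> i = \<alpha> (i - 1)" "\<alpha> i = Suc (\<beta> i) \<or> \<beta> i = Suc (\<alpha> i)"
    "(i, min (\<alpha> i) (\<beta> i)) \<in> W"
    by blast+
qed

lemma crossings_W: "(i, j) \<in> crossings \<Lambda> \<Longrightarrow> (i, j) \<in> vertices_in k"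
proof -
  assume "(i, j) \<in> crossings \<Lambda>"
  then obtain \<alpha> where l: "\<alpha> \<in> \<Lambda>" "\<alpha> (i - 1) = j" "\<alpha> i = Suc j"
    by (auto simp: crossings_def)
  then show ?thesis
    using step[OF l(1), of i] range[OF l(1), of i] range[OF l(1), of "i - 1"]
    by (auto simp: vertices_in_def)
qed

lemma crossings_iff_crosses_at:
  assumes "\<alpha> \<in> \<Lambda>" "\<beta> \<in> \<Lambda>" "\<alpha> i = j" "\<beta> i = Suc j"
  shows "(i, j) \<in> crossings \<Lambda> \<longleftrightarrow> crosses_at \<alpha> \<beta> i"
proof
  assume "(i, j) \<in> crossings \<Lambda>"
  then obtain \<gamma> where n: "\<gamma> \<in> \<Lambda>" "\<gamma> (i - 1) = j" "\<gamma> i = Suc j"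
    by (auto simp: crossings_def)
  then have "\<gamma> = \<beta>"
    using wire_unique[OF n(1) assms(2), of i] assms(4) by simp
  moreover have "\<alpha> (i - 1) \<noteq> j"
    using wire_neq[OF n(1) assms(1), of i "i - 1"] n(2,3) assms(3) by simp
  ultimately show "crosses_at \<alpha> \<beta> i"
    using step[OF assms(1), of i] n assms(3) W_sparse[of i "\<alpha> (i - 1)"] crossings_W[of i j]
      \<open>(i, j) \<in> crossings \<Lambda>\<close>
    by (auto simp: crosses_at_def vertices_in_def)
next
  assume "crosses_at \<alpha> \<beta> i"
  then show "(i, j) \<in> crossings \<Lambda>"
    using crosses_at_steps[OF assms(1,2)] assms unfolding crossings_def by auto
qed

lemma sparse_crossings: "sparse {j. (i, j) \<in> crossings \<Lambda>}"
  using crossings_W W_sparse unfolding sparse_def vertices_in_def by blast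

text \<open>The critical case is a wire falling to level \<open>j - 1\<close> without a recorded
  crossing. The wire coming from \<open>j - 1\<close> must leave that level and, \<open>W\<close>
  being sparse, can only rise to \<open>j\<close>; so it is the rising wire of a crossing after
  all.\<close>

lemma step_swaps:
  assumes "\<alpha> \<in> \<Lambda>"
  shows "\<alpha> i = swaps {j. (i, j) \<in> crossings \<Lambda>} (\<alpha> (i - 1))"
proof -
  let ?X = "{j. (i, j) \<in> crossings \<Lambda>}"
  define j where "j = \<alpha> (i - 1)"
  consider "j \<in> ?X" | a where "j \<notin> ?X" "j = Suc a" "a \<in> ?X" | "j \<notin> ?X" "\<not> (0 < j \<and> j - 1 \<in> ?X)"
    by (cases j) auto
  then show ?thesis
  proof cases
    case 1
    then obtain \<gamma> where n: "\<gamma> \<in> \<Lambda>" "\<gamma> (i - 1) = j" "\<gamma> i = Suc j"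
      by (auto simp: crossings_def)
    then have "\<gamma> = \<alpha>"
      using wire_unique[OF n(1) assms, of "i - 1"] j_def by simp
    with n 1 show ?thesis
      by (simp add: swaps_def flip: j_def)
  next
    case 2
    from 2(3) obtain \<gamma> where n: "\<gamma> \<in> \<Lambda>" "\<gamma> (i - 1) = a" "\<gamma> i = Suc a"
      by (auto simp: crossings_def)
    have "\<alpha> i \<noteq> Suc a"
      using wire_neq[OF n(1) assms, of "i - 1" i] n(2,3) 2(2) j_def by simp
    moreover have "(i, a) \<in> W"
      using 2 crossings_W by (auto simp: vertices_in_def)
    ultimately have "\<alpha> i = a"
      using step[OF assms, of i] 2 W_sparse[of i a] by (auto simp flip: j_def)
    with 2 show ?thesis
      by (simp add: swaps_def flip: j_def)
  next
    case 3
    have "\<alpha> i = j"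
    proof (rule ccontr)
      assume "\<alpha> i \<noteq> j"
      moreover have "\<not> (\<alpha> i = Suc j)"
        using 3 assms by (auto simp: crossings_def j_def)
      ultimately have d: "j = Suc (\<alpha> i)" "(i, \<alpha> i) \<in> W"
        using step[OF assms, of i] by (auto simp flip: j_def)
      obtain \<gamma> where n: "\<gamma> \<in> \<Lambda>" "\<gamma> (i - 1) = \<alpha> i"
        using obtain_wire range[OF assms, of i] by metis
      have "\<gamma> i \<noteq> \<alpha> i"
        using wire_neq[OF n(1) assms, of "i - 1" i] d(1) n(2) j_def by simp
      moreover have "\<gamma> (i - 1) \<noteq> Suc (\<gamma> i)"
      proof
        assume e: "\<gamma> (i - 1) = Suc (\<gamma> i)"
        then have "(i, \<gamma> i) \<in> W"
          using step[OF n(1), of i] by simp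
        then show False
          using W_sparse[of i "\<gamma> i"] e n(2) d(2) by simp
      qed
      ultimately have "\<gamma> i = Suc (\<alpha> i)"
        using step[OF n(1), of i] n(2) by metis
      then have "\<alpha> i \<in> ?X"
        using n by (auto simp: crossings_def)
      with 3 d show False by auto
    qed
    with 3 show ?thesis
      by (auto simp: swaps_def simp flip: j_def)
  qed
qed

lemma step_swaps': "\<alpha> \<in> \<Lambda> \<Longrightarrow> \<alpha> (i - 1) = swaps {j. (i, j) \<in> crossings \<Lambda>} (\<alpha> i)"
  by (subst step_swaps[of \<alpha> i]) (simp_all add: swaps_swaps sparse_crossings)

end

locale wires = network +
  fixes k :: nat and \<Lambda> :: "(int \<Rightarrow> nat) set"
  assumes wiring: "wiring k \<Lambda>"
begin

sublocale prewires n r W k \<Lambda>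
  using wiring by unfold_locales (simp add: wiring_def)

lemma crosses_once: "\<alpha> \<in> \<Lambda> \<Longrightarrow> \<beta> \<in> \<Lambda> \<Longrightarrow> \<alpha> \<noteq> \<beta> \<Longrightarrow> \<exists>c. \<forall>i. crosses_at \<alpha> \<beta> i \<longleftrightarrow> r dvd i - c"
  using wiring unfolding wiring_def by blast

end

context network begin

text \<open>The complement of the contacts gives the crossings, and \<open>step_swaps\<close>
  rebuilds each wire from them, starting at column 0 and going in both directions.\<close>

lemma wiring_determined:
  assumes "wiring k \<Lambda>" "wiring k \<Lambda>'" "wcontacts k \<Lambda> = wcontacts k \<Lambda>'"
  shows "\<Lambda> = \<Lambda>'"
proof -
  have sub: "\<Lambda> \<subseteq> \<Lambda>'"
    if a: "wiring k \<Lambda>" "wiring k \<Lambda>'" "wcontacts k \<Lambda> = wcontacts k \<Lambda>'" for \<Lambda> \<Lambda>'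
  proof
    interpret A: wires n r W k \<Lambda> using a(1) by unfold_locales
    interpret B: wires n r W k \<Lambda>' using a(2) by unfold_locales
    have X: "crossings \<Lambda> = crossings \<Lambda>'"
      using a(3) A.crossings_W B.crossings_W unfolding wcontacts_def by auto
    fix \<alpha> assume l: "\<alpha> \<in> \<Lambda>"
    obtain \<beta> where m: "\<beta> \<in> \<Lambda>'" "\<beta> 0 = \<alpha> 0"
      using B.obtain_wire A.range[OF l, of 0] by metis
    have "\<beta> i = \<alpha> i" for i
    proof (induction i rule: int_induct[where k = 0])
      case (step1 i)
      then show ?case
        using A.step_swaps[OF l, of "i + 1"] B.step_swaps[OF m(1), of "i + 1"] X by simp
    next
      case (step2 i)
      then show ?case
        using A.step_swaps'[OF l, of i] B.step_swaps'[OF m(1), of i] X by simp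
    qed (use m in simp)
    then show "\<alpha> \<in> \<Lambda>'"
      using m by (metis ext)
  qed
  show ?thesis
    using sub[OF assms] sub[OF assms(2,1) assms(3)[symmetric]] by blast
qed

end

section \<open>Exchanging a crossing and a contact of two wires\<close>

lemma window_boundary:
  fixes p q r :: int
  assumes "0 < r" "p < q" "q < p + r"
  defines "w \<equiv> \<lambda>i. (i - p) mod r < q - p"
  shows "r dvd i - p \<Longrightarrow> w i \<and> \<not> w (i - 1)"
    and "r dvd i - q \<Longrightarrow> \<not> w i \<and> w (i - 1)"
    and "\<not> r dvd i - p \<Longrightarrow> \<not> r dvd i - q \<Longrightarrow> w (i - 1) = w i"
    and "w (i + r) = w i"
proof -
  define m where "m = (i - p) mod r"
  have m: "0 \<le> m" "m < r"
    using assms(1) by (simp_all add: m_def)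
  have "(i - 1 - p) mod r = (m - 1) mod r"
    unfolding m_def by (simp add: mod_diff_left_eq algebra_simps)
  then have m1: "(i - 1 - p) mod r = (if m = 0 then r - 1 else m - 1)"
    using m by (auto simp: zmod_minus1)
  have p: "r dvd i - p \<longleftrightarrow> m = 0"
    by (simp add: m_def dvd_eq_mod_eq_0)
  have "r dvd i - q \<longleftrightarrow> (i - p) mod r = (q - p) mod r"
    by (simp add: mod_eq_dvd_iff)
  then have q: "r dvd i - q \<longleftrightarrow> m = q - p"
    using assms(2,3) by (simp add: m_def)
  show "r dvd i - p \<Longrightarrow> w i \<and> \<not> w (i - 1)"
    "r dvd i - q \<Longrightarrow> \<not> w i \<and> w (i - 1)"
    "\<not> r dvd i - p \<Longrightarrow> \<not> r dvd i - q \<Longrightarrow> w (i - 1) = w i"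
    using m m1 assms(2,3) unfolding w_def p q by (auto simp flip: m_def)
  have "(i + r - p) mod r = (i - p) mod r"
    by (metis add_diff_eq add.commute diff_add_eq mod_add_self2)
  then show "w (i + r) = w i"
    by (simp add: w_def)
qed

text \<open>A counting argument: two disjoint nonempty unions of residue classes that together fill
  at most two classes consist of one class each.\<close>

lemma periodic_class:
  fixes r :: int
  assumes "\<And>i. C (i + r) \<longleftrightarrow> C i" "\<And>i. C' (i + r) \<longleftrightarrow> C' i" "C a" "C' b"
    and disj: "\<And>i. \<not> (C i \<and> C' i)"
    and un: "\<And>i. C i \<or> C' i \<longleftrightarrow> r dvd i - c \<or> r dvd i - d"
  shows "\<exists>e. \<forall>i. C i \<longleftrightarrow> r dvd i - e"
proof -
  have sub: "C i" if "r dvd i - e" "C e'" "r dvd e' - e" for i e e'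
    using periodic_dvd[of C r i e, OF assms(1)] periodic_dvd[of C r e' e, OF assms(1)] that by blast
  have sub': "C' i" if "r dvd i - e" "C' e'" "r dvd e' - e" for i e e'
    using periodic_dvd[of C' r i e, OF assms(2)] periodic_dvd[of C' r e' e, OF assms(2)] that by blast
  show ?thesis
    using sub sub' disj un assms(3,4) by metis
qed

context network begin

lemma crosses_at_shift:
  assumes "\<And>i. \<alpha> (i + r) = n - 1 - \<alpha> i" "\<And>i. \<beta> (i + r) = n - 1 - \<beta> i"
    and "\<And>i. \<alpha> i < n" "\<And>i. \<beta> i < n" "\<And>i. \<alpha> i \<noteq> \<beta> i"
  shows "crosses_at \<alpha> \<beta> (i + r) \<longleftrightarrow> crosses_at \<alpha> \<beta> i"
proof -
  have "\<alpha> (i + r) < \<beta> (i + r) \<longleftrightarrow> \<not> \<alpha> i < \<beta> i" for i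
    using assms(1)[of i] assms(2)[of i] assms(3)[of i] assms(4)[of i] assms(5)[of i] by linarith
  from this[of i] this[of "i - 1"] show ?thesis
    by (simp add: crosses_at_def algebra_simps)
qed

text \<open>After one period the reflection has reversed the order of the two levels, which is
  impossible for a pair that never crosses.\<close>

lemma crosses_at_ex:
  assumes "\<alpha> r = n - 1 - \<alpha> 0" "\<beta> r = n - 1 - \<beta> 0" "\<alpha> 0 < n" "\<beta> 0 < n" "\<alpha> 0 \<noteq> \<beta> 0"
  shows "\<exists>i. crosses_at \<alpha> \<beta> i"
proof (rule ccontr)
  assume "\<not> ?thesis"
  then have c: "\<alpha> (i - 1) < \<beta> (i - 1) \<longleftrightarrow> \<alpha> i < \<beta> i" for i
    by (auto simp: crosses_at_def)
  have "\<alpha> (int i) < \<beta> (int i) \<longleftrightarrow> \<alpha> 0 < \<beta> 0" for i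
    by (induction i) (use c[of "1 + int _"] in auto)
  from this[of "nat r"] show False
    using assms r_pos by simp linarith
qed

end

context wires begin

lemma contact_steps:
  assumes "\<alpha> \<in> \<Lambda>" "\<beta> \<in> \<Lambda>" "\<alpha> i = Suc (\<beta> i) \<or> \<beta> i = Suc (\<alpha> i)" "(i, min (\<alpha> i) (\<beta> i)) \<in> W"
    and "\<not> crosses_at \<alpha> \<beta> i"
  shows "\<alpha> (i - 1) = \<alpha> i \<and> \<beta> (i - 1) = \<beta> i"
proof -
  have *: "\<alpha> (i - 1) = \<alpha> i \<and> \<beta> (i - 1) = \<beta> i"
    if a: "\<alpha> \<in> \<Lambda>" "\<beta> \<in> \<Lambda>" "\<beta> i = Suc (\<alpha> i)" "(i, \<alpha> i) \<in> W" "\<not> crosses_at \<alpha> \<beta> i" for \<alpha> \<beta>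
  proof -
    have X: "(i, \<alpha> i) \<notin> crossings \<Lambda>"
      using crossings_iff_crosses_at[OF a(1,2) refl a(3)] a(5) by simp
    have X1: "(i, Suc (\<alpha> i)) \<notin> crossings \<Lambda>"
      using a(4) W_sparse crossings_W by (fastforce simp: vertices_in_def)
    have X2: "(i, \<alpha> i - 1) \<notin> crossings \<Lambda>" if "0 < \<alpha> i"
      using a(4) W_sparse[of i "\<alpha> i - 1"] crossings_W[of i "\<alpha> i - 1"] that
      by (auto simp: vertices_in_def)
    show ?thesis
      using step_swaps'[OF a(1), of i] step_swaps'[OF a(2), of i] X X1 X2 a(3)
      by (auto simp: swaps_def split: if_splits)
  qed
  have "\<alpha> \<noteq> \<beta>"
    using assms(3) by auto
  with assms(3) show ?thesis
    using *[OF assms(1,2)] *[OF assms(2,1)] assms(4,5) crosses_at_sym[OF assms(1,2), of i]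
    by (auto simp: min_def)
qed

lemma crossings_shift:
  assumes "(i, j) \<in> W"
  shows "(i + r, n - 2 - j) \<in> crossings \<Lambda> \<longleftrightarrow> (i, j) \<in> crossings \<Lambda>"
proof (cases "k \<le> j \<and> Suc j < n - k")
  case True
  obtain \<alpha> \<beta> where L: "\<alpha> \<in> \<Lambda>" "\<alpha> i = j" "\<beta> \<in> \<Lambda>" "\<beta> i = Suc j"
    using obtain_wire[of j i] obtain_wire[of "Suc j" i] True by (metis Suc_lessD le_Suc_eq)
  then have ne: "\<alpha> \<noteq> \<beta>" by auto
  have "\<beta> (i + r) = n - 2 - j" "\<alpha> (i + r) = Suc (n - 2 - j)"
    using shift[OF L(1), of i] shift[OF L(3), of i] L True by auto
  then have "(i + r, n - 2 - j) \<in> crossings \<Lambda> \<longleftrightarrow> crosses_at \<beta> \<alpha> (i + r)"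
    using crossings_iff_crosses_at L by blast
  also have "\<dots> \<longleftrightarrow> crosses_at \<beta> \<alpha> i"
  proof (rule crosses_at_shift)
    show "\<beta> i \<noteq> \<alpha> i" for i
      using wire_unique[OF L(3,1), of i] ne by blast
  next
    show "\<beta> i < n" "\<alpha> i < n" for i
      using range[OF L(1), of i] range[OF L(3), of i] by auto
  qed (use shift L in blast)+
  also have "\<dots> \<longleftrightarrow> (i, j) \<in> crossings \<Lambda>"
    using crosses_at_sym[OF L(1,3) ne, of i] crossings_iff_crosses_at[OF L(1,3,2,4)] by simp
  finally show ?thesis .
next
  case False
  then show ?thesis
    using crossings_W[of i j] crossings_W[of "i + r" "n - 2 - j"] W_less[OF assms]
    by (auto simp: vertices_in_def)
qed

text \<open>The two wires exchange their courses on the sections from \<open>p\<close> up to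
  \<open>q - 1\<close> and on all translates of this interval, so their crossing moves from the
  class of \<open>p\<close> to that of \<open>q\<close>. A third wire crosses the union of the two
  as before; its two classes of crossings are only redistributed. Since antiperiodicity forces a
  crossing with each of the new wires, each gets exactly one class.\<close>

lemma swap_wires:
  assumes A: "\<alpha> \<in> \<Lambda>" and B: "\<beta> \<in> \<Lambda>" and cp: "crosses_at \<alpha> \<beta> p" and cq: "\<not> crosses_at \<alpha> \<beta> q"
    and adj: "\<alpha> q = Suc (\<beta> q) \<or> \<beta> q = Suc (\<alpha> q)" and Wq: "(q, min (\<alpha> q) (\<beta> q)) \<in> W"
    and pq: "p < q" "q < p + r"
  obtains \<Lambda>' \<alpha>' \<beta>' where "wiring k \<Lambda>'" "\<alpha>' \<in> \<Lambda>'" "\<beta>' \<in> \<Lambda>'" "crosses_at \<alpha>' \<beta>' q" "\<not> crosses_at \<alpha>' \<beta>' p"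
    "\<And>i. {\<alpha>' i, \<beta>' i} = {\<alpha> i, \<beta> i}"
    "crossings \<Lambda>' = crossings \<Lambda> - {(i, min (\<alpha> i) (\<beta> i)) |i. r dvd i - p} \<union>
       {(i, min (\<alpha> i) (\<beta> i)) |i. r dvd i - q}"
proof -
  define w where "w i \<longleftrightarrow> (i - p) mod r < q - p" for i
  note win = window_boundary[OF r_pos pq, folded w_def]
  define \<alpha>' where "\<alpha>' i = (if w i then \<beta> i else \<alpha> i)" for i
  define \<beta>' where "\<beta>' i = (if w i then \<alpha> i else \<beta> i)" for i
  define \<Lambda>' where "\<Lambda>' = \<Lambda> - {\<alpha>, \<beta>} \<union> {\<alpha>', \<beta>'}"
  have ne: "\<alpha> \<noteq> \<beta>"
    using cp by (auto simp: crosses_at_def)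
  have neq: "\<alpha> i \<noteq> \<beta> i" for i
    using wire_unique[OF A B, of i] ne by blast
  have neq': "\<gamma> i \<noteq> \<alpha> i" "\<gamma> i \<noteq> \<beta> i" if "\<gamma> \<in> \<Lambda> - {\<alpha>, \<beta>}" for \<gamma> i
    using wire_unique[of \<gamma> \<alpha> i] wire_unique[of \<gamma> \<beta> i] A B that by blast+
  obtain c where c: "crosses_at \<alpha> \<beta> i \<longleftrightarrow> r dvd i - c" for i
    using crosses_once[OF A B ne] by blast
  have P: "crosses_at \<alpha> \<beta> i \<longleftrightarrow> r dvd i - p" for i
  proof -
    have "r dvd p - c"
      using c cp by simp
    then have "r dvd i - c \<longleftrightarrow> r dvd i - p"
      by (metis diff_diff_eq2 dvd_diff dvd_diff_commute diff_add_cancel dvd_add_left_iff add_diff_eq)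
    then show ?thesis using c by simp
  qed
  have sh: "crosses_at \<alpha> \<beta> (i + r) \<longleftrightarrow> crosses_at \<alpha> \<beta> i" for i
  proof -
    have "r dvd (i - p) + r \<longleftrightarrow> r dvd i - p"
      by simp
    moreover have "(i - p) + r = (i + r) - p"
      by simp
    ultimately show ?thesis
      using P[of i] P[of "i + r"] by simp
  qed
  let ?Q = "\<lambda>i. \<not> crosses_at \<alpha> \<beta> i \<and> (\<alpha> i = Suc (\<beta> i) \<or> \<beta> i = Suc (\<alpha> i)) \<and> (i, min (\<alpha> i) (\<beta> i)) \<in> W"
  have "?Q (i + r) \<longleftrightarrow> ?Q i" for i
  proof -
    have "(\<alpha> i = Suc (\<beta> i) \<or> \<beta> i = Suc (\<alpha> i)) \<longleftrightarrow>
        (\<alpha> (i + r) = Suc (\<beta> (i + r)) \<or> \<beta> (i + r) = Suc (\<alpha> (i + r)))"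
      using shift[OF A, of i] shift[OF B, of i] range[OF A, of i] range[OF B, of i] by auto
    moreover have "(i + r, min (\<alpha> (i + r)) (\<beta> (i + r))) \<in> W \<longleftrightarrow> (i, min (\<alpha> i) (\<beta> i)) \<in> W"
      if "\<alpha> i = Suc (\<beta> i) \<or> \<beta> i = Suc (\<alpha> i)"
      using shift_min(1)[OF A B that] that W_shift[of "min (\<alpha> i) (\<beta> i)" i]
        range[OF A, of i] range[OF B, of i] by (auto simp: min_def)
    ultimately show ?thesis
      using sh[of i] by blast
  qed
  then have Q: "?Q i" if "r dvd i - q" for i
    using periodic_dvd[of ?Q r i q] that cq adj Wq by blast
  have stepP: "\<alpha> (i - 1) = \<beta> i \<and> \<beta> (i - 1) = \<alpha> i \<and> (\<alpha> i = Suc (\<beta> i) \<or> \<beta> i = Suc (\<alpha> i)) \<and>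
      w i \<and> \<not> w (i - 1) \<and> \<not> r dvd i - q" if "r dvd i - p" for i
    using crosses_at_steps[OF A B, of i] P that win(1)[OF that] Q[of i] by auto
  have stepQ: "\<alpha> (i - 1) = \<alpha> i \<and> \<beta> (i - 1) = \<beta> i \<and> (\<alpha> i = Suc (\<beta> i) \<or> \<beta> i = Suc (\<alpha> i)) \<and>
      \<not> w i \<and> w (i - 1) \<and> \<not> r dvd i - p \<and> (i, min (\<alpha> i) (\<beta> i)) \<in> W" if "r dvd i - q" for i
    using contact_steps[OF A B, of i] Q[OF that] P win(2)[OF that] by auto
  have other: "w (i - 1) = w i" if "\<not> r dvd i - p" "\<not> r dvd i - q" for i
    using win(3) that by blast
  have cross': "crosses_at \<alpha>' \<beta>' i \<longleftrightarrow> r dvd i - q" for i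
  proof -
    consider "r dvd i - p" | "r dvd i - q" | "\<not> r dvd i - p" "\<not> r dvd i - q" by blast
    then show ?thesis
    proof cases
      case 1
      then show ?thesis using stepP[OF 1] by (simp add: crosses_at_def \<alpha>'_def \<beta>'_def)
    next
      case 2
      then show ?thesis using stepQ[OF 2] neq[of i] by (auto simp: crosses_at_def \<alpha>'_def \<beta>'_def)
    next
      case 3
      then have "\<not> crosses_at \<alpha> \<beta> i"
        using P by simp
      with 3 other[OF 3] neq[of i] neq[of "i - 1"] show ?thesis
        unfolding crosses_at_def \<alpha>'_def \<beta>'_def by (cases "w i"; simp; linarith)
    qed
  qed
  have rng: "k \<le> \<alpha>' i \<and> \<alpha>' i < n - k \<and> \<alpha>' (i + r) = n - 1 - \<alpha>' i"
    "k \<le> \<beta>' i \<and> \<beta>' i < n - k \<and> \<beta>' (i + r) = n - 1 - \<beta>' i" for i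
    using range[OF A, of i] range[OF B, of i] shift[OF A, of i] shift[OF B, of i] win(4)[of i]
    by (auto simp: \<alpha>'_def \<beta>'_def)
  have third: "\<exists>e. \<forall>i. crosses_at \<alpha>' \<gamma> i \<longleftrightarrow> r dvd i - e" "\<exists>e. \<forall>i. crosses_at \<beta>' \<gamma> i \<longleftrightarrow> r dvd i - e"
    if g: "\<gamma> \<in> \<Lambda> - {\<alpha>, \<beta>}" for \<gamma>
  proof -
    have G: "\<gamma> \<in> \<Lambda>" "\<alpha> \<noteq> \<gamma>" "\<beta> \<noteq> \<gamma>"
      using g by auto
    \<comment> \<open>If both crossed the third wire at one column, both would end up on the level
      that it leaves.\<close>
    have no: "\<not> (crosses_at \<alpha> \<gamma> i \<and> crosses_at \<beta> \<gamma> i)" for i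
      using crosses_at_steps(1)[OF A G(1), of i] crosses_at_steps(1)[OF B G(1), of i] neq[of i] by auto
    have both: "(crosses_at \<alpha>' \<gamma> i \<and> crosses_at \<beta>' \<gamma> i \<longleftrightarrow> crosses_at \<alpha> \<gamma> i \<and> crosses_at \<beta> \<gamma> i) \<and>
        (crosses_at \<alpha>' \<gamma> i \<or> crosses_at \<beta>' \<gamma> i \<longleftrightarrow> crosses_at \<alpha> \<gamma> i \<or> crosses_at \<beta> \<gamma> i)" for i
    proof (cases "r dvd i - p \<or> r dvd i - q")
      case True
      \<comment> \<open>Where the courses are switched, the two wires are neighbours on both sides
        of the column. The third wire lies on the same side of both, so it makes no difference which
        of them it is compared with.\<close>
      have "{\<alpha> (i - 1), \<beta> (i - 1)} = {\<alpha> i, \<beta> i}" "\<alpha> i = Suc (\<beta> i) \<or> \<beta> i = Suc (\<alpha> i)"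
        using True stepP[of i] stepQ[of i] by auto
      then have "\<alpha> (i - 1) < \<gamma> (i - 1) \<longleftrightarrow> \<beta> (i - 1) < \<gamma> (i - 1)" "\<alpha> i < \<gamma> i \<longleftrightarrow> \<beta> i < \<gamma> i"
        using neq'[OF g, of i] neq'[OF g, of "i - 1"] by (auto simp: doubleton_eq_iff)
      then show ?thesis
        unfolding crosses_at_def \<alpha>'_def \<beta>'_def by simp
    next
      case False
      then show ?thesis
        using other[of i] unfolding crosses_at_def \<alpha>'_def \<beta>'_def by auto
    qed
    obtain d e where d: "\<And>i. crosses_at \<alpha> \<gamma> i \<longleftrightarrow> r dvd i - d" and e: "\<And>i. crosses_at \<beta> \<gamma> i \<longleftrightarrow> r dvd i - e"
      using crosses_once[OF A G(1,2)] crosses_once[OF B G(1,3)] by blast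
    have un: "crosses_at \<alpha>' \<gamma> i \<or> crosses_at \<beta>' \<gamma> i \<longleftrightarrow> r dvd i - d \<or> r dvd i - e" for i
      using both d e by blast
    have dj: "\<not> (crosses_at \<alpha>' \<gamma> i \<and> crosses_at \<beta>' \<gamma> i)" for i
      using both no by blast
    have lt: "\<alpha>' i < n" "\<beta>' i < n" "\<gamma> i < n" "\<alpha>' i \<noteq> \<gamma> i" "\<beta>' i \<noteq> \<gamma> i" for i
      using rng[of i] range[OF G(1), of i] neq'[OF g, of i] by (auto simp: \<alpha>'_def \<beta>'_def)
    have per: "crosses_at \<alpha>' \<gamma> (i + r) = crosses_at \<alpha>' \<gamma> i" "crosses_at \<beta>' \<gamma> (i + r) = crosses_at \<beta>' \<gamma> i" for i
      using lt rng shift[OF G(1)] by (intro crosses_at_shift; simp)+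
    obtain a b where ab: "crosses_at \<alpha>' \<gamma> a" "crosses_at \<beta>' \<gamma> b"
      using crosses_at_ex[of \<alpha>' \<gamma>] crosses_at_ex[of \<beta>' \<gamma>] lt rng[of 0] shift[OF G(1), of 0] by auto
    show "\<exists>e. \<forall>i. crosses_at \<alpha>' \<gamma> i \<longleftrightarrow> r dvd i - e"
      by (rule periodic_class[of "crosses_at \<alpha>' \<gamma>" r "crosses_at \<beta>' \<gamma>", OF per ab dj un])
    show "\<exists>e. \<forall>i. crosses_at \<beta>' \<gamma> i \<longleftrightarrow> r dvd i - e"
      using dj un by (intro periodic_class[of "crosses_at \<beta>' \<gamma>" r "crosses_at \<alpha>' \<gamma>", OF per(2,1) ab(2,1)]) blast+
  qed
  have sym': "crosses_at x y i \<longleftrightarrow> crosses_at y x i" if "\<And>i. x i \<noteq> y i" for x y i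
    using that[of i] that[of "i - 1"] unfolding crosses_at_def by linarith
  have neqab: "\<alpha>' i \<noteq> \<beta>' i" for i
    using neq[of i] by (auto simp: \<alpha>'_def \<beta>'_def)
  have neqg: "\<alpha>' i \<noteq> \<gamma> i" "\<beta>' i \<noteq> \<gamma> i" if "\<gamma> \<in> \<Lambda> - {\<alpha>, \<beta>}" for \<gamma> i
    using neq'[OF that, of i] by (auto simp: \<alpha>'_def \<beta>'_def)
  have "wiring k \<Lambda>'"
    unfolding wiring_def prewiring_def
  proof (intro conjI ballI allI impI)
    fix x i assume "x \<in> \<Lambda>'"
    then show "k \<le> x i" "x i < n - k" "x (i + r) = n - 1 - x i"
      using range[of x i] shift[of x i] rng[of i] unfolding \<Lambda>'_def by auto
  next
    fix x i assume x: "x \<in> \<Lambda>'"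
    have "\<alpha>' i = \<alpha>' (i - 1) \<or> \<alpha>' i = Suc (\<alpha>' (i - 1)) \<and> (i, \<alpha>' (i - 1)) \<in> W \<or> \<alpha>' (i - 1) = Suc (\<alpha>' i) \<and> (i, \<alpha>' i) \<in> W"
      "\<beta>' i = \<beta>' (i - 1) \<or> \<beta>' i = Suc (\<beta>' (i - 1)) \<and> (i, \<beta>' (i - 1)) \<in> W \<or> \<beta>' (i - 1) = Suc (\<beta>' i) \<and> (i, \<beta>' i) \<in> W"
    proof -
      consider "r dvd i - p" | "r dvd i - q" | "\<not> r dvd i - p" "\<not> r dvd i - q" by blast
      then have "(\<alpha>' i = \<alpha>' (i - 1) \<or> \<alpha>' i = Suc (\<alpha>' (i - 1)) \<and> (i, \<alpha>' (i - 1)) \<in> W \<or> \<alpha>' (i - 1) = Suc (\<alpha>' i) \<and> (i, \<alpha>' i) \<in> W)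
        \<and> (\<beta>' i = \<beta>' (i - 1) \<or> \<beta>' i = Suc (\<beta>' (i - 1)) \<and> (i, \<beta>' (i - 1)) \<in> W \<or> \<beta>' (i - 1) = Suc (\<beta>' i) \<and> (i, \<beta>' i) \<in> W)"
      proof cases
        case 1
        then show ?thesis using stepP[OF 1] by (simp add: \<alpha>'_def \<beta>'_def)
      next
        case 2
        then show ?thesis using stepQ[OF 2] by (auto simp: \<alpha>'_def \<beta>'_def min_def split: if_splits)
      next
        case 3
        then show ?thesis
          using other[OF 3] step[OF A, of i] step[OF B, of i] by (cases "w i") (simp_all add: \<alpha>'_def \<beta>'_def)
      qed
      then show "\<alpha>' i = \<alpha>' (i - 1) \<or> \<alpha>' i = Suc (\<alpha>' (i - 1)) \<and> (i, \<alpha>' (i - 1)) \<in> W \<or> \<alpha>' (i - 1) = Suc (\<alpha>' i) \<and> (i, \<alpha>' i) \<in> W"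
        "\<beta>' i = \<beta>' (i - 1) \<or> \<beta>' i = Suc (\<beta>' (i - 1)) \<and> (i, \<beta>' (i - 1)) \<in> W \<or> \<beta>' (i - 1) = Suc (\<beta>' i) \<and> (i, \<beta>' i) \<in> W"
        by blast+
    qed
    then show "x i = x (i - 1) \<or> x i = Suc (x (i - 1)) \<and> (i, x (i - 1)) \<in> W \<or> x (i - 1) = Suc (x i) \<and> (i, x i) \<in> W"
      using x step[of x i] unfolding \<Lambda>'_def by blast
  next
    fix i j assume j: "k \<le> j \<and> j < n - k"
    obtain x where x: "x \<in> \<Lambda>" "x i = j"
      using obtain_wire j by metis
    have "\<exists>y\<in>\<Lambda>'. y i = j"
      using x unfolding \<Lambda>'_def \<alpha>'_def \<beta>'_def by (cases "x = \<alpha>"; cases "x = \<beta>"; cases "w i"; auto)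
    moreover have "y = z" if "y \<in> \<Lambda>'" "z \<in> \<Lambda>'" "y i = z i" for y z
      using that wire_unique[of y z i] neqg[of y i] neqg[of z i] neqab[of i]
      unfolding \<Lambda>'_def by (elim UnE insertE emptyE; force)
    ultimately show "\<exists>!y. y \<in> \<Lambda>' \<and> y i = j"
      by metis
  next
    fix x y assume xy: "x \<in> \<Lambda>'" "y \<in> \<Lambda>'" "x \<noteq> y"
    then consider "x \<in> \<Lambda>" "y \<in> \<Lambda>" | "x \<in> \<Lambda> - {\<alpha>, \<beta>}" "y = \<alpha>' \<or> y = \<beta>'" | "y \<in> \<Lambda> - {\<alpha>, \<beta>}" "x = \<alpha>' \<or> x = \<beta>'"
      | "x = \<alpha>'" "y = \<beta>'" | "x = \<beta>'" "y = \<alpha>'"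
      unfolding \<Lambda>'_def by blast
    then show "\<exists>c. \<forall>i. crosses_at x y i \<longleftrightarrow> r dvd i - c"
    proof cases
      case 1
      then show ?thesis using crosses_once xy by blast
    next
      case 2
      have "x i \<noteq> y i" for i
        using neqg[OF 2(1), of i] 2(2) by auto
      then show ?thesis
        using third[OF 2(1)] 2(2) sym'[of x y] by auto
    next
      case 3
      then show ?thesis
        using third[OF 3(1)] by auto
    next
      case 4
      then show ?thesis using cross' by auto
    next
      case 5
      then show ?thesis using cross' sym'[of \<alpha>' \<beta>'] neqab by auto
    qed
  qed
  moreover have "crossings \<Lambda>' = crossings \<Lambda> - {(i, min (\<alpha> i) (\<beta> i)) |i. r dvd i - p} \<union>
       {(i, min (\<alpha> i) (\<beta> i)) |i. r dvd i - q}" (is "_ = ?R")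
  proof -
    have "(i, a) \<in> crossings \<Lambda>' \<longleftrightarrow> (i, a) \<in> ?R" for i a
    proof -
      let ?c = "\<lambda>\<gamma>. \<gamma> (i - 1) = a \<and> \<gamma> i = Suc a"
      have 1: "(i, a) \<in> crossings \<Lambda>' \<longleftrightarrow> (\<exists>\<gamma>\<in>\<Lambda> - {\<alpha>, \<beta>}. ?c \<gamma>) \<or> ?c \<alpha>' \<or> ?c \<beta>'"
        unfolding crossings_def \<Lambda>'_def by auto
      have 2: "(i, a) \<in> crossings \<Lambda> \<longleftrightarrow> (\<exists>\<gamma>\<in>\<Lambda> - {\<alpha>, \<beta>}. ?c \<gamma>) \<or> ?c \<alpha> \<or> ?c \<beta>"
        using A B unfolding crossings_def by auto
      have 3: "(i, a) \<in> ?R \<longleftrightarrow> (i, a) \<in> crossings \<Lambda> \<and> \<not> (r dvd i - p \<and> a = min (\<alpha> i) (\<beta> i)) \<or>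
          r dvd i - q \<and> a = min (\<alpha> i) (\<beta> i)"
        by auto
      consider "r dvd i - p" | "r dvd i - q" | "\<not> r dvd i - p" "\<not> r dvd i - q" by blast
      then show ?thesis
      proof cases
        case c1: 1
        have "\<not> ?c \<alpha>'" "\<not> ?c \<beta>'"
          using stepP[OF c1] by (auto simp: \<alpha>'_def \<beta>'_def)
        moreover have "a \<noteq> min (\<alpha> i) (\<beta> i)" if ex: "\<exists>\<gamma>\<in>\<Lambda> - {\<alpha>, \<beta>}. ?c \<gamma>"
        proof -
          obtain \<gamma> where g: "\<gamma> \<in> \<Lambda> - {\<alpha>, \<beta>}" "?c \<gamma>" using ex by blast
          then show ?thesis
            using neq'[OF g(1), of "i - 1"] stepP[OF c1] by (auto simp: min_def)
        qed
        moreover have "\<alpha> (i - 1) = \<beta> i" "\<beta> (i - 1) = \<alpha> i"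
          using stepP[OF c1] by blast+
        then have "a = min (\<alpha> i) (\<beta> i)" if "?c \<alpha> \<or> ?c \<beta>"
          using that by (elim disjE conjE) linarith+
        ultimately show ?thesis
          using 1 2 3 c1 stepP[OF c1] by blast
      next
        case c2: 2
        note sQ = stepQ[OF c2]
        have e: "\<alpha> (i - 1) = \<alpha> i" "\<beta> (i - 1) = \<beta> i" "\<not> w i" "w (i - 1)"
          using sQ by blast+
        then have v: "\<alpha>' (i - 1) = \<beta> i" "\<alpha>' i = \<alpha> i" "\<beta>' (i - 1) = \<alpha> i" "\<beta>' i = \<beta> i"
          by (simp_all add: \<alpha>'_def \<beta>'_def)
        have "\<alpha> i = Suc (\<beta> i) \<or> \<beta> i = Suc (\<alpha> i)"
          using sQ by blast
        then have "?c \<alpha>' \<or> ?c \<beta>' \<longleftrightarrow> a = min (\<alpha> i) (\<beta> i)"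
          unfolding v by linarith
        moreover have "\<not> ?c \<alpha>" "\<not> ?c \<beta>"
          unfolding e by simp_all
        ultimately show ?thesis
          using 1 2 3 c2 stepQ[OF c2] by blast
      next
        case c3: 3
        then have "?c \<alpha>' \<or> ?c \<beta>' \<longleftrightarrow> ?c \<alpha> \<or> ?c \<beta>"
          using other[OF c3] by (auto simp: \<alpha>'_def \<beta>'_def)
        with 1 2 3 c3 show ?thesis
          by blast
      qed
    qed
    then show ?thesis by auto
  qed
  moreover have "{\<alpha>' i, \<beta>' i} = {\<alpha> i, \<beta> i}" for i
    by (auto simp: \<alpha>'_def \<beta>'_def)
  moreover have "\<not> crosses_at \<alpha>' \<beta>' p" "crosses_at \<alpha>' \<beta>' q"
    using cross' stepP[of p] by auto
  ultimately show ?thesis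
    using that[of \<Lambda>' \<alpha>' \<beta>'] by (simp add: \<Lambda>'_def)
qed

end

section \<open>Sweeping between a cut and its translate\<close>

lemma int_first:
  fixes D :: "int \<Rightarrow> bool"
  assumes "D a" "\<And>q. q < b \<Longrightarrow> \<not> D q"
  obtains q where "D q" "\<not> D (q - 1)"
proof -
  have "\<exists>q. D q \<and> \<not> D (q - 1)"
  proof (rule ccontr)
    assume "\<not> ?thesis"
    then have d: "D q \<Longrightarrow> D (q - 1)" for q by blast
    have "D (a - int m)" for m
      by (induction m) (use assms(1) d[of "a - int _"] in \<open>auto simp: algebra_simps\<close>)
    from this[of "nat (a - b) + 1"] assms(2)[of "a - int (nat (a - b) + 1)"] show False
      by (simp split: if_splits)
  qed
  with that show thesis by blast
qed

text \<open>A cut is described by the columns \<open>c j\<close> at which it passes the levels \<open>j\<close>; the vertices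
  between the cut and its image under the translation form the window.\<close>

locale cut_network = network +
  fixes c :: "nat \<Rightarrow> int"
  assumes c_W: "(i, j) \<in> W \<Longrightarrow> c j \<le> i \<longleftrightarrow> c (Suc j) \<le> i"
    and c_le: "j < n \<Longrightarrow> c j \<le> c (n - 1 - j) + r"
begin

text \<open>The columns of the translated cut: the reflection takes level \<open>n - 1 - j\<close>
  to level \<open>j\<close>.\<close>

definition c' :: "nat \<Rightarrow> int" where "c' j = c (n - 1 - j) + r"

definition window :: "(int \<times> nat) set" where
  "window = {(i, j) \<in> W. c j \<le> i \<and> i < c' j}"

text \<open>A common bound for the window on the right, where the sweep starts. Inserting 0 only
  provides a maximum in the absence of levels.\<close>

definition rim :: int where "rim = Max (insert 0 (c' ` {..<n}))"

text \<open>The front of the sweep after \<open>u\<close> columns. On each level it moves left from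
  the translated cut to the cut, resting while the common column \<open>rim - u\<close> is outside
  the window. A wire passes it on its section \<open>pos u j - 1\<close>, immediately to the left of
  column \<open>pos u j\<close>.\<close>

definition pos :: "nat \<Rightarrow> nat \<Rightarrow> int" where
  "pos u j = max (c j) (min (rim - int u) (c' j))"

definition steps :: "(int \<Rightarrow> nat) set \<Rightarrow> nat \<Rightarrow> nat set" where
  "steps \<Lambda> u = {j. (rim - 1 - int u, j) \<in> crossings \<Lambda> \<inter> window}"

text \<open>The greedy property: sweeping the window from right to left, the wires of a contact outside
  \<open>V\<close> have already crossed.\<close>

definition greedy_wiring :: "nat \<Rightarrow> (int \<times> nat) set \<Rightarrow> (int \<Rightarrow> nat) set \<Rightarrow> bool" where
  "greedy_wiring k V \<Lambda> \<longleftrightarrow> (\<forall>i j. (i, j) \<in> wcontacts k \<Lambda> \<longrightarrow> (i, j) \<in> window \<longrightarrow> (i, j) \<notin> V \<longrightarrow>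
     state (steps \<Lambda>) (nat (rim - 1 - i)) (Suc j) < state (steps \<Lambda>) (nat (rim - 1 - i)) j)"

lemma c'_rim: "j < n \<Longrightarrow> c' j \<le> rim"
  unfolding rim_def by (intro Max_ge) auto

lemma W_shift_back:
  assumes "(i, j) \<in> W"
  shows "(i - r, n - 2 - j) \<in> W"
proof -
  have e: "n - 2 - (n - 2 - j) = j" "Suc (n - 2 - j) < n"
    using W_less[OF assms] by auto
  show ?thesis
    using W_shift[OF e(2), of "i - r"] assms unfolding e(1) by simp
qed

lemma c'_W: "(i, j) \<in> W \<Longrightarrow> c' j \<le> i \<longleftrightarrow> c' (Suc j) \<le> i"
proof -
  assume w: "(i, j) \<in> W"
  then have "Suc (n - 2 - j) = n - 1 - j" "n - 1 - Suc j = n - 2 - j"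
    using W_less by fastforce+
  then show ?thesis
    using c_W[OF W_shift_back[OF w]] by (simp add: c'_def) linarith
qed

lemma pos_W: "(i, j) \<in> W \<Longrightarrow> pos u j \<le> i \<longleftrightarrow> pos u (Suc j) \<le> i"
  using c_W[of i j] c'_W[of i j] by (simp add: pos_def min_le_iff_disj)

lemma window_less_rim: "(i, j) \<in> window \<Longrightarrow> i < rim"
  using c'_rim[of j] W_less[of i j] by (auto simp: window_def)

text \<open>Every vertex has a translate in the window: take a translate at or right of the cut
  whose predecessor is left of the cut. Applying the translation to the predecessor shows that it is
  left of the translated cut.\<close>

lemma window_shift_induct:
  assumes W: "(i, j) \<in> W"
    and sh: "\<And>i j. (i, j) \<in> W \<Longrightarrow> P (i + r) (n - 2 - j) \<longleftrightarrow> P i j"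
    and win: "\<And>i j. (i, j) \<in> window \<Longrightarrow> P i j"
  shows "P i j"
proof -
  \<comment> \<open>\<open>(I q, J q)\<close> is the \<open>q\<close>-th translate of the vertex;
    odd translates are reflected.\<close>
  define J where "J q = (if even q then j else n - 2 - j)" for q :: int
  define I where "I q = i + q * r" for q
  have jn: "Suc j < n"
    using W W_less by blast
  have JS: "J (q + 1) = n - 2 - J q" "J q = n - 2 - J (q + 1)" "Suc (J q) < n" for q
    using jn by (auto simp: J_def)
  have IS: "I (q + 1) = I q + r" for q
    by (simp add: I_def algebra_simps)
  have inv: "((I q, J q) \<in> W \<and> (P (I q) (J q) \<longleftrightarrow> P i j))" for q
  proof (induction q rule: int_induct[where k = 0])
    case (step1 q)
    then show ?case
      using sh[of "I q" "J q"] W_shift[of "J q" "I q"] JS(1,3)[of q] IS[of q] by simp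
  next
    case (step2 q)
    have "I q = I (q - 1) + r" "J q = n - 2 - J (q - 1)"
      using IS[of "q - 1"] JS(1)[of "q - 1"] by simp_all
    with step2 show ?case
      using sh[of "I (q - 1)" "J (q - 1)"] W_shift[of "J (q - 1)" "I (q - 1)"] JS(3)[of "q - 1"] by simp
  qed (use W in \<open>simp add: I_def J_def\<close>)
  define lo where "lo = Min (c ` {..<n})"
  have lo: "lo \<le> c a" if "a < n" for a
    unfolding lo_def using that by (intro Min_le) auto
  have mult: "q \<le> q * r" if "0 \<le> q" for q
    using mult_left_mono[of 1 r q] r_pos that by simp
  have "c (J q) \<le> I q" if "q = \<bar>i\<bar> + \<bar>rim\<bar>" for q
  proof -
    have "c (J q) \<le> rim"
      using c_le[of "J q"] c'_rim[of "J q"] JS(3)[of q] by (simp add: c'_def)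
    then show ?thesis
      using mult[of q] that unfolding I_def by linarith
  qed
  moreover have "\<not> c (J q) \<le> I q" if "q < - (\<bar>i\<bar> + \<bar>lo\<bar>)" for q
  proof -
    have "lo \<le> c (J q)"
      using lo JS(3)[of q] by simp
    moreover have "q * r \<le> q"
      using mult[of "- q"] that by simp
    ultimately show ?thesis
      using that unfolding I_def by linarith
  qed
  ultimately obtain q where q: "c (J q) \<le> I q" "\<not> c (J (q - 1)) \<le> I (q - 1)"
    using int_first[of "\<lambda>q. c (J q) \<le> I q"] by metis
  have "(I (q - 1), J (q - 1)) \<in> W"
    using inv by blast
  then have "I (q - 1) < c (Suc (J (q - 1)))"
    using q(2) c_W by auto
  moreover have "n - 1 - J q = Suc (J (q - 1))" "I q = I (q - 1) + r"
    using JS(1,3)[of "q - 1"] IS[of "q - 1"] by auto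
  ultimately have "I q < c' (J q)"
    by (simp add: c'_def)
  with q(1) inv[of q] have "(I q, J q) \<in> window"
    by (simp add: window_def)
  from win[OF this] inv[of q] show ?thesis
    by blast
qed

end

locale cut_wires = cut_network n r W c + wires n r W k \<Lambda>
  for n r W c k \<Lambda>
begin

lemma along_step:
  assumes "\<And>i j. (i, j) \<in> W \<Longrightarrow> d j \<le> i \<longleftrightarrow> d (Suc j) \<le> i" "\<alpha> \<in> \<Lambda>" "d (\<alpha> (i - 1)) \<le> i"
  shows "d (\<alpha> i) \<le> i"
  using step[OF assms(2), of i] assms(3) assms(1)[of i "\<alpha> i"] assms(1)[of i "\<alpha> (i - 1)"]
  by (elim disjE conjE; simp)

text \<open>A front separates no vertex from one of its two levels, so a wire that changes level at
  a vertex cannot slip back behind the front. It is applied to the cut, to its translate and to the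
  intermediate fronts \<open>pos u\<close>.\<close>

lemma along:
  assumes d: "\<And>i j. (i, j) \<in> W \<Longrightarrow> d j \<le> i \<longleftrightarrow> d (Suc j) \<le> i" and "\<alpha> \<in> \<Lambda>"
    and "d (\<alpha> i) \<le> i + 1" "i < i'"
  shows "d (\<alpha> i') \<le> i'"
proof -
  have "d (\<alpha> (i + 1 + int m)) \<le> i + 1 + int m" for m
  proof (induction m)
    case 0
    show ?case using along_step[of d, OF d assms(2), of "i + 1"] assms(3) by simp
  next
    case (Suc m)
    then show ?case using along_step[of d, OF d assms(2), of "i + 1 + int (Suc m)"] by (simp add: algebra_simps)
  qed
  from this[of "nat (i' - i - 1)"] assms(4) show ?thesis
    by simp
qed

text \<open>By \<open>along\<close> a wire passes the front only once; section
  \<open>d j - 1\<close> is the last one before the front on level \<open>j\<close>.\<close>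

lemma level_unique:
  assumes d: "\<And>i j. (i, j) \<in> W \<Longrightarrow> d j \<le> i \<longleftrightarrow> d (Suc j) \<le> i" and a: "\<alpha> \<in> \<Lambda>"
    and "\<alpha> (d j - 1) = j" "\<alpha> (d j' - 1) = j'"
  shows "j = j'"
proof -
  have "\<not> d j < d j'"
    using along[of d, OF d a, of "d j - 1" "d j' - 1"] assms(3,4) by (cases "d j \<le> d j' - 1") auto
  moreover have "\<not> d j' < d j"
    using along[of d, OF d a, of "d j' - 1" "d j - 1"] assms(3,4) by (cases "d j' \<le> d j - 1") auto
  ultimately have "d j = d j'"
    by simp
  with assms(3,4) show ?thesis by metis
qed

definition wire :: "nat \<Rightarrow> nat \<Rightarrow> int \<Rightarrow> nat" where
  "wire u j = (THE \<alpha>. \<alpha> \<in> \<Lambda> \<and> \<alpha> (pos u j - 1) = j)"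

lemma wire: "k \<le> j \<Longrightarrow> j < n - k \<Longrightarrow> wire u j \<in> \<Lambda> \<and> wire u j (pos u j - 1) = j"
  unfolding wire_def by (rule theI'[OF wire_ex1])

lemma wire_eqI:
  assumes "\<alpha> \<in> \<Lambda>" "\<alpha> (pos u j - 1) = j"
  shows "wire u j = \<alpha>"
  using wire[of j u] range[OF assms(1), of "pos u j - 1"] wire_unique[of "wire u j" \<alpha> "pos u j - 1"] assms
  by auto

lemma wire_inj:
  assumes "k \<le> j" "j < n - k" "k \<le> j'" "j' < n - k" "wire u j = wire u j'"
  shows "j = j'"
  using level_unique[of "pos u" "wire u j" j j', OF pos_W] wire[OF assms(1,2), of u] wire[OF assms(3,4), of u] assms(5)
  by simp

lemma steps_vertices: "j \<in> steps \<Lambda> u \<Longrightarrow> k \<le> j \<and> Suc j < n - k"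
  using crossings_W by (auto simp: steps_def vertices_in_def)

lemma sparse_steps: "sparse (steps \<Lambda> u)"
  using sparse_crossings[of "rim - 1 - int u"] by (auto simp: sparse_def steps_def)

lemma swaps_steps_range: "k \<le> j \<Longrightarrow> j < n - k \<Longrightarrow> k \<le> swaps (steps \<Lambda> u) j \<and> swaps (steps \<Lambda> u) j < n - k"
  using steps_vertices by (intro swaps_range) auto

lemma pos_in_window:
  assumes "c j \<le> rim - 1 - int u" "rim - 1 - int u < c' j"
  shows "pos u j = rim - int u" "pos (Suc u) j = rim - 1 - int u"
  using assms by (auto simp: pos_def)

text \<open>On levels where the swept column lies in the window, the front moves by one column and
  the wires follow \<open>step_swaps\<close>; on the others neither the front nor the network
  changes. The cases do not mix, because a vertex has both of its levels in the window or
  none.\<close>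

lemma wire_Suc:
  assumes j: "k \<le> j" "j < n - k"
  shows "wire (Suc u) j = wire u (swaps (steps \<Lambda> u) j)"
proof -
  define i where "i = rim - 1 - int u"
  let ?X = "{j. (i, j) \<in> crossings \<Lambda>}"
  define \<alpha> where "\<alpha> = wire (Suc u) j"
  have a: "\<alpha> \<in> \<Lambda>" "\<alpha> (pos (Suc u) j - 1) = j"
    using wire[OF j] by (auto simp: \<alpha>_def)
  have XW: "(i, a) \<in> W" if "(i, a) \<in> crossings \<Lambda>" for a
    using crossings_W that by (auto simp: vertices_in_def)
  have win: "(i, a) \<in> window \<longleftrightarrow> c a \<le> i \<and> i < c' a" "(i, a) \<in> window \<longleftrightarrow> c (Suc a) \<le> i \<and> i < c' (Suc a)"
    if "(i, a) \<in> W" for a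
    using that c_W[of i a] c'_W[of i a] by (auto simp: window_def)
  show ?thesis
  proof (cases "c j \<le> i \<and> i < c' j")
    case True
    have "steps \<Lambda> u \<subseteq> ?X"
      by (auto simp: steps_def i_def)
    moreover have "j \<in> steps \<Lambda> u \<longleftrightarrow> j \<in> ?X"
      using True win(1)[of j] XW[of j] by (auto simp: steps_def simp flip: i_def)
    moreover have "j - 1 \<in> steps \<Lambda> u \<longleftrightarrow> j - 1 \<in> ?X" if "0 < j"
      using True win(2)[of "j - 1"] XW[of "j - 1"] that by (auto simp: steps_def simp flip: i_def)
    ultimately have sw: "swaps (steps \<Lambda> u) j = swaps ?X j"
      by (auto simp: swaps_def)
    have "pos (Suc u) j = i"
      using pos_in_window True by (simp add: i_def)
    then have ai: "\<alpha> i = swaps ?X j"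
      using step_swaps[OF a(1), of i] a(2) by simp
    have "c (swaps ?X j) \<le> i \<and> i < c' (swaps ?X j)"
    proof -
      have "j \<in> ?X \<or> j \<notin> ?X \<and> 0 < j \<and> j - 1 \<in> ?X \<or> swaps ?X j = j"
        by (auto simp: swaps_def)
      then consider "j \<in> ?X" | "j \<notin> ?X" "0 < j" "j - 1 \<in> ?X" | "swaps ?X j = j"
        by satx
      then show ?thesis
      proof cases
        case 1
        then show ?thesis using True win[of j] XW[of j] by (auto simp: swaps_def)
      next
        case 2
        then show ?thesis using True win[of "j - 1"] XW[of "j - 1"] by (auto simp: swaps_def)
      next
        case 3
        then show ?thesis using True by simp
      qed
    qed
    then have "pos u (swaps ?X j) = i + 1"
      using pos_in_window(1)[of "swaps ?X j" u] by (simp add: i_def)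
    then show ?thesis
      using wire_eqI[OF a(1), of u "swaps ?X j"] ai sw by (simp add: \<alpha>_def)
  next
    case False
    have "j \<notin> steps \<Lambda> u" "\<not> (0 < j \<and> j - 1 \<in> steps \<Lambda> u)"
      using False win(1)[of j] win(2)[of "j - 1"] XW by (auto simp: steps_def simp flip: i_def)
    then have "swaps (steps \<Lambda> u) j = j"
      by (auto simp: swaps_def)
    moreover have "pos (Suc u) j = pos u j"
      using False c_le[of j] j unfolding pos_def i_def c'_def by auto
    ultimately show ?thesis
      using wire_eqI[OF a(1), of u j] a(2) by (simp add: \<alpha>_def)
  qed
qed

definition crossed :: "(int \<Rightarrow> nat) \<Rightarrow> (int \<Rightarrow> nat) \<Rightarrow> int \<Rightarrow> bool" where
  "crossed \<alpha> \<beta> i \<longleftrightarrow> crosses_at \<alpha> \<beta> i \<and> (i, min (\<alpha> i) (\<beta> i)) \<in> window"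

lemma crossed_bounds:
  assumes "\<alpha> \<in> \<Lambda>" "\<beta> \<in> \<Lambda>" "(i, min (\<alpha> i) (\<beta> i)) \<in> window" "\<alpha> i = Suc (\<beta> i) \<or> \<beta> i = Suc (\<alpha> i)"
  shows "c (\<alpha> i) \<le> i" "i < c' (\<alpha> i)"
  using assms c_W[of i "\<beta> i"] c'_W[of i "\<beta> i"] c_W[of i "\<alpha> i"] c'_W[of i "\<alpha> i"]
  by (auto simp: window_def min_def split: if_splits)

text \<open>A wire that has reached the cut at column \<open>i\<close> has reached the translated
  cut one period later and stays beyond it.\<close>

lemma window_same_period:
  assumes "\<alpha> \<in> \<Lambda>" "c (\<alpha> i) \<le> i" "i' < c' (\<alpha> i')"
  shows "i' < i + r"
proof (rule ccontr)
  assume "\<not> ?thesis"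
  moreover have "n - 1 - \<alpha> (i + r) = \<alpha> i"
    using shift[OF assms(1), of i] range[OF assms(1), of i] by auto
  then have "c' (\<alpha> (i + r)) \<le> i + r"
    using assms(2) unfolding c'_def by simp
  ultimately show False
    using along[of c', OF c'_W assms(1), of "i + r" i'] assms(3) by (cases "i + r = i'") auto
qed

text \<open>Any two columns in which a wire is inside the window are less than \<open>r\<close>
  apart, while the crossings of a pair form a single residue class modulo \<open>r\<close>.\<close>

lemma crossed_unique:
  assumes "\<alpha> \<in> \<Lambda>" "\<beta> \<in> \<Lambda>" "crossed \<alpha> \<beta> i" "crossed \<alpha> \<beta> i'"
  shows "i = i'"
proof -
  note cr = assms(3,4)[unfolded crossed_def]
  have "\<alpha> \<noteq> \<beta>"
    using cr by (auto simp: crosses_at_def)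
  then obtain d where d: "crosses_at \<alpha> \<beta> i \<longleftrightarrow> r dvd i - d" for i
    using crosses_once assms(1,2) by blast
  have "r dvd i - i'"
    using d cr by (metis diff_diff_eq2 dvd_diff diff_add_cancel)
  moreover have "i' < i + r" "i < i' + r"
    using window_same_period[OF assms(1)] crossed_bounds[OF assms(1,2)] crosses_at_steps(3)[OF assms(1,2)] cr
    by blast+
  ultimately show ?thesis
    using zdvd_not_zless[of "i - i'" r] zdvd_not_zless[of "i' - i" r]
    by (metis add.commute diff_gt_0_iff_gt dvd_diff_commute less_diff_eq linorder_neqE diff_less_eq)
qed

text \<open>The pair crosses somewhere, and \<open>window_shift_induct\<close> carries the crossing
  into the window.\<close>

lemma crossed_ex:
  assumes "\<alpha> \<in> \<Lambda>" "\<beta> \<in> \<Lambda>" "\<alpha> \<noteq> \<beta>"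
  shows "\<exists>i. crossed \<alpha> \<beta> i"
proof -
  obtain d where d: "crosses_at \<alpha> \<beta> i \<longleftrightarrow> r dvd i - d" for i
    using crosses_once assms by blast
  then have "crosses_at \<alpha> \<beta> d"
    by simp
  have dr: "crosses_at \<alpha> \<beta> (i + r) \<longleftrightarrow> crosses_at \<alpha> \<beta> i" for i
  proof -
    have "(i - d) + r = (i + r) - d" by simp
    then show ?thesis using d[of i] d[of "i + r"] by (metis dvd_add_triv_right_iff)
  qed
  let ?adj = "\<lambda>i. \<alpha> i = Suc (\<beta> i) \<or> \<beta> i = Suc (\<alpha> i)"
  have adj: "?adj (i + r) \<longleftrightarrow> ?adj i" for i
    using shift[OF assms(1), of i] shift[OF assms(2), of i] range[OF assms(1), of i] range[OF assms(2), of i]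
    by auto
  \<comment> \<open>The trivial equation makes this an instance of the property used in the
    induction, whose level variable \<open>j\<close> has to be tied to the two wires.\<close>
  have "crosses_at \<alpha> \<beta> d \<and> ?adj d \<and> min (\<alpha> d) (\<beta> d) = min (\<alpha> d) (\<beta> d) \<longrightarrow> (\<exists>i. crossed \<alpha> \<beta> i)"
  proof (rule window_shift_induct[where P = "\<lambda>i j. crosses_at \<alpha> \<beta> i \<and> ?adj i \<and> min (\<alpha> i) (\<beta> i) = j \<longrightarrow> (\<exists>i. crossed \<alpha> \<beta> i)"])
    show "(d, min (\<alpha> d) (\<beta> d)) \<in> W"
      using crosses_at_steps(4)[OF assms(1,2)] \<open>crosses_at \<alpha> \<beta> d\<close> by blast
  next
    fix i j assume w: "(i, j) \<in> W"
    have "min (\<alpha> (i + r)) (\<beta> (i + r)) = n - 2 - j \<longleftrightarrow> min (\<alpha> i) (\<beta> i) = j" if "?adj i"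
      using shift_min(1)[OF assms(1,2) that] W_less[OF w] that range[OF assms(1), of i] range[OF assms(2), of i]
      by auto
    then show "(crosses_at \<alpha> \<beta> (i + r) \<and> ?adj (i + r) \<and> min (\<alpha> (i + r)) (\<beta> (i + r)) = n - 2 - j \<longrightarrow> (\<exists>i. crossed \<alpha> \<beta> i))
      \<longleftrightarrow> (crosses_at \<alpha> \<beta> i \<and> ?adj i \<and> min (\<alpha> i) (\<beta> i) = j \<longrightarrow> (\<exists>i. crossed \<alpha> \<beta> i))"
      using dr[of i] adj[of i] by blast
  qed (auto simp: crossed_def)
  then show ?thesis
    using \<open>crosses_at \<alpha> \<beta> d\<close> crosses_at_steps(3)[OF assms(1,2)] by blast
qed

lemma crossed_iff_step:
  assumes j: "k \<le> j" "j < n - k" "k \<le> j'" "j' < n - k" "j \<noteq> j'"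
  shows "crossed (wire (Suc u) j) (wire (Suc u) j') (rim - 1 - int u) \<longleftrightarrow>
    (\<exists>a\<in>steps \<Lambda> u. {j, j'} = {a, Suc a})"
proof -
  define i where "i = rim - 1 - int u"
  have *: "crossed \<alpha> \<beta> i \<longleftrightarrow> (i, a) \<in> crossings \<Lambda> \<inter> window"
    if "\<alpha> \<in> \<Lambda>" "\<beta> \<in> \<Lambda>" "\<alpha> (i - 1) = a" "\<beta> (i - 1) = Suc a" for \<alpha> \<beta> a
  proof
    assume cr: "crossed \<alpha> \<beta> i"
    then have "\<beta> i = a" "\<alpha> i = Suc a"
      using crosses_at_steps(1,2)[OF that(1,2), of i] that(3,4) by (auto simp: crossed_def)
    then show "(i, a) \<in> crossings \<Lambda> \<inter> window"
      using cr that by (auto simp: crossed_def crossings_def min_def)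
  next
    assume x: "(i, a) \<in> crossings \<Lambda> \<inter> window"
    then obtain \<gamma> where "\<gamma> \<in> \<Lambda>" "\<gamma> (i - 1) = a" "\<gamma> i = Suc a"
      by (auto simp: crossings_def)
    then have ai: "\<alpha> i = Suc a"
      using wire_unique[of \<gamma> \<alpha> "i - 1"] that by simp
    have "\<beta> i = a"
      using step_swaps[OF that(2), of i] that(4) x sparse_crossings[of i] by (auto simp: swaps_def sparse_def)
    with ai that x show "crossed \<alpha> \<beta> i"
      by (auto simp: crossed_def crosses_at_def min_def)
  qed
  show ?thesis
  proof
    assume cr: "crossed (wire (Suc u) j) (wire (Suc u) j') (rim - 1 - int u)"
    define \<alpha> \<beta> where "\<alpha> = wire (Suc u) j" and "\<beta> = wire (Suc u) j'"
    have L: "\<alpha> \<in> \<Lambda>" "\<beta> \<in> \<Lambda>"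
      using wire j by (auto simp: \<alpha>_def \<beta>_def)
    have cr': "crosses_at \<alpha> \<beta> i" "(i, min (\<alpha> i) (\<beta> i)) \<in> window"
      using cr by (auto simp: crossed_def i_def \<alpha>_def \<beta>_def)
    have ne: "\<alpha> \<noteq> \<beta>"
      using cr'(1) by (auto simp: crosses_at_def)
    note st = crosses_at_steps[OF L cr'(1)]
    have "c (\<alpha> i) \<le> i \<and> i < c' (\<alpha> i)" "c (\<beta> i) \<le> i \<and> i < c' (\<beta> i)"
      using crossed_bounds[OF L cr'(2) st(3)] crossed_bounds[OF L(2,1), of i] cr'(2) st(3) by (auto simp: min.commute)
    then have p: "pos (Suc u) (\<alpha> (i - 1)) = i" "pos (Suc u) (\<beta> (i - 1)) = i"
      using pos_in_window(2)[of "\<alpha> i" u] pos_in_window(2)[of "\<beta> i" u] st(1,2) by (simp_all flip: i_def)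
    then have "wire (Suc u) (\<alpha> (i - 1)) = \<alpha>" "wire (Suc u) (\<beta> (i - 1)) = \<beta>"
      using wire_eqI L by simp_all
    then have jj: "\<alpha> (i - 1) = j" "\<beta> (i - 1) = j'"
      using wire_inj[of "\<alpha> (i - 1)" j "Suc u"] wire_inj[of "\<beta> (i - 1)" j' "Suc u"] range[OF L(1), of "i - 1"]
        range[OF L(2), of "i - 1"] j by (auto simp: \<alpha>_def \<beta>_def)
    have cr2: "crossed \<alpha> \<beta> i" "crossed \<beta> \<alpha> i"
      using cr' crosses_at_sym[OF L ne, of i] by (simp_all add: crossed_def min.commute)
    have "j' = Suc j \<or> j = Suc j'"
      using st(1-3) jj by auto
    then show "\<exists>a\<in>steps \<Lambda> u. {j, j'} = {a, Suc a}"
    proof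
      assume "j' = Suc j"
      then show ?thesis
        using *[OF L jj(1)] jj(2) cr2(1) by (intro bexI[of _ j]) (auto simp: steps_def i_def)
    next
      assume "j = Suc j'"
      then show ?thesis
        using *[OF L(2,1) jj(2)] jj(1) cr2(2) by (intro bexI[of _ j']) (auto simp: steps_def i_def)
    qed
  next
    assume "\<exists>a\<in>steps \<Lambda> u. {j, j'} = {a, Suc a}"
    then obtain a where a: "(i, a) \<in> crossings \<Lambda> \<inter> window" "{j, j'} = {a, Suc a}"
      by (auto simp: steps_def i_def)
    then have "c a \<le> i" "i < c' a" "c (Suc a) \<le> i" "i < c' (Suc a)"
      using c_W[of i a] c'_W[of i a] by (auto simp: window_def)
    then have p: "pos (Suc u) a = i" "pos (Suc u) (Suc a) = i"
      using pos_in_window(2)[of a u] pos_in_window(2)[of "Suc a" u] by (simp_all flip: i_def)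
    have r: "k \<le> a" "a < n - k" "k \<le> Suc a" "Suc a < n - k"
      using a(2) j by (auto simp: doubleton_eq_iff)
    define \<alpha> \<beta> where "\<alpha> = wire (Suc u) a" and "\<beta> = wire (Suc u) (Suc a)"
    have L: "\<alpha> \<in> \<Lambda>" "\<beta> \<in> \<Lambda>" "\<alpha> (i - 1) = a" "\<beta> (i - 1) = Suc a"
      using wire[OF r(1,2), of "Suc u"] wire[OF r(3,4), of "Suc u"] p by (auto simp: \<alpha>_def \<beta>_def)
    have "crossed \<alpha> \<beta> i"
      using *[OF L] a(1) by blast
    moreover from this have "crossed \<beta> \<alpha> i"
      using crosses_at_sym[OF L(1,2), of i] L(3,4) by (auto simp: crossed_def min.commute)
    ultimately show "crossed (wire (Suc u) j) (wire (Suc u) j') (rim - 1 - int u)"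
      using a(2) by (auto simp: doubleton_eq_iff \<alpha>_def \<beta>_def i_def)
  qed
qed

text \<open>Labels are the levels on which the wires pass the translated cut. The order of labels is
  therefore that of the levels until the pair crosses in the swept part, and the reverse afterwards;
  \<open>crossed_unique\<close> excludes a second crossing.\<close>

lemma state_order:
  assumes "k \<le> j" "j < n - k" "k \<le> j'" "j' < n - k" "j \<noteq> j'"
  shows "(state (steps \<Lambda>) u j < state (steps \<Lambda>) u j' \<longleftrightarrow> j < j') \<longleftrightarrow>
    \<not> (\<exists>i\<ge>rim - int u. crossed (wire u j) (wire u j') i)"
  using assms
proof (induction u arbitrary: j j')
  case 0
  then show ?case
    using window_less_rim by (fastforce simp: crossed_def)
next
  case (Suc u)
  define \<alpha> \<beta> where "\<alpha> = wire (Suc u) j" and "\<beta> = wire (Suc u) j'"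
  let ?s = "swaps (steps \<Lambda> u)"
  have L: "\<alpha> \<in> \<Lambda>" "\<beta> \<in> \<Lambda>" "\<alpha> = wire u (?s j)" "\<beta> = wire u (?s j')"
    using wire[of j "Suc u"] wire[of j' "Suc u"] Suc.prems wire_Suc[of j u] wire_Suc[of j' u]
    by (simp_all add: \<alpha>_def \<beta>_def)
  have ne: "?s j \<noteq> ?s j'"
    using swaps_inj[OF sparse_steps] Suc.prems(5) by blast
  have IH: "(state (steps \<Lambda>) (Suc u) j < state (steps \<Lambda>) (Suc u) j' \<longleftrightarrow> ?s j < ?s j') \<longleftrightarrow>
      \<not> (\<exists>i\<ge>rim - int u. crossed \<alpha> \<beta> i)"
    using Suc.IH[of "?s j" "?s j'"] swaps_steps_range[of j u] swaps_steps_range[of j' u] Suc.prems ne L by simp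
  have new: "crossed \<alpha> \<beta> (rim - 1 - int u) \<longleftrightarrow> (\<exists>a\<in>steps \<Lambda> u. {j, j'} = {a, Suc a})"
    using crossed_iff_step[OF Suc.prems] by (simp add: \<alpha>_def \<beta>_def)
  have split: "(\<exists>i\<ge>rim - int (Suc u). crossed \<alpha> \<beta> i) \<longleftrightarrow>
      (\<exists>i\<ge>rim - int u. crossed \<alpha> \<beta> i) \<or> crossed \<alpha> \<beta> (rim - 1 - int u)"
  proof -
    have "i \<ge> rim - int (Suc u) \<longleftrightarrow> i \<ge> rim - int u \<or> i = rim - 1 - int u" for i
      by auto
    then show ?thesis by metis
  qed
  show ?case
  proof (cases "crossed \<alpha> \<beta> (rim - 1 - int u)")
    case True
    then have "\<not> (\<exists>i\<ge>rim - int u. crossed \<alpha> \<beta> i)"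
      using crossed_unique[OF L(1,2)] by fastforce
    moreover have "?s j < ?s j' \<longleftrightarrow> \<not> j < j'"
    proof -
      obtain a where a: "a \<in> steps \<Lambda> u" "{j, j'} = {a, Suc a}"
        using new True by blast
      then have "?s a = Suc a" "?s (Suc a) = a"
        using sparse_steps[of u] by (auto simp: swaps_def sparse_def)
      with a show ?thesis by (auto simp: doubleton_eq_iff)
    qed
    ultimately show ?thesis
      using IH True split unfolding \<alpha>_def[symmetric] \<beta>_def[symmetric] by blast
  next
    case False
    then have "?s j < ?s j' \<longleftrightarrow> j < j'"
      using new swaps_less_iff[OF sparse_steps Suc.prems(5), of u] by blast
    with False show ?thesis
      using IH split unfolding \<alpha>_def[symmetric] \<beta>_def[symmetric] by blast
  qed
qed

text \<open>The network of crossings is reduced: a pair about to cross has not crossed further right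
  in the window, because it crosses there only once.\<close>

lemma state_less_at_steps:
  assumes "j \<in> steps \<Lambda> u"
  shows "state (steps \<Lambda>) u j < state (steps \<Lambda>) u (Suc j)"
proof -
  have r: "k \<le> j" "j < n - k" "k \<le> Suc j" "Suc j < n - k"
    using steps_vertices[OF assms] by auto
  have sw: "swaps (steps \<Lambda> u) j = Suc j" "swaps (steps \<Lambda> u) (Suc j) = j"
    using assms sparse_steps[of u] by (auto simp: swaps_def sparse_def)
  have w: "wire (Suc u) j = wire u (Suc j)" "wire (Suc u) (Suc j) = wire u j"
    using wire_Suc r sw by simp_all
  have cr: "crossed (wire u j) (wire u (Suc j)) (rim - 1 - int u)"
    using crossed_iff_step[of "Suc j" j u] r assms w by auto
  have "\<not> (\<exists>i\<ge>rim - int u. crossed (wire u j) (wire u (Suc j)) i)"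
    using crossed_unique[OF _ _ cr] wire r by fastforce
  then show ?thesis
    using state_order[of j "Suc j" u] r by auto
qed

end

section \<open>Uniqueness and transitivity of the greedy property\<close>

context cut_network begin

text \<open>Induction over the swept columns. As long as both wirings agree, they produce the same
  labels. A vertex that is a crossing of one and a contact of the other lies outside
  \<open>V\<close>; greediness of the latter says that its labels are inverted, reducedness of the
  former that they are not. Agreement in the window then spreads to all translates.\<close>

lemma greedy_wiring_unique:
  assumes "wiring k \<Lambda>" "wiring k \<Lambda>'" "greedy_wiring k V \<Lambda>" "greedy_wiring k V \<Lambda>'"
    and "V \<inter> window \<inter> vertices_in k \<subseteq> wcontacts k \<Lambda>" "V \<inter> window \<inter> vertices_in k \<subseteq> wcontacts k \<Lambda>'"
  shows "\<Lambda> = \<Lambda>'"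
proof -
  have sub: "steps \<Lambda> u \<subseteq> steps \<Lambda>' u"
    if a: "wiring k \<Lambda>" "wiring k \<Lambda>'" "greedy_wiring k V \<Lambda>'" "V \<inter> window \<inter> vertices_in k \<subseteq> wcontacts k \<Lambda>"
      and eq: "\<And>v. v < u \<Longrightarrow> steps \<Lambda> v = steps \<Lambda>' v" for \<Lambda> \<Lambda>' u
  proof (rule subsetI, rule ccontr)
    interpret A: cut_wires n r W c k \<Lambda> using a(1) by unfold_locales
    interpret B: cut_wires n r W c k \<Lambda>' using a(2) by unfold_locales
    fix j assume j: "j \<in> steps \<Lambda> u" "j \<notin> steps \<Lambda>' u"
    define i where "i = rim - 1 - int u"
    have ij: "(i, j) \<in> crossings \<Lambda>" "(i, j) \<in> window" "(i, j) \<notin> crossings \<Lambda>'"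
      using j by (auto simp: steps_def i_def)
    then have v: "(i, j) \<in> vertices_in k"
      using A.crossings_W by blast
    then have "(i, j) \<notin> V"
      using a(4) ij by (auto simp: wcontacts_def)
    then have "state (steps \<Lambda>') u (Suc j) < state (steps \<Lambda>') u j"
      using a(3) ij v unfolding greedy_wiring_def wcontacts_def by (force simp: i_def)
    moreover have "state (steps \<Lambda>') u = state (steps \<Lambda>) u"
      using state_cong[of u "steps \<Lambda>" "steps \<Lambda>'"] eq by (intro ext) simp
    ultimately show False
      using A.state_less_at_steps[OF j(1)] by simp
  qed
  have eq: "steps \<Lambda> u = steps \<Lambda>' u" for u
    by (induction u rule: less_induct) (use sub[OF assms(1,2,4,5)] sub[OF assms(2,1,3,6)] in blast)
  have cr: "(i, j) \<in> crossings \<Lambda> \<longleftrightarrow> (i, j) \<in> crossings \<Lambda>'" if "(i, j) \<in> window" for i j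
    using eq[of "nat (rim - 1 - i)"] window_less_rim[OF that] that by (auto simp: steps_def)
  have sh: "(i + r, n - 2 - j) \<in> crossings \<Lambda> \<longleftrightarrow> (i, j) \<in> crossings \<Lambda>"
    if "(i, j) \<in> W" "wiring k \<Lambda>" for i j \<Lambda>
  proof -
    interpret A: wires n r W k \<Lambda> using that(2) by unfold_locales
    show ?thesis by (rule A.crossings_shift[OF that(1)])
  qed
  have "(i, j) \<in> crossings \<Lambda> \<longleftrightarrow> (i, j) \<in> crossings \<Lambda>'" if "(i, j) \<in> W" for i j
    using window_shift_induct[OF that, of "\<lambda>i j. (i, j) \<in> crossings \<Lambda> \<longleftrightarrow> (i, j) \<in> crossings \<Lambda>'"]
      sh assms(1,2) cr by blast
  then have "wcontacts k \<Lambda> = wcontacts k \<Lambda>'"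
    by (auto simp: wcontacts_def vertices_in_def)
  then show ?thesis
    using wiring_determined assms(1,2) by blast
qed

text \<open>Only the contacts of the outer wiring need an argument, since they were prescribed for
  the inner one. Outside \<open>V\<close> their labels are inverted in the outer network by its own
  greediness, and \<open>state_inverted_mono\<close> passes the inversion on to the inner
  network.\<close>

lemma greedy_wiring_trans:
  assumes "wiring a \<Lambda>" "wiring b \<Lambda>'" "a \<le> b" "greedy_wiring a V \<Lambda>" "greedy_wiring b (wcontacts a \<Lambda>) \<Lambda>'"
    and "wcontacts a \<Lambda> \<inter> vertices_in b \<subseteq> wcontacts b \<Lambda>'"
  shows "greedy_wiring b V \<Lambda>'"
  unfolding greedy_wiring_def
proof (intro allI impI)
  interpret A: cut_wires n r W c a \<Lambda> using assms(1) by unfold_locales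
  interpret B: cut_wires n r W c b \<Lambda>' using assms(2) by unfold_locales
  fix i j assume ij: "(i, j) \<in> wcontacts b \<Lambda>'" "(i, j) \<in> window" "(i, j) \<notin> V"
  let ?u = "nat (rim - 1 - i)"
  show "state (steps \<Lambda>') ?u (Suc j) < state (steps \<Lambda>') ?u j"
  proof (cases "(i, j) \<in> wcontacts a \<Lambda>")
    case False
    then show ?thesis
      using assms(5) ij unfolding greedy_wiring_def by blast
  next
    case True
    then have "state (steps \<Lambda>) ?u (Suc j) < state (steps \<Lambda>) ?u j"
      using assms(4) ij unfolding greedy_wiring_def by blast
    moreover have "b \<le> j" "Suc j < n - b"
      using ij by (auto simp: wcontacts_def vertices_in_def)
    \<comment> \<open>The inner wiring runs the outer crossings as comparators: such a crossing is
      not among the prescribed contacts, so it is skipped only if the labels are inverted already,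
      and by reducedness it is performed only if they are not.\<close>
    moreover have "j \<in> steps \<Lambda>' u \<longleftrightarrow> j \<in> steps \<Lambda> u \<and> b \<le> j \<and> Suc j < n - b \<and>
        state (steps \<Lambda>') u j < state (steps \<Lambda>') u (Suc j)" for u j
    proof
      assume j: "j \<in> steps \<Lambda>' u"
      then have v: "(rim - 1 - int u, j) \<in> vertices_in b" "(rim - 1 - int u, j) \<notin> wcontacts b \<Lambda>'"
        using B.crossings_W by (auto simp: steps_def wcontacts_def)
      then have "(rim - 1 - int u, j) \<notin> wcontacts a \<Lambda>"
        using assms(6) by blast
      moreover have "(rim - 1 - int u, j) \<in> vertices_in a"
        using v(1) assms(3) by (auto simp: vertices_in_def)
      ultimately show "j \<in> steps \<Lambda> u \<and> b \<le> j \<and> Suc j < n - b \<and> state (steps \<Lambda>') u j < state (steps \<Lambda>') u (Suc j)"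
        using j v(1) B.state_less_at_steps[OF j] by (auto simp: steps_def wcontacts_def vertices_in_def)
    next
      assume j: "j \<in> steps \<Lambda> u \<and> b \<le> j \<and> Suc j < n - b \<and> state (steps \<Lambda>') u j < state (steps \<Lambda>') u (Suc j)"
      then have x: "(rim - 1 - int u, j) \<in> crossings \<Lambda>" "(rim - 1 - int u, j) \<in> window"
        by (auto simp: steps_def)
      show "j \<in> steps \<Lambda>' u"
      proof (rule ccontr)
        assume "j \<notin> steps \<Lambda>' u"
        then have "(rim - 1 - int u, j) \<in> wcontacts b \<Lambda>'"
          using x j by (auto simp: steps_def wcontacts_def vertices_in_def window_def)
        moreover have "(rim - 1 - int u, j) \<notin> wcontacts a \<Lambda>"
          using x by (auto simp: wcontacts_def)
        ultimately have "state (steps \<Lambda>') u (Suc j) < state (steps \<Lambda>') u j"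
          using assms(5) x unfolding greedy_wiring_def by force
        with j show False by simp
      qed
    qed
    ultimately show ?thesis
      using state_inverted_mono[of "steps \<Lambda>" "steps \<Lambda>'" b "n - b" j "Suc j" ?u]
        A.sparse_steps A.state_less_at_steps by simp
  qed
qed

end

section \<open>Existence of a wiring on the inner levels\<close>

primrec comparators :: "(nat \<Rightarrow> nat set) \<Rightarrow> nat \<Rightarrow> nat \<Rightarrow> nat \<Rightarrow> nat \<Rightarrow> nat" where
  "comparators A k m 0 = id"
| "comparators A k m (Suc u) = comparators A k m u \<circ>
     swaps {j \<in> A u. k \<le> j \<and> Suc j < m \<and> comparators A k m u j < comparators A k m u (Suc j)}"

text \<open>The layers of \<open>B\<close> depend on the states that its earlier layers produce.
  Hence \<open>comparators\<close> computes the states by a direct recursion, and the layers are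
  read off from it.\<close>

lemma comparators_ex:
  "\<exists>B. \<forall>u j. j \<in> B u \<longleftrightarrow> j \<in> A u \<and> k \<le> j \<and> Suc j < m \<and> state B u j < state B u (Suc j)"
proof -
  define B where "B u = {j \<in> A u. k \<le> j \<and> Suc j < m \<and> comparators A k m u j < comparators A k m u (Suc j)}" for u
  have "state B u j = comparators A k m u j" for u j
    by (induction u arbitrary: j) (simp_all add: B_def)
  then show ?thesis
    by (intro exI[of _ B]) (simp add: B_def)
qed

primrec level_of :: "(nat \<Rightarrow> nat set) \<Rightarrow> nat \<Rightarrow> nat \<Rightarrow> nat" where
  "level_of B 0 a = a"
| "level_of B (Suc u) a = swaps (B u) (level_of B u a)"

lemma state_level_of: "(\<And>u. sparse (B u)) \<Longrightarrow> state B u (level_of B u a) = a"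
  by (induction u) (simp_all add: swaps_swaps)

lemma level_of_state: "(\<And>u. sparse (B u)) \<Longrightarrow> level_of B u (state B u j) = j"
  using state_level_of[of B u "state B u j"] state_inj[of B u "level_of B u (state B u j)" j] by simp

lemma level_of_range:
  assumes "\<And>u. B u \<subseteq> {j. k \<le> j \<and> Suc j < m}" "k \<le> a" "a < m"
  shows "k \<le> level_of B u a \<and> level_of B u a < m"
  by (induction u) (simp_all add: assms(2,3) swaps_range[OF assms(1)])

text \<open>A strictly decreasing self-map of an interval has no slack: at distance \<open>d\<close>
  from the left end its value is at least \<open>d\<close> below the top, at distance
  \<open>d\<close> from the right end at least \<open>d\<close> above the bottom.\<close>

lemma decreasing_interval:
  fixes f :: "nat \<Rightarrow> nat"
  assumes dec: "\<And>i j. k \<le> i \<Longrightarrow> i < j \<Longrightarrow> j < m \<Longrightarrow> f j < f i"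
    and rng: "\<And>i. k \<le> i \<Longrightarrow> i < m \<Longrightarrow> k \<le> f i \<and> f i < m" and "k \<le> j" "j < m"
  shows "f j = k + m - 1 - j"
proof -
  have up: "f (k + d) + d < m" if "k + d < m" for d
    using that
  proof (induction d)
    case 0
    then show ?case using rng[of k] by simp
  next
    case (Suc d)
    then show ?case using dec[of "k + d" "k + Suc d"] by simp
  qed
  have dn: "k + d \<le> f (m - 1 - d)" if "k + d < m" for d
    using that
  proof (induction d)
    case 0
    then show ?case using rng[of "m - 1"] by simp
  next
    case (Suc d)
    then have "k \<le> m - 1 - Suc d" "m - 1 - Suc d < m - 1 - d" "m - 1 - d < m"
      by linarith+
    from dec[OF this] Suc show ?case by linarith
  qed
  have "f j + (j - k) < m"
    using up[of "j - k"] assms(3,4) by simp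
  moreover have "k + (m - 1 - j) \<le> f j"
    using dn[of "m - 1 - j"] assms(3,4) by simp
  ultimately show ?thesis
    using assms(3,4) by linarith
qed

context network begin

text \<open>A full sweep of the given wiring inverts every pair of levels, so by
  \<open>state_inverted_mono\<close> the comparators on the inner levels do so as well and end in
  the reversal. Comparators exchange a pair of labels at most once, hence here exactly once.
  Continued antiperiodically they trace a wiring, all of whose crossings are crossings of the given
  one, so that old contacts remain contacts.\<close>

lemma wiring_restrict_ex:
  assumes "wiring a \<Lambda>" "a \<le> b"
  shows "\<exists>\<Lambda>'. wiring b \<Lambda>' \<and> wcontacts a \<Lambda> \<inter> vertices_in b \<subseteq> wcontacts b \<Lambda>'"
proof (cases "b < n - b")
  case False
  \<comment> \<open>No level is left, and the empty set of wires is a wiring.\<close>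
  then have "wiring b {}" "vertices_in b = {}"
    by (auto simp: wiring_def prewiring_def vertices_in_def)
  then show ?thesis by blast
next
  case True
  \<comment> \<open>Any cut serves here. The vertical one at column 0 has the columns from 0 to
    \<open>r - 1\<close> as its window, so that \<open>rim\<close> is \<open>r\<close>.\<close>
  interpret cut_wires n r W "\<lambda>_. 0" a \<Lambda>
    using assms(1) r_pos by unfold_locales auto
  define R where "R = nat r"
  have R: "int R = r"
    using r_pos by (simp add: R_def)
  have c'r: "c' j = r" for j
    by (simp add: c'_def)
  have "0 < n"
    using True by simp
  then have "c' ` {..<n} = {r}"
    by (auto simp: c'r image_iff)
  then have "rim = Max (insert 0 {r})"
    by (simp add: rim_def)
  then have rim: "rim = r"
    using r_pos by simp
  define A where "A = steps \<Lambda>"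
  obtain B where B: "j \<in> B u \<longleftrightarrow> j \<in> A u \<and> b \<le> j \<and> Suc j < n - b \<and> state B u j < state B u (Suc j)" for u j
    using comparators_ex[of A b "n - b"] by blast
  have spA: "sparse (A u)" for u
    by (simp add: A_def sparse_steps)
  have spB: "sparse (B u)" for u
    using spA[of u] by (simp add: sparse_def B)
  have rB: "B u \<subseteq> {j. b \<le> j \<and> Suc j < n - b}" for u
    using B by blast
  have final: "state B R j = n - 1 - j" if "b \<le> j" "j < n - b" for j
  proof -
    have "state B R j = b + (n - b) - 1 - j"
    proof (rule decreasing_interval[OF _ _ that])
      fix i j assume ij: "b \<le> i" "i < j" "j < n - b"
      have "i \<noteq> j" "a \<le> i" "i < n - a" "a \<le> j" "j < n - a"
        using ij assms(2) by auto
      moreover have "wire R i \<in> \<Lambda>" "wire R j \<in> \<Lambda>" "wire R i \<noteq> wire R j"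
        using wire[of i R] wire[of j R] wire_inj[of i j R] calculation by auto
      then obtain x where x: "crossed (wire R i) (wire R j) x"
        using crossed_ex by blast
      then have "x \<ge> rim - int R"
        by (auto simp: crossed_def window_def rim R)
      ultimately have "\<not> state (steps \<Lambda>) R i < state (steps \<Lambda>) R j"
        using state_order[of i j R] x ij by auto
      then have "state A R j < state A R i"
        using state_inj[of "steps \<Lambda>" R i j] sparse_steps \<open>i \<noteq> j\<close> unfolding A_def by fastforce
      then show "state B R j < state B R i"
        using state_inverted_mono[of A B b "n - b" i j R] spA B ij state_less_at_steps by (simp add: A_def)
    next
      show "b \<le> state B R i \<and> state B R i < n - b" if "b \<le> i" "i < n - b" for i
        using state_range[of B b "n - b", OF rB that] .
    qed
    then show ?thesis
      using True by simp
  qed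
  \<comment> \<open>The section to the right of column \<open>i\<close> of the first period is
    reached after the columns \<open>r - 1\<close> down to \<open>i + 1\<close>, that is, after
    \<open>R - 1 - i\<close> layers. Other periods are copies, reflected when \<open>i div r\<close>
    is odd.\<close>
  define u where "u i = R - 1 - nat (i mod r)" for i
  define \<phi> where "\<phi> x i = (if even (i div r) then level_of B (u i) x else n - 1 - level_of B (u i) x)" for x i
  define J where "J = {x. b \<le> x \<and> x < n - b}"
  have lv: "level_of B v x \<in> J" if "x \<in> J" for v x
    using level_of_range[of B b "n - b", OF rB] that by (auto simp: J_def)
  have rng: "\<phi> x i \<in> J" if "x \<in> J" for x i
    using lv[OF that, of "u i"] by (auto simp: \<phi>_def J_def)
  have sh: "\<phi> x (i + r) = n - 1 - \<phi> x i" if "x \<in> J" for x i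
  proof -
    have "(i + r) div r = i div r + 1"
      using r_pos by (intro div_add_self2) simp
    then show ?thesis
      using lv[OF that, of "u i"] by (auto simp: \<phi>_def u_def J_def)
  qed
  have col: "\<phi> x i = level_of B (R - 1 - nat i) x" "\<phi> x (i - 1) = level_of B (Suc (R - 1 - nat i)) x"
    if "x \<in> J" "0 \<le> i" "i < r" for x i
  proof -
    show "\<phi> x i = level_of B (R - 1 - nat i) x"
      using that by (simp add: \<phi>_def u_def)
    show "\<phi> x (i - 1) = level_of B (Suc (R - 1 - nat i)) x"
    \<comment> \<open>Section -1 belongs to the previous period: the reflected starting level
      \<open>n - 1 - x\<close> has to agree with the level reached after all \<open>R\<close>
      layers, which is what \<open>final\<close> provides.\<close>
    proof (cases "i = 0")
      case True
      have "R - 1 - nat (r - 1) = 0"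
        using R by linarith
      have "(-1) div r = - 1" "(-1) mod r = r - 1"
        using r_pos by (simp_all add: div_eq_minus1 zmod_minus1)
      with True have "\<phi> x (i - 1) = n - 1 - x"
        using True \<open>R - 1 - nat (r - 1) = 0\<close> by (simp add: \<phi>_def u_def)
      moreover have "level_of B R x = n - 1 - x"
      proof -
        have "n - 1 - x \<in> J" "n - 1 - (n - 1 - x) = x"
          using that(1) by (auto simp: J_def)
        then show ?thesis
          using final[of "n - 1 - x"] level_of_state[of B R "n - 1 - x", OF spB] by (simp add: J_def)
      qed
      moreover have "Suc (R - 1 - nat i) = R"
        using True R r_pos by simp
      ultimately show ?thesis by simp
    next
      case False
      then have "\<phi> x (i - 1) = level_of B (R - 1 - nat (i - 1)) x"
        using that by (simp add: \<phi>_def u_def)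
      moreover have "R - 1 - nat (i - 1) = Suc (R - 1 - nat i)"
        using False that R by linarith
      ultimately show ?thesis by simp
    qed
  qed
  have leftstep: "\<phi> x (i - 1) = swaps (B (R - 1 - nat i)) (\<phi> x i)" if "x \<in> J" "0 \<le> i" "i < r" for x i
    using col[OF that] by simp
  have BW: "(i, j) \<in> crossings \<Lambda>" "(i, j) \<in> W" if "j \<in> B (R - 1 - nat i)" "0 \<le> i" "i < r" for i j
  proof -
    have "j \<in> steps \<Lambda> (R - 1 - nat i)"
      using that B by (simp add: A_def)
    moreover have "rim - 1 - int (R - 1 - nat i) = i"
      using that R rim by linarith
    ultimately show "(i, j) \<in> crossings \<Lambda>" "(i, j) \<in> W"
      by (auto simp: steps_def window_def)
  qed
  have red: "P i" if "\<And>i. P (i + r) \<longleftrightarrow> P i" "\<And>i. 0 \<le> i \<Longrightarrow> i < r \<Longrightarrow> P i" for P and i :: int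
    using periodic_dvd[of P r i "i mod r"] that r_pos by (simp add: minus_mod_eq_mult_div)
  have inj: "x = y" if "x \<in> J" "y \<in> J" "\<phi> x i = \<phi> y i" for x y i
  proof -
    have "level_of B (u i) x = level_of B (u i) y"
      using that lv[OF that(1), of "u i"] lv[OF that(2), of "u i"] unfolding \<phi>_def J_def by (auto split: if_splits)
    then show ?thesis
      using state_level_of[of B "u i", OF spB] by metis
  qed
  have once: "\<exists>d. \<forall>i. crosses_at (\<phi> x) (\<phi> y) i \<longleftrightarrow> r dvd i - d" if xy: "x \<in> J" "y \<in> J" "x < y" for x y
  proof -
    have ne: "\<phi> x i \<noteq> \<phi> y i" for i
      using inj[OF xy(1,2), of i] xy(3) by blast
    have lt: "\<phi> x i < n" "\<phi> y i < n" for i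
      using rng[OF xy(1), of i] rng[OF xy(2), of i] by (auto simp: J_def)
    have per: "crosses_at (\<phi> x) (\<phi> y) (i + r) \<longleftrightarrow> crosses_at (\<phi> x) (\<phi> y) i" for i
      by (intro crosses_at_shift sh xy lt ne)
    \<comment> \<open>\<open>I v\<close> says that the labels \<open>x < y\<close> stand in reverse
      order after \<open>v\<close> layers. Comparators never undo this, so it switches on at a
      single layer, which is the only crossing of the pair in the period.\<close>
    define I where "I v \<longleftrightarrow> level_of B v y < level_of B v x" for v
    have I_Suc: "I (Suc v)" if "I v" for v
    proof -
      have "\<not> (level_of B v y \<in> B v \<and> level_of B v x = Suc (level_of B v y))"
      proof
        assume *: "level_of B v y \<in> B v \<and> level_of B v x = Suc (level_of B v y)"
        then have "state B v (level_of B v y) < state B v (level_of B v x)"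
          using B by simp
        then show False
          using xy(3) by (simp add: state_level_of spB)
      qed
      then show ?thesis
        using swaps_less[OF spB, of "level_of B v y" "level_of B v x" v] that by (simp add: I_def)
    qed
    have I_mono: "I w" if "I v" "v \<le> w" for v w
      using that(2,1) by (induction w rule: dec_induct) (auto intro: I_Suc)
    have cr: "crosses_at (\<phi> x) (\<phi> y) i \<longleftrightarrow> \<not> I (R - 1 - nat i) \<and> I (Suc (R - 1 - nat i))" if "0 \<le> i" "i < r" for i
    proof -
      have "\<phi> x i < \<phi> y i \<longleftrightarrow> \<not> I (R - 1 - nat i)" "\<phi> x (i - 1) < \<phi> y (i - 1) \<longleftrightarrow> \<not> I (Suc (R - 1 - nat i))"
        using ne[of i] ne[of "i - 1"] col[OF xy(1) that] col[OF xy(2) that] unfolding I_def by auto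
      then show ?thesis
        using I_Suc by (auto simp: crosses_at_def)
    qed
    obtain d0 where d0: "crosses_at (\<phi> x) (\<phi> y) d0"
      using crosses_at_ex[of "\<phi> x" "\<phi> y"] sh[OF xy(1), of 0] sh[OF xy(2), of 0] lt[of 0] ne[of 0] by auto
    define d where "d = d0 mod r"
    have modr: "crosses_at (\<phi> x) (\<phi> y) i \<longleftrightarrow> crosses_at (\<phi> x) (\<phi> y) (i mod r)" for i
      using periodic_dvd[of "crosses_at (\<phi> x) (\<phi> y)" r i "i mod r"] per by (simp add: minus_mod_eq_mult_div)
    have d: "0 \<le> d" "d < r" "crosses_at (\<phi> x) (\<phi> y) d"
      using d0 modr[of d0] r_pos by (simp_all add: d_def)
    have uniq: "i = d" if i: "0 \<le> i" "i < r" "crosses_at (\<phi> x) (\<phi> y) i" for i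
    proof -
      have "\<not> Suc (R - 1 - nat i) \<le> R - 1 - nat d"
        using cr[OF i(1,2)] cr[OF d(1,2)] i(3) d(3) I_mono by blast
      moreover have "\<not> Suc (R - 1 - nat d) \<le> R - 1 - nat i"
        using cr[OF i(1,2)] cr[OF d(1,2)] i(3) d(3) I_mono by blast
      ultimately show ?thesis
        using i d R by linarith
    qed
    have "crosses_at (\<phi> x) (\<phi> y) i \<longleftrightarrow> r dvd i - d" for i
    proof -
      have "crosses_at (\<phi> x) (\<phi> y) i \<longleftrightarrow> i mod r = d"
        using modr[of i] uniq[of "i mod r"] d(3) r_pos by auto
      also have "\<dots> \<longleftrightarrow> r dvd i - d"
        using d by (metis mod_eq_dvd_iff mod_pos_pos_trivial)
      finally show ?thesis .
    qed
    then show ?thesis by blast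
  qed
  define \<Lambda>' where "\<Lambda>' = \<phi> ` J"
  have wir: "wiring b \<Lambda>'"
    unfolding wiring_def prewiring_def
  proof (intro conjI ballI allI impI)
    fix \<alpha> i assume "\<alpha> \<in> \<Lambda>'"
    then show "b \<le> \<alpha> i" "\<alpha> i < n - b" "\<alpha> (i + r) = n - 1 - \<alpha> i"
      using rng[of _ i] sh[of _ i] by (auto simp: \<Lambda>'_def J_def)
  next
    fix \<alpha> i assume "\<alpha> \<in> \<Lambda>'"
    then obtain x where x: "x \<in> J" "\<alpha> = \<phi> x"
      by (auto simp: \<Lambda>'_def)
    show "\<alpha> i = \<alpha> (i - 1) \<or> \<alpha> i = Suc (\<alpha> (i - 1)) \<and> (i, \<alpha> (i - 1)) \<in> W \<or> \<alpha> (i - 1) = Suc (\<alpha> i) \<and> (i, \<alpha> i) \<in> W"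
    proof (rule red[where P = "\<lambda>i. \<alpha> i = \<alpha> (i - 1) \<or> \<alpha> i = Suc (\<alpha> (i - 1)) \<and> (i, \<alpha> (i - 1)) \<in> W \<or> \<alpha> (i - 1) = Suc (\<alpha> i) \<and> (i, \<alpha> i) \<in> W"])
      fix i
      have s: "\<alpha> (i + r) = n - 1 - \<alpha> i" "\<alpha> (i + r - 1) = n - 1 - \<alpha> (i - 1)"
        using sh[OF x(1), of i] sh[OF x(1), of "i - 1"] x(2) by (simp_all add: algebra_simps)
      have l: "\<alpha> i < n" "\<alpha> (i - 1) < n"
        using rng[OF x(1), of i] rng[OF x(1), of "i - 1"] x(2) by (auto simp: J_def)
      have 1: "\<alpha> (i + r) = \<alpha> (i + r - 1) \<longleftrightarrow> \<alpha> i = \<alpha> (i - 1)"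
        unfolding s using l by auto
      have 2: "\<alpha> (i + r) = Suc (\<alpha> (i + r - 1)) \<and> (i + r, \<alpha> (i + r - 1)) \<in> W \<longleftrightarrow> \<alpha> (i - 1) = Suc (\<alpha> i) \<and> (i, \<alpha> i) \<in> W"
      proof -
        have "\<alpha> (i + r) = Suc (\<alpha> (i + r - 1)) \<longleftrightarrow> \<alpha> (i - 1) = Suc (\<alpha> i)"
          unfolding s using l by auto
        moreover have "\<alpha> (i + r - 1) = n - 2 - \<alpha> i" if "\<alpha> (i - 1) = Suc (\<alpha> i)"
          unfolding s that by simp
        ultimately show ?thesis
          using W_shift[of "\<alpha> i" i] l by auto
      qed
      have 3: "\<alpha> (i + r - 1) = Suc (\<alpha> (i + r)) \<and> (i + r, \<alpha> (i + r)) \<in> W \<longleftrightarrow> \<alpha> i = Suc (\<alpha> (i - 1)) \<and> (i, \<alpha> (i - 1)) \<in> W"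
      proof -
        have "\<alpha> (i + r - 1) = Suc (\<alpha> (i + r)) \<longleftrightarrow> \<alpha> i = Suc (\<alpha> (i - 1))"
          unfolding s using l by auto
        moreover have "\<alpha> (i + r) = n - 2 - \<alpha> (i - 1)" if "\<alpha> i = Suc (\<alpha> (i - 1))"
          unfolding s that by simp
        ultimately show ?thesis
          using W_shift[of "\<alpha> (i - 1)" i] l by auto
      qed
      show "(\<alpha> (i + r) = \<alpha> (i + r - 1) \<or> \<alpha> (i + r) = Suc (\<alpha> (i + r - 1)) \<and> (i + r, \<alpha> (i + r - 1)) \<in> W \<or>
          \<alpha> (i + r - 1) = Suc (\<alpha> (i + r)) \<and> (i + r, \<alpha> (i + r)) \<in> W) \<longleftrightarrow>
        (\<alpha> i = \<alpha> (i - 1) \<or> \<alpha> i = Suc (\<alpha> (i - 1)) \<and> (i, \<alpha> (i - 1)) \<in> W \<or> \<alpha> (i - 1) = Suc (\<alpha> i) \<and> (i, \<alpha> i) \<in> W)"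
        using 1 2 3 by satx
    next
      fix i :: int assume i: "0 \<le> i" "i < r"
      let ?B = "B (R - 1 - nat i)"
      have e: "\<alpha> (i - 1) = swaps ?B (\<alpha> i)"
        using leftstep[OF x(1) i] x(2) by simp
      have "\<alpha> i \<in> ?B \<and> swaps ?B (\<alpha> i) = Suc (\<alpha> i) \<or> swaps ?B (\<alpha> i) \<in> ?B \<and> \<alpha> i = Suc (swaps ?B (\<alpha> i)) \<or> swaps ?B (\<alpha> i) = \<alpha> i"
        by (auto simp: swaps_def)
      then show "\<alpha> i = \<alpha> (i - 1) \<or> \<alpha> i = Suc (\<alpha> (i - 1)) \<and> (i, \<alpha> (i - 1)) \<in> W \<or> \<alpha> (i - 1) = Suc (\<alpha> i) \<and> (i, \<alpha> i) \<in> W"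
        unfolding e using BW(2)[OF _ i] by metis
    qed
  next
    fix i j assume j: "b \<le> j \<and> j < n - b"
    define x where "x = state B (u i) (if even (i div r) then j else n - 1 - j)"
    have "b \<le> (if even (i div r) then j else n - 1 - j)" "(if even (i div r) then j else n - 1 - j) < n - b"
      using j by auto
    from state_range[of B b "n - b", OF rB this, of "u i"] have x: "x \<in> J"
      by (simp add: x_def J_def)
    have xe: "\<phi> x i = j"
      unfolding \<phi>_def x_def level_of_state[OF spB] using j by auto
    show "\<exists>!\<alpha>. \<alpha> \<in> \<Lambda>' \<and> \<alpha> i = j"
    proof (rule ex1I[of _ "\<phi> x"])
      show "\<phi> x \<in> \<Lambda>' \<and> \<phi> x i = j"
        using x xe by (simp add: \<Lambda>'_def)
      show "\<alpha> = \<phi> x" if "\<alpha> \<in> \<Lambda>' \<and> \<alpha> i = j" for \<alpha>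
        using that inj[OF _ x, of _ i] xe by (auto simp: \<Lambda>'_def)
    qed
  next
    fix \<alpha> \<beta> assume ab: "\<alpha> \<in> \<Lambda>'" "\<beta> \<in> \<Lambda>'" "\<alpha> \<noteq> \<beta>"
    then obtain x y where xy: "x \<in> J" "\<alpha> = \<phi> x" "y \<in> J" "\<beta> = \<phi> y"
      by (auto simp: \<Lambda>'_def)
    have ne: "\<alpha> i \<noteq> \<beta> i" for i
      using inj[OF xy(1,3), of i] xy ab(3) by auto
    have "crosses_at \<beta> \<alpha> i \<longleftrightarrow> crosses_at \<alpha> \<beta> i" for i
      using ne[of i] ne[of "i - 1"] unfolding crosses_at_def by linarith
    moreover have "x < y \<or> y < x"
      using ab(3) xy by auto
    ultimately show "\<exists>d. \<forall>i. crosses_at \<alpha> \<beta> i \<longleftrightarrow> r dvd i - d"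
      using once[OF xy(1,3)] once[OF xy(3,1)] xy(2,4) by auto
  qed
  interpret N: wires n r W b \<Lambda>'
    using wir by unfold_locales
  have "(i, j) \<in> crossings \<Lambda>' \<longrightarrow> (i, j) \<in> crossings \<Lambda>" if "(i, j) \<in> W" for i j
    using that
  proof (rule window_shift_induct[where P = "\<lambda>i j. (i, j) \<in> crossings \<Lambda>' \<longrightarrow> (i, j) \<in> crossings \<Lambda>"])
    fix i j assume "(i, j) \<in> window"
    then have i: "0 \<le> i" "i < r"
      by (auto simp: window_def c'r)
    show "(i, j) \<in> crossings \<Lambda>' \<longrightarrow> (i, j) \<in> crossings \<Lambda>"
    proof
      assume "(i, j) \<in> crossings \<Lambda>'"
      then obtain x where x: "x \<in> J" "\<phi> x (i - 1) = j" "\<phi> x i = Suc j"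
        by (auto simp: crossings_def \<Lambda>'_def)
      then have "swaps (B (R - 1 - nat i)) (Suc j) = j"
        using leftstep[OF x(1) i] by simp
      then have "j \<in> B (R - 1 - nat i)"
        by (auto simp: swaps_def split: if_splits)
      then show "(i, j) \<in> crossings \<Lambda>"
        using BW(1) i by blast
    qed
  qed (simp only: crossings_shift N.crossings_shift)
  then have "wcontacts a \<Lambda> \<inter> vertices_in b \<subseteq> wcontacts b \<Lambda>'"
    using N.crossings_W by (auto simp: wcontacts_def vertices_in_def)
  with wir show ?thesis
    by blast
qed

end

context cut_wires begin

text \<open>If the labels at the contact are not inverted, the pair has not crossed to its right, so
  its crossing in the window lies at some \<open>p\<close> to the left, less than a period away.
  \<open>swap_wires\<close> exchanges the two, and the way back is a flip that moves a contact from
  \<open>p\<close> to the later column \<open>i\<close>.\<close>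

lemma not_greedy_swap:
  assumes ij: "(i, j) \<in> wcontacts k \<Lambda>" "(i, j) \<in> window"
    and ns: "\<not> state (steps \<Lambda>) (nat (rim - 1 - i)) (Suc j) < state (steps \<Lambda>) (nat (rim - 1 - i)) j"
  obtains \<Lambda>' \<alpha> \<beta> p where "wiring k \<Lambda>'" "\<alpha> \<in> \<Lambda>'" "\<beta> \<in> \<Lambda>'" "crosses_at \<alpha> \<beta> i" "min (\<alpha> i) (\<beta> i) = j"
    "\<not> crosses_at \<alpha> \<beta> p" "\<alpha> p = Suc (\<beta> p) \<or> \<beta> p = Suc (\<alpha> p)" "(p, min (\<alpha> p) (\<beta> p)) \<in> window" "p < i"
    "(p, min (\<alpha> p) (\<beta> p)) \<in> crossings \<Lambda>"
    "crossings \<Lambda>' = crossings \<Lambda> - {(m, min (\<alpha> m) (\<beta> m)) |m. r dvd m - p} \<union>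
       {(m, min (\<alpha> m) (\<beta> m)) |m. r dvd m - i}"
proof -
  let ?u = "nat (rim - 1 - i)"
  have u: "rim - 1 - int ?u = i" "rim - int ?u = i + 1"
    using window_less_rim[OF ij(2)] by simp_all
  have v: "k \<le> j" "j < n - k" "k \<le> Suc j" "Suc j < n - k" "(i, j) \<in> W" "(i, j) \<notin> crossings \<Lambda>"
    using ij(1) by (auto simp: wcontacts_def vertices_in_def)
  have w: "c j \<le> i" "i < c' j" "c (Suc j) \<le> i" "i < c' (Suc j)"
    using ij(2) c_W[OF v(5)] c'_W[OF v(5)] by (auto simp: window_def)
  define \<alpha> \<beta> where "\<alpha> = wire ?u j" and "\<beta> = wire ?u (Suc j)"
  have "pos ?u j = i + 1" "pos ?u (Suc j) = i + 1"
    using pos_in_window(1)[of j ?u] pos_in_window(1)[of "Suc j" ?u] w u by simp_all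
  then have L: "\<alpha> \<in> \<Lambda>" "\<beta> \<in> \<Lambda>" "\<alpha> i = j" "\<beta> i = Suc j"
    using wire[OF v(1,2), of ?u] wire[OF v(3,4), of ?u] by (auto simp: \<alpha>_def \<beta>_def)
  have "state (steps \<Lambda>) ?u j \<noteq> state (steps \<Lambda>) ?u (Suc j)"
    using state_inj[of "steps \<Lambda>" ?u j "Suc j"] sparse_steps by auto
  then have "\<not> (\<exists>m\<ge>i + 1. crossed \<alpha> \<beta> m)"
    using state_order[OF v(1-4), of ?u] ns u unfolding \<alpha>_def \<beta>_def by auto
  moreover have nc: "\<not> crosses_at \<alpha> \<beta> i"
    using crossings_iff_crosses_at[OF L] v by blast
  moreover obtain p where p: "crossed \<alpha> \<beta> p"
    using crossed_ex[OF L(1,2)] L(3,4) by fastforce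
  ultimately have pi: "p < i"
    by (metis crossed_def linorder_less_linear zless_imp_add1_zle)
  have cp: "crosses_at \<alpha> \<beta> p" "(p, min (\<alpha> p) (\<beta> p)) \<in> window"
    using p by (auto simp: crossed_def)
  note adj = crosses_at_steps(3)[OF L(1,2) cp(1)]
  have pX: "(p, min (\<alpha> p) (\<beta> p)) \<in> crossings \<Lambda>"
    using crossings_iff_crosses_at[OF L(1,2), of p "\<alpha> p"] crossings_iff_crosses_at[OF L(2,1), of p "\<beta> p"]
      crosses_at_sym[OF L(1,2), of p] cp(1) adj L(3,4) by (auto simp: min_def)
  have ipr: "i < p + r"
    using window_same_period[OF L(1), of p i] crossed_bounds[OF L(1,2) cp(2) adj] w L by simp
  have ai: "\<alpha> i = Suc (\<beta> i) \<or> \<beta> i = Suc (\<alpha> i)" "(i, min (\<alpha> i) (\<beta> i)) \<in> W"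
    using L(3,4) v(5) by (simp_all add: min_def)
  obtain \<Lambda>' \<alpha>' \<beta>' where s: "wiring k \<Lambda>'" "\<alpha>' \<in> \<Lambda>'" "\<beta>' \<in> \<Lambda>'" "crosses_at \<alpha>' \<beta>' i" "\<not> crosses_at \<alpha>' \<beta>' p"
    "\<And>i. {\<alpha>' i, \<beta>' i} = {\<alpha> i, \<beta> i}"
    "crossings \<Lambda>' = crossings \<Lambda> - {(i, min (\<alpha> i) (\<beta> i)) |i. r dvd i - p} \<union>
       {(m, min (\<alpha> m) (\<beta> m)) |m. r dvd m - i}"
    by (rule swap_wires[OF L(1,2) cp(1) nc ai pi ipr]) (rule that; assumption)
  have m: "min (\<alpha>' m) (\<beta>' m) = min (\<alpha> m) (\<beta> m)" for m
    using s(6)[of m] by (auto simp: doubleton_eq_iff min.commute)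
  show thesis
  proof (rule that[of \<Lambda>' \<alpha>' \<beta>' p])
    show "\<alpha>' p = Suc (\<beta>' p) \<or> \<beta>' p = Suc (\<alpha>' p)"
      using s(6)[of p] adj by (auto simp: doubleton_eq_iff)
  qed (use s m L cp pi pX in \<open>simp_all add: min_def\<close>)
qed

end

section \<open>The topology of the Moebius strip\<close>

lemma tau_funpow: "(tau ^^ m) (x, y) = (x + real m * pi, (- 1) ^ m * y)"
  by (induction m) (simp_all add: tau_def algebra_simps)

lemma mproj_eq_iff:
  "mproj (x, y) = mproj (x', y') \<longleftrightarrow>
    (\<exists>q::int. x' = x + of_int q * pi \<and> y' = (if even q then y else - y))"
proof -
  have "tau_rel (x, y) (x', y') \<longleftrightarrow> (\<exists>q::int. x' = x + of_int q * pi \<and> y' = (if even q then y else - y))"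
  proof
    assume "tau_rel (x, y) (x', y')"
    then obtain m l where "x + real m * pi = x' + real l * pi" "(- 1) ^ m * y = (- 1) ^ l * y'"
      by (auto simp: tau_rel_def tau_funpow)
    then show "\<exists>q::int. x' = x + of_int q * pi \<and> y' = (if even q then y else - y)"
      by (intro exI[of _ "int m - int l"]) (auto simp: algebra_simps minus_one_power_iff split: if_splits)
  next
    assume "\<exists>q::int. x' = x + of_int q * pi \<and> y' = (if even q then y else - y)"
    then obtain q :: int where q: "x' = x + of_int q * pi" "y' = (if even q then y else - y)"
      by blast
    show "tau_rel (x, y) (x', y')"
    proof (cases "0 \<le> q")
      case True
      then have "(tau ^^ nat q) (x, y) = (tau ^^ 0) (x', y')"
        using q by (simp add: tau_funpow minus_one_power_iff even_nat_iff)
      then show ?thesis unfolding tau_rel_def by blast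
    next
      case False
      then have "(tau ^^ 0) (x, y) = (tau ^^ nat (- q)) (x', y')"
        using q by (simp add: tau_funpow minus_one_power_iff even_nat_iff)
      then show ?thesis unfolding tau_rel_def by blast
    qed
  qed
  then show ?thesis
    by (simp add: mobius.abs_eq_iff)
qed

lemma mproj_shift: "mproj (x + pi, - y) = mproj (x, y)" "mproj (x - pi, - y) = mproj (x, y)"
  unfolding mproj_eq_iff by (rule exI[of _ "-1"], simp) (rule exI[of _ 1], simp)

lemma mproj_cases: obtains x y where "v = mproj (x, y)"
proof -
  have "\<exists>x y. v = mproj (x, y)"
  proof (induction v rule: mobius.abs_induct)
    case (1 p)
    show ?case by (cases p) blast
  qed
  with that show thesis by blast
qed

lemma mproj_fundamental: obtains x y where "v = mproj (x, y)" "0 \<le> x" "x < pi"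
proof -
  obtain x y where v: "v = mproj (x, y)"
    by (rule mproj_cases)
  define q where "q = \<lfloor>x / pi\<rfloor>"
  have "of_int q * pi \<le> x" "x < (of_int q + 1) * pi"
    unfolding q_def by (simp_all flip: pos_le_divide_eq pos_divide_less_eq)
  moreover have "v = mproj (x - of_int q * pi, if even q then y else - y)"
    unfolding v mproj_eq_iff by (intro exI[of _ "- q"]) simp
  ultimately show thesis
    using that[of "x - of_int q * pi"] by (simp add: algebra_simps)
qed

lemma antiperiodic_int:
  assumes "antiperiodic f"
  shows "f (x + of_int q * pi) = (if even q then f x else - f x)"
proof (induction q rule: int_induct[where k = 0])
  have sh: "f (x + pi) = - f x" for x
    using assms by (simp add: antiperiodic_def)
  {
    case (step1 q)
    then show ?case using sh[of "x + of_int q * pi"] by (simp add: algebra_simps)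
  next
    case (step2 q)
    then show ?case using sh[of "x + of_int (q - 1) * pi"] by (auto simp: algebra_simps)
  }
qed simp

text \<open>Antiperiodicity makes the full preimage of a pseudoline in the plane a single
  graph.\<close>

lemma mproj_in_curve:
  assumes "antiperiodic f"
  shows "mproj (x, y) \<in> curve f \<longleftrightarrow> y = f x"
proof
  assume "mproj (x, y) \<in> curve f"
  then obtain z where "mproj (z, f z) = mproj (x, y)"
    by (auto simp: curve_def)
  then show "y = f x"
    unfolding mproj_eq_iff using antiperiodic_int[OF assms] by auto
qed (auto simp: curve_def)

lemma curve_inj:
  assumes "antiperiodic f" "antiperiodic g" "curve f = curve g"
  shows "f = g"
proof
  show "f x = g x" for x
    using mproj_in_curve[OF assms(1), of x "f x"] mproj_in_curve[OF assms(2), of x "f x"] assms(3) by simp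
qed

text \<open>These are the full preimages of sets of the strip. Topology in the strip is handled
  through them, in the plane.\<close>

definition tau_closed :: "(real \<times> real) set \<Rightarrow> bool" where
  "tau_closed P \<longleftrightarrow> (\<forall>x y. (x, y) \<in> P \<longrightarrow> (x + pi, - y) \<in> P \<and> (x - pi, - y) \<in> P)"

lemma tau_closed_int:
  assumes "tau_closed P" "(x, y) \<in> P"
  shows "(x + of_int q * pi, if even q then y else - y) \<in> P"
proof (induction q rule: int_induct[where k = 0])
  case (step1 q)
  then have "(x + of_int q * pi + pi, - (if even q then y else - y)) \<in> P"
    using assms(1) by (auto simp: tau_closed_def)
  then show ?case by (auto simp: algebra_simps split: if_splits)
next
  case (step2 q)
  then have "(x + of_int q * pi - pi, - (if even q then y else - y)) \<in> P"
    using assms(1) by (auto simp: tau_closed_def)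
  then show ?case by (auto simp: algebra_simps split: if_splits)
qed (use assms in simp)

lemma mproj_image_iff:
  assumes "tau_closed P"
  shows "mproj (x, y) \<in> mproj ` P \<longleftrightarrow> (x, y) \<in> P"
proof
  assume "mproj (x, y) \<in> mproj ` P"
  then obtain x' y' where p: "(x', y') \<in> P" "mproj (x', y') = mproj (x, y)"
    by force
  then show "(x, y) \<in> P"
    unfolding mproj_eq_iff using tau_closed_int[OF assms p(1)] by auto
qed auto

lemma vimage_image_mproj: "tau_closed P \<Longrightarrow> mproj -` mproj ` P = P"
  using mproj_image_iff by auto

lemma tau_closed_vimage: "tau_closed (mproj -` S)"
  by (simp add: tau_closed_def mproj_shift)

lemma vimage_mproj_cancel: "mproj -` S = mproj -` S' \<Longrightarrow> S = S'"
proof (rule set_eqI)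
  fix v assume eq: "mproj -` S = mproj -` S'"
  obtain x y where "v = mproj (x, y)" by (rule mproj_cases)
  then show "v \<in> S \<longleftrightarrow> v \<in> S'" using eq by blast
qed

lemma continuous_mproj: "continuous_on A mproj"
proof -
  have "continuous_on UNIV mproj"
    by (simp add: continuous_on_open_vimage open_mobius_def)
  then show ?thesis by (rule continuous_on_subset) simp
qed

lemma closed_mobius: "closed C \<longleftrightarrow> closed (mproj -` C)"
  by (simp add: closed_def open_mobius_def vimage_Compl)

lemma tau_closed_closure: "tau_closed P \<Longrightarrow> tau_closed (closure P)"
proof -
  assume P: "tau_closed P"
  have "closure P \<subseteq> (\<lambda>p. (fst p + a, - snd p)) -` closure P" if "a = pi \<or> a = - pi" for a
  proof (rule closure_minimal)
    show "P \<subseteq> (\<lambda>p. (fst p + a, - snd p)) -` closure P"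
      using P that by (auto simp: tau_closed_def intro!: subsetD[OF closure_subset])
    show "closed ((\<lambda>p. (fst p + a, - snd p)) -` closure P)"
      by (intro closed_vimage closed_closure continuous_intros)
  qed
  from this[of pi] this[of "- pi"] show ?thesis
    by (force simp: tau_closed_def)
qed

text \<open>The closure of an invariant set is invariant, so its image is closed in the quotient
  topology and contains the closure taken in the strip.\<close>

lemma vimage_closure: "mproj -` closure S = closure (mproj -` S)"
proof
  have c: "closed (mproj ` closure (mproj -` S))"
    unfolding closed_mobius vimage_image_mproj[OF tau_closed_closure[OF tau_closed_vimage]] by simp
  have "S \<subseteq> mproj ` closure (mproj -` S)"
  proof
    fix v assume "v \<in> S"
    moreover obtain x y where "v = mproj (x, y)" by (rule mproj_cases)
    ultimately show "v \<in> mproj ` closure (mproj -` S)"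
      using closure_subset[of "mproj -` S"] by blast
  qed
  then have "closure S \<subseteq> mproj ` closure (mproj -` S)"
    using c by (rule closure_minimal)
  then have "mproj -` closure S \<subseteq> mproj -` mproj ` closure (mproj -` S)"
    by blast
  then show "mproj -` closure S \<subseteq> closure (mproj -` S)"
    unfolding vimage_image_mproj[OF tau_closed_closure[OF tau_closed_vimage]] .
  show "closure (mproj -` S) \<subseteq> mproj -` closure S"
    using closure_subset[of S] by (intro closure_minimal) (auto simp flip: closed_mobius)
qed

text \<open>The region above the graph of \<open>u\<close> and its image under \<open>tau\<close>,
  the region below \<open>d\<close>, project to one set \<open>U\<close>. It is connected as an
  image of a half plane, open, and closed within the complement of \<open>S\<close>, hence a
  component. It lies in no compact set, whereas every other component lies between \<open>d\<close>
  and \<open>u\<close> and so does. The graphs of \<open>u\<close> and \<open>d\<close> project to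
  the same curve, the boundary of \<open>U\<close>.\<close>

lemma first_level_top:
  assumes cont: "continuous_on UNIV u"
    and top: "\<And>x. mproj (x, u x) \<in> S"
    and le: "\<And>x y. mproj (x, y) \<in> S \<Longrightarrow> y \<le> u x"
  shows "first_level S = range (\<lambda>x. mproj (x, u x))"
proof -
  define d where "d x = - u (x + pi)" for x
  \<comment> \<open>Two translations cancel the reflection, and \<open>u\<close> is the greatest
    height in the preimage of \<open>S\<close>, so it has period \<open>2 * pi\<close>.\<close>
  have u2: "u (x + pi + pi) = u x" for x
  proof -
    have "mproj (x + pi + pi, y) = mproj (x, y)" for y
      using mproj_shift(1)[of "x + pi" "- y"] mproj_shift(1)[of x y] by simp
    then show ?thesis
      using top[of x] top[of "x + pi + pi"] le[of x "u (x + pi + pi)"] le[of "x + pi + pi" "u x"] by force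
  qed
  have um: "u (x - pi) = u (x + pi)" for x
    using u2[of "x - pi"] by (simp add: algebra_simps)
  have ge: "d x \<le> y" if "mproj (x, y) \<in> S" for x y
    using le[of "x + pi" "- y"] that mproj_shift(1)[of x y] by (simp add: d_def)
  have contd: "continuous_on UNIV d"
    unfolding d_def by (intro continuous_intros continuous_on_compose2[OF cont]) auto
  have mpd: "mproj (x, d x) = mproj (x + pi, u (x + pi))" for x
    using mproj_shift(1)[of x "d x"] by (simp add: d_def)
  have uf: "continuous_on A (\<lambda>p. u (fst p))" "continuous_on A (\<lambda>p. d (fst p))" for A :: "(real \<times> real) set"
    by (rule continuous_on_compose2[OF cont], auto intro!: continuous_intros)
      (rule continuous_on_compose2[OF contd], auto intro!: continuous_intros)
  define P where "P = {p. u (fst p) < snd p \<or> snd p < d (fst p)}"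
  have tP: "tau_closed P"
    using u2 um unfolding tau_closed_def P_def d_def by auto
  define U where "U = mproj ` P"
  have lU: "mproj -` U = P"
    unfolding U_def by (rule vimage_image_mproj[OF tP])
  have opP: "open P"
    unfolding P_def by (intro open_Collect_disj open_Collect_less uf continuous_intros)
  then have opU: "open U"
    by (simp add: open_mobius_def lU)
  have memU: "mproj (x, y) \<in> U \<longleftrightarrow> u x < y \<or> y < d x" for x y
    unfolding U_def mproj_image_iff[OF tP] by (simp add: P_def)
  have US: "U \<inter> S = {}"
  proof -
    have "v \<notin> S" if "v \<in> U" for v
    proof -
      obtain x y where v: "v = mproj (x, y)" by (rule mproj_cases)
      show ?thesis using that le[of x y] ge[of x y] unfolding v memU by auto
    qed
    then show ?thesis by blast
  qed
  have Uim: "U = (\<lambda>p. mproj (fst p, u (fst p) + snd p)) ` (UNIV \<times> {0<..})"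
  proof (intro set_eqI iffI)
    fix v assume vU: "v \<in> U"
    obtain x y where v: "v = mproj (x, y)" by (rule mproj_cases)
    have "\<exists>x y. v = mproj (x, y) \<and> u x < y"
    proof (cases "u x < y")
      case False
      then have "u (x + pi) < - y"
        using vU unfolding v memU by (auto simp: d_def)
      then show ?thesis
        using mproj_shift(1)[of x y] v by metis
    qed (use v in blast)
    then obtain x y where "v = mproj (x, y)" "u x < y" by blast
    then show "v \<in> (\<lambda>p. mproj (fst p, u (fst p) + snd p)) ` (UNIV \<times> {0<..})"
      by (intro image_eqI[of _ _ "(x, y - u x)"]) auto
  qed (auto simp: memU)
  have connU: "connected U"
    unfolding Uim
  proof (rule connected_continuous_image)
    show "continuous_on (UNIV \<times> {0<..}) (\<lambda>p. mproj (fst p, u (fst p) + snd p))"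
      by (rule continuous_on_compose2[OF continuous_mproj[of UNIV]]) (auto intro!: continuous_intros uf)
    show "connected ((UNIV :: real set) \<times> {0::real<..})"
      by (intro connected_Times) auto
  qed
  have clU: "mproj -` closure U = {p. u (fst p) \<le> snd p \<or> snd p \<le> d (fst p)}"
  proof
    show "mproj -` closure U \<subseteq> {p. u (fst p) \<le> snd p \<or> snd p \<le> d (fst p)}"
      unfolding vimage_closure lU
      by (rule closure_minimal) (auto simp: P_def intro!: closed_Collect_disj closed_Collect_le uf continuous_intros)
    have *: "(x, y) \<in> closure P" if "u x \<le> y" for x y
    proof -
      have "(\<lambda>h. (x, u x + h)) ` closure {0<..} \<subseteq> closure ((\<lambda>h. (x, u x + h)) ` {0<..})"
        by (intro image_closure_subset closed_closure closure_subset) (auto intro!: continuous_intros)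
      also have "\<dots> \<subseteq> closure P"
        by (intro closure_mono) (auto simp: P_def)
      finally have "(\<lambda>h. (x, u x + h)) ` {0..} \<subseteq> closure P"
        by simp
      then show ?thesis
        using that by (force simp: image_subset_iff dest: bspec[of _ _ "y - u x"])
    qed
    show "{p. u (fst p) \<le> snd p \<or> snd p \<le> d (fst p)} \<subseteq> mproj -` closure U"
    proof
      fix p assume p: "p \<in> {p. u (fst p) \<le> snd p \<or> snd p \<le> d (fst p)}"
      obtain x y where xy: "p = (x, y)" by (cases p)
      then consider "u x \<le> y" | "u (x + pi) \<le> - y"
        using p by (auto simp: d_def)
      then show "p \<in> mproj -` closure U"
      proof cases
        case 1
        then show ?thesis using * xy by (simp add: vimage_closure lU)
      next
        case 2
        then have "(x + pi, - y) \<in> mproj -` closure U"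
          using * by (simp add: vimage_closure lU)
        then show ?thesis by (simp add: xy mproj_shift)
      qed
    qed
  qed
  have clUS: "closure U \<subseteq> U \<union> S"
  proof
    fix v assume vU: "v \<in> closure U"
    obtain x y where v: "v = mproj (x, y)" by (rule mproj_cases)
    have "(x, y) \<in> mproj -` closure U" using vU v by simp
    then have "u x < y \<or> y < d x \<or> y = u x \<or> y = d x"
      unfolding clU by auto
    then show "v \<in> U \<union> S"
      using top[of x] top[of "x + pi"] mpd[of x] by (auto simp: v memU)
  qed
  have Ucomp: "U \<in> components (- S)"
    unfolding in_components_maximal
  proof (intro conjI allI impI)
    show "U \<noteq> {}"
      by (auto simp: Uim)
    show "U \<subseteq> - S"
      using US by blast
    fix D assume D: "D \<noteq> {} \<and> U \<subseteq> D \<and> D \<subseteq> - S \<and> connected D"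
    have "U \<inter> D = {} \<or> (- closure U) \<inter> D = {}"
    proof (rule connectedD)
      show "D \<subseteq> U \<union> - closure U" "U \<inter> - closure U \<inter> D = {}"
        using D clUS closure_subset[of U] by blast+
    qed (use D opU in auto)
    then show "D = U"
      using D clUS \<open>U \<noteq> {}\<close> by blast
  qed (rule connU)
  have unb: "\<not> (\<exists>K. compact K \<and> U \<subseteq> K)"
  proof
    assume "\<exists>K. compact K \<and> U \<subseteq> K"
    then obtain K where K: "compact K" "U \<subseteq> K" by blast
    \<comment> \<open>The bands of height less than \<open>m\<close> are open and exhaust the strip,
      so heights are bounded on a compact set.\<close>
    define O' where "O' m = mproj ` {p. \<bar>snd p\<bar> < real m}" for m :: nat
    have tO: "tau_closed {p. \<bar>snd p\<bar> < real m}" for m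
      by (auto simp: tau_closed_def)
    have "open (O' m)" for m
      unfolding open_mobius_def O'_def vimage_image_mproj[OF tO]
      by (intro open_Collect_less continuous_intros)
    moreover have "K \<subseteq> (\<Union>m\<in>UNIV. O' m)"
    proof
      fix v
      obtain x y where v: "v = mproj (x, y)" by (rule mproj_cases)
      obtain m where "\<bar>y\<bar> < real m" using reals_Archimedean2 by blast
      then show "v \<in> (\<Union>m\<in>UNIV. O' m)" by (auto simp: O'_def v mproj_image_iff[OF tO])
    qed
    ultimately obtain C where C: "finite C" "K \<subseteq> (\<Union>m\<in>C. O' m)"
      using compactE_image[OF K(1), of UNIV O'] by auto
    define y where "y = \<bar>u 0\<bar> + 1 + real (Max (insert 0 C))"
    have "0 \<le> real (Max (insert 0 C))"
      by (rule of_nat_0_le_iff)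
    then have "u 0 < y"
      unfolding y_def by linarith
    then have "mproj (0, y) \<in> U"
      by (simp add: memU)
    then obtain m where m: "m \<in> C" "mproj (0, y) \<in> O' m"
      using K C by blast
    then have "\<bar>y\<bar> < real m"
      unfolding O'_def mproj_image_iff[OF tO] by simp
    moreover have "m \<le> Max (insert 0 C)"
      using C m by auto
    then have "real m \<le> real (Max (insert 0 C))"
      by (rule of_nat_mono)
    ultimately show False
      by (simp add: y_def)
  qed
  have other: "\<exists>K. compact K \<and> C \<subseteq> K" if C: "C \<in> components (- S)" "C \<noteq> U" for C
  proof -
    have "bounded (u ` {0..pi + pi})"
      by (intro compact_imp_bounded compact_continuous_image continuous_on_subset[OF cont]) auto
    then obtain B where B0: "\<forall>x\<in>{0..pi + pi}. \<bar>u x\<bar> \<le> B"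
      unfolding bounded_iff by auto
    then have B: "\<bar>u x\<bar> \<le> B" if "0 \<le> x" "x \<le> pi + pi" for x
      using that by auto
    have "compact (mproj ` ({0..pi} \<times> {-B..B}))"
      by (intro compact_continuous_image continuous_mproj compact_Times compact_Icc)
    moreover have "C \<subseteq> mproj ` ({0..pi} \<times> {-B..B})"
    proof
      fix v assume vC: "v \<in> C"
      obtain x y where v: "v = mproj (x, y)" "0 \<le> x" "x < pi" by (rule mproj_fundamental)
      have "C \<inter> U = {}"
        using components_nonoverlap[OF C(1) Ucomp] C(2) by blast
      then have "d x \<le> y" "y \<le> u x"
        using vC by (auto simp: v(1) memU disjoint_iff not_less)
      then show "v \<in> mproj ` ({0..pi} \<times> {-B..B})"
        using B[of x] B[of "x + pi"] v by (intro image_eqI[of _ _ "(x, y)"]) (auto simp: d_def)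
    qed
    ultimately show ?thesis by blast
  qed
  have "C \<in> components (- S) \<and> \<not> (\<exists>K. compact K \<and> C \<subseteq> K) \<longleftrightarrow> C = U" for C
  proof
    assume C: "C \<in> components (- S) \<and> \<not> (\<exists>K. compact K \<and> C \<subseteq> K)"
    show "C = U"
      using C other[of C] by fast
  next
    assume "C = U"
    then show "C \<in> components (- S) \<and> \<not> (\<exists>K. compact K \<and> C \<subseteq> K)"
      using Ucomp unb by simp
  qed
  then have "external_face S = U"
    unfolding external_face_def by simp
  then have fl: "first_level S = closure U - U"
    by (simp add: first_level_def frontier_def interior_open opU)
  show ?thesis
  proof (intro set_eqI iffI)
    fix v assume v1: "v \<in> first_level S"
    obtain x y where v: "v = mproj (x, y)" by (rule mproj_cases)
    have "(x, y) \<in> mproj -` closure U" "\<not> (u x < y \<or> y < d x)"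
      using v1 unfolding fl v by (simp_all add: memU)
    then have "y = u x \<or> y = d x"
      unfolding clU by auto
    then show "v \<in> range (\<lambda>x. mproj (x, u x))"
      using mpd[of x] by (auto simp: v)
  next
    fix v assume "v \<in> range (\<lambda>x. mproj (x, u x))"
    then obtain x where v: "v = mproj (x, u x)" by blast
    have "(x, u x) \<in> mproj -` closure U"
      unfolding clU by simp
    then show "v \<in> first_level S"
      using top[of x] US unfolding fl v by auto
  qed
qed

section \<open>Levels and wirings as arrangements\<close>

text \<open>The functions in the definition are quantified existentially, but by
  \<open>curve_inj\<close> a curve determines its function.\<close>

lemma crossing_point_curve_iff:
  assumes "antiperiodic f" "antiperiodic g"
  shows "crossing_point (curve f) (curve g) p \<longleftrightarrow> (\<exists>x. p = mproj (x, f x) \<and> f x = g x \<and>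
    (\<forall>\<^sub>F h in at_right 0. (f (x - h) - g (x - h)) * (f (x + h) - g (x + h)) < 0))"
proof
  assume "crossing_point (curve f) (curve g) p"
  then obtain f' g' x where fg: "antiperiodic f'" "antiperiodic g'" "curve f = curve f'" "curve g = curve g'"
    and x: "p = mproj (x, f' x)" "f' x = g' x"
      "\<forall>\<^sub>F h in at_right 0. (f' (x - h) - g' (x - h)) * (f' (x + h) - g' (x + h)) < 0"
    unfolding crossing_point_def by blast
  have "f' = f" "g' = g"
    using curve_inj[OF assms(1) fg(1,3)] curve_inj[OF assms(2) fg(2,4)] by simp_all
  with x show "\<exists>x. p = mproj (x, f x) \<and> f x = g x \<and>
    (\<forall>\<^sub>F h in at_right 0. (f (x - h) - g (x - h)) * (f (x + h) - g (x + h)) < 0)"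
    by blast
next
  assume "\<exists>x. p = mproj (x, f x) \<and> f x = g x \<and>
    (\<forall>\<^sub>F h in at_right 0. (f (x - h) - g (x - h)) * (f (x + h) - g (x + h)) < 0)"
  then show "crossing_point (curve f) (curve g) p"
    unfolding crossing_point_def using assms by blast
qed

lemma contact_point_curve_iff:
  assumes "antiperiodic f" "antiperiodic g"
  shows "contact_point (curve f) (curve g) p \<longleftrightarrow> (\<exists>x. p = mproj (x, f x) \<and> f x = g x \<and>
    (\<forall>\<^sub>F h in at_right 0. (f (x - h) - g (x - h)) * (f (x + h) - g (x + h)) > 0))"
proof
  assume "contact_point (curve f) (curve g) p"
  then obtain f' g' x where fg: "antiperiodic f'" "antiperiodic g'" "curve f = curve f'" "curve g = curve g'"
    and x: "p = mproj (x, f' x)" "f' x = g' x"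
      "\<forall>\<^sub>F h in at_right 0. (f' (x - h) - g' (x - h)) * (f' (x + h) - g' (x + h)) > 0"
    unfolding contact_point_def by blast
  have "f' = f" "g' = g"
    using curve_inj[OF assms(1) fg(1,3)] curve_inj[OF assms(2) fg(2,4)] by simp_all
  with x show "\<exists>x. p = mproj (x, f x) \<and> f x = g x \<and>
    (\<forall>\<^sub>F h in at_right 0. (f (x - h) - g (x - h)) * (f (x + h) - g (x + h)) > 0)"
    by blast
next
  assume "\<exists>x. p = mproj (x, f x) \<and> f x = g x \<and>
    (\<forall>\<^sub>F h in at_right 0. (f (x - h) - g (x - h)) * (f (x + h) - g (x + h)) > 0)"
  then show "contact_point (curve f) (curve g) p"
    unfolding contact_point_def using assms by blast
qed

text \<open>The levels \<open>s j\<close> of an arrangement: the heights of its \<open>n\<close> curves over each abscissa in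
  increasing order.  All vertices lie over the abscissae \<open>t i\<close>.\<close>

locale levels =
  fixes n :: nat and s :: "nat \<Rightarrow> real \<Rightarrow> real" and t :: "int \<Rightarrow> real" and r :: int
  assumes r_pos: "0 < r"
    and t_mono: "strict_mono t"
    and t_shift: "t (i + r) = t i + pi"
    and s_cont: "j < n \<Longrightarrow> continuous_on UNIV (s j)"
    and s_le: "Suc j < n \<Longrightarrow> s j x \<le> s (Suc j) x"
    and s_strict: "Suc j < n \<Longrightarrow> x \<notin> range t \<Longrightarrow> s j x < s (Suc j) x"
    and s_simple: "Suc (Suc j) < n \<Longrightarrow> s j x < s (Suc (Suc j)) x"
    and s_shift: "j < n \<Longrightarrow> s (n - 1 - j) (x + pi) = - s j x"
begin

definition W :: "(int \<times> nat) set" where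
  "W = {(i, j). Suc j < n \<and> s j (t i) = s (Suc j) (t i)}"

sublocale network n r W
proof
  show "0 < r" by (rule r_pos)
  show "(i, j) \<in> W \<Longrightarrow> Suc j < n" for i j
    by (simp add: W_def)
  show "(i, j) \<in> W \<Longrightarrow> (i, Suc j) \<notin> W" for i j
    using s_simple[of j "t i"] by (auto simp: W_def)
  fix i j assume j: "Suc j < n"
  have e: "n - 1 - Suc j = n - 2 - j" "Suc (n - 2 - j) = n - 1 - j"
    using j by auto
  have "s (n - 2 - j) (t i + pi) = - s (Suc j) (t i)" "s (n - 1 - j) (t i + pi) = - s j (t i)"
    using s_shift[of "Suc j" "t i"] s_shift[of j "t i"] j unfolding e by simp_all
  then show "(i + r, n - 2 - j) \<in> W \<longleftrightarrow> (i, j) \<in> W"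
    using j unfolding W_def mem_Collect_eq prod.case e(2) t_shift by auto
qed

lemma s_mono: "i \<le> j \<Longrightarrow> j < n \<Longrightarrow> s i x \<le> s j x"
  by (induction j rule: dec_induct) (auto intro: order_trans s_le)

lemma s_less: "i < j \<Longrightarrow> j < n \<Longrightarrow> x \<notin> range t \<Longrightarrow> s i x < s j x"
  using s_strict[of i x] s_mono[of "Suc i" j x] by fastforce

lemma s_less_two: "Suc (Suc i) \<le> j \<Longrightarrow> j < n \<Longrightarrow> s i x < s j x"
  using s_simple[of i x] s_mono[of "Suc (Suc i)" j x] by fastforce

lemma s_eq_imp:
  assumes "i < j" "j < n" "s i x = s j x"
  obtains m where "x = t m" "j = Suc i" "(m, i) \<in> W"
proof -
  have "x \<in> range t"
    using s_less[OF assms(1,2), of x] assms(3) by auto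
  then obtain m where m: "x = t m" by blast
  have j: "j = Suc i"
    using s_less_two[of i j x] assms by fastforce
  with assms m have "(m, i) \<in> W"
    by (simp add: W_def)
  with m j show thesis by (rule that)
qed

lemma t_int: "t (i + q * r) = t i + of_int q * pi"
proof (induction q rule: int_induct[where k = 0])
  case (step1 q)
  then show ?case using t_shift[of "i + q * r"] by (simp add: algebra_simps)
next
  case (step2 q)
  then show ?case using t_shift[of "i + (q - 1) * r"] by (simp add: algebra_simps)
qed simp

lemma idx_ex: "\<exists>i. t i \<le> x \<and> x < t (i + 1)"
proof -
  obtain a :: int where a: "(x - t 0) / pi < of_int a"
    using ex_less_of_int by blast
  obtain b :: int where b: "of_int b < (x - t 0) / pi"
    using ex_of_int_less by blast
  have "x < t (a * r)"
    using a t_int[of 0 a] by (simp add: pos_divide_less_eq)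
  moreover have "\<not> x < t q" if "q < b * r" for q
    using that b t_int[of 0 b] strict_monoD[OF t_mono that] by (simp add: pos_less_divide_eq)
  ultimately obtain q where "x < t q" "\<not> x < t (q - 1)"
    using int_first[of "\<lambda>q. x < t q"] by metis
  then show ?thesis
    by (intro exI[of _ "q - 1"]) simp
qed

lemma t_less_iff: "t i < t j \<longleftrightarrow> i < j" and t_le_iff: "t i \<le> t j \<longleftrightarrow> i \<le> j" and t_eq_iff: "t i = t j \<longleftrightarrow> i = j"
  using t_mono by (simp_all add: strict_mono_less strict_mono_less_eq strict_mono_eq)

definition idx :: "real \<Rightarrow> int" where "idx x = (SOME i. t i \<le> x \<and> x < t (i + 1))"

lemma idx: "t (idx x) \<le> x" "x < t (idx x + 1)"
  using someI_ex[OF idx_ex[of x]] by (auto simp: idx_def)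

lemma idx_eqI: "t i \<le> x \<Longrightarrow> x < t (i + 1) \<Longrightarrow> idx x = i"
  using idx[of x] t_less_iff[of i "idx x + 1"] t_less_iff[of "idx x" "i + 1"] by linarith

lemma idx_t [simp]: "idx (t i) = i"
  by (rule idx_eqI) (auto simp: t_less_iff)

lemma idx_shift: "idx (x + pi) = idx x + r"
  using idx[of x] t_shift[of "idx x"] t_shift[of "idx x + 1"]
  by (intro idx_eqI) (simp_all add: algebra_simps)

lemma open_gap_not_t: "t i < x \<Longrightarrow> x < t (i + 1) \<Longrightarrow> x \<notin> range t"
  using t_less_iff by force

lemma gap_point: obtains x where "t i < x" "x < t (i + 1)" "x \<notin> range t"
  using dense[of "t i" "t (i + 1)"] t_less_iff[of i "i + 1"] open_gap_not_t by auto

definition vert :: "int \<times> nat \<Rightarrow> mobius" where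
  "vert = (\<lambda>(i, j). mproj (t i, s j (t i)))"

lemma vert_eq_imp: "vert (i, j) = vert (i', j') \<Longrightarrow> \<exists>q. i' = i + q * r"
  unfolding vert_def prod.case mproj_eq_iff using t_int t_eq_iff by metis

lemma s_int:
  assumes "j < n"
  shows "s (if even q then j else n - 1 - j) (x + of_int q * pi) = (if even q then s j x else - s j x)"
proof (induction q rule: int_induct[where k = 0])
  case (step1 q)
  let ?j = "if even q then j else n - 1 - j"
  have "s (n - 1 - ?j) (x + of_int q * pi + pi) = - s ?j (x + of_int q * pi)"
    using assms by (intro s_shift) auto
  moreover have "n - 1 - ?j = (if even (q + 1) then j else n - 1 - j)"
    using assms by auto
  ultimately show ?case
    using step1 by (auto simp: algebra_simps split: if_splits)
next
  case (step2 q)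
  let ?j = "if even (q - 1) then j else n - 1 - j"
  have e: "x + of_int q * pi = x + of_int (q - 1) * pi + pi"
    by (simp add: algebra_simps)
  have "s (n - 1 - ?j) (x + of_int q * pi) = - s ?j (x + of_int (q - 1) * pi)"
    unfolding e using assms by (intro s_shift) auto
  moreover have "n - 1 - ?j = (if even q then j else n - 1 - j)"
    using assms by auto
  ultimately show ?case
    using step2 by (auto split: if_splits)
qed simp

text \<open>A vertex is named by the lower of its two levels. The reflection turns the pair
  \<open>j\<close>, \<open>j + 1\<close> into \<open>n - 2 - j\<close>, \<open>n - 1 - j\<close>, so
  the new lower level is \<open>n - 2 - j\<close>.\<close>

lemma W_int:
  assumes "(i, j) \<in> W"
  shows "s (if even q then j else n - 2 - j) (t (i + q * r)) = (if even q then s j (t i) else - s j (t i))"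
    and "(i + q * r, if even q then j else n - 2 - j) \<in> W"
proof -
  have jn: "j < n" "Suc j < n" "s j (t i) = s (Suc j) (t i)"
    using assms by (auto simp: W_def)
  show *: "s (if even q then j else n - 2 - j) (t (i + q * r)) = (if even q then s j (t i) else - s j (t i))"
    using s_int[OF jn(1), of q "t i"] s_int[OF jn(2), of q "t i"] jn(3) by (auto simp: t_int)
  show "(i + q * r, if even q then j else n - 2 - j) \<in> W"
    using * s_int[OF jn(1), of q "t i"] s_int[OF jn(2), of q "t i"] jn
    by (auto simp: W_def t_int Suc_diff_Suc numeral_2_eq_2)
qed

text \<open>Over one abscissa different vertices have different heights, because no three levels
  meet; hence a vertex of the strip is named only by translates of one pair.\<close>

lemma vert_eq_iff:
  assumes "(i, j) \<in> W" "(i', j') \<in> W"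
  shows "vert (i, j) = vert (i', j') \<longleftrightarrow> (\<exists>q. i' = i + q * r \<and> j' = (if even q then j else n - 2 - j))"
proof -
  note * = W_int(1)[OF assms(1)] and W' = W_int(2)[OF assms(1)]
  show ?thesis
  proof
    assume "vert (i, j) = vert (i', j')"
    then obtain q where q: "t i' = t i + of_int q * pi" "s j' (t i') = (if even q then s j (t i) else - s j (t i))"
      by (auto simp: vert_def mproj_eq_iff)
    have i': "i' = i + q * r"
      using q(1) t_int t_eq_iff by metis
    define j'' where "j'' = (if even q then j else n - 2 - j)"
    have e: "s j'' (t i') = s j' (t i')" "(i', j'') \<in> W"
      using *[of q] q(2) W'[of q] unfolding i' j''_def by simp_all
    have False if "j' < j''"
      using s_less_two[of j' "Suc j''" "t i'"] that e by (auto simp: W_def)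
    moreover have False if "j'' < j'"
      using s_less_two[of j'' "Suc j'" "t i'"] that e assms(2) by (auto simp: W_def)
    ultimately have "j' = j''"
      using linorder_neqE_nat by blast
    with i' show "\<exists>q. i' = i + q * r \<and> j' = (if even q then j else n - 2 - j)"
      unfolding j''_def by blast
  next
    assume "\<exists>q. i' = i + q * r \<and> j' = (if even q then j else n - 2 - j)"
    then obtain q where q: "i' = i + q * r" "j' = (if even q then j else n - 2 - j)" by blast
    show "vert (i, j) = vert (i', j')"
      unfolding vert_def prod.case mproj_eq_iff q(1) q(2) using *[of q] by (intro exI[of _ q]) (simp add: t_int)
  qed
qed

text \<open>The levels \<open>k..<n - k\<close>, projected to the strip. They turn out to be the
  \<open>k\<close>-kernel of \<open>graphs 0\<close> (\<open>kernel_graphs\<close>).\<close>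

definition graphs :: "nat \<Rightarrow> mobius set" where
  "graphs k = mproj ` {(x, y). \<exists>j. k \<le> j \<and> j < n - k \<and> y = s j x}"

lemma mproj_in_graphs: "mproj (x, y) \<in> graphs k \<longleftrightarrow> (\<exists>j. k \<le> j \<and> j < n - k \<and> y = s j x)"
proof -
  have "tau_closed {(x, y). \<exists>j. k \<le> j \<and> j < n - k \<and> y = s j x}"
  proof -
    have "\<exists>j'. k \<le> j' \<and> j' < n - k \<and> - s j x = s j' (x + pi)" "\<exists>j'. k \<le> j' \<and> j' < n - k \<and> - s j x = s j' (x - pi)"
      if "k \<le> j" "j < n - k" for j x
    proof -
      have j: "j < n" "k \<le> n - 1 - j" "n - 1 - j < n - k" "n - 1 - j < n" "n - 1 - (n - 1 - j) = j"
        using that by auto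
      show "\<exists>j'. k \<le> j' \<and> j' < n - k \<and> - s j x = s j' (x + pi)"
        using s_shift[OF j(1), of x] j by (intro exI[of _ "n - 1 - j"]) simp
      have "s j x = - s (n - 1 - j) (x - pi)"
        using s_shift[OF j(4), of "x - pi"] unfolding j(5) by simp
      then show "\<exists>j'. k \<le> j' \<and> j' < n - k \<and> - s j x = s j' (x - pi)"
        using j by (intro exI[of _ "n - 1 - j"]) simp
    qed
    then show ?thesis by (auto simp: tau_closed_def)
  qed
  then show ?thesis
    by (simp add: graphs_def mproj_image_iff)
qed

definition track :: "(int \<Rightarrow> nat) \<Rightarrow> real \<Rightarrow> real" where
  "track \<alpha> x = s (\<alpha> (idx x)) x"

definition realize :: "(int \<Rightarrow> nat) set \<Rightarrow> mobius set set" where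
  "realize \<Lambda> = (\<lambda>\<alpha>. curve (track \<alpha>)) ` \<Lambda>"

end

locale levels_prewires = levels n s t r + prewires n r "levels.W n s t" k \<Lambda> for n s t r k \<Lambda>

locale levels_wires = levels n s t r + wires n r "levels.W n s t" k \<Lambda> for n s t r k \<Lambda>
begin

sublocale levels_prewires n s t r k \<Lambda> ..

end

section \<open>The curves traced by wires\<close>

context levels_prewires begin

lemma less_n: "\<alpha> \<in> \<Lambda> \<Longrightarrow> \<alpha> i < n"
  using range[of \<alpha> i] by (auto intro: less_le_trans)

text \<open>Wires change level only at vertices, where both levels have the same height. Hence the
  right end of the gap may be included, which is what makes tracks continuous.\<close>

lemma track_on:
  assumes "\<alpha> \<in> \<Lambda>" "t i \<le> x" "x \<le> t (i + 1)"
  shows "track \<alpha> x = s (\<alpha> i) x"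
proof (cases "x = t (i + 1)")
  case False
  then show ?thesis
    using assms idx_eqI[of i x] by (simp add: track_def)
next
  case True
  have "s (\<alpha> (i + 1)) (t (i + 1)) = s (\<alpha> i) (t (i + 1))"
    using step[OF assms(1), of "i + 1"] by (auto simp: W_def)
  then show ?thesis
    using True by (simp add: track_def)
qed

lemma track_cont:
  assumes "\<alpha> \<in> \<Lambda>"
  shows "continuous_on UNIV (track \<alpha>)"
proof (rule continuous_at_imp_continuous_on, intro ballI)
  fix x
  define i where "i = idx x"
  have piece: "continuous_on {t j..t (j + 1)} (track \<alpha>)" for j
    by (subst continuous_on_cong[OF refl, of _ _ "s (\<alpha> j)"])
      (use track_on[OF assms, of j] s_cont[OF less_n[OF assms]] in \<open>auto intro: continuous_on_subset\<close>)
  have u: "{t (i - 1)..t (i + 1)} = {t (i - 1)..t i} \<union> {t i..t (i + 1)}"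
    using t_le_iff[of "i - 1" i] t_le_iff[of i "i + 1"] by auto
  have "continuous_on {t (i - 1)..t (i + 1)} (track \<alpha>)"
    unfolding u using piece[of "i - 1"] piece[of i] by (intro continuous_on_closed_Un) auto
  moreover have "x \<in> interior {t (i - 1)..t (i + 1)}"
    using idx[of x] t_less_iff[of "i - 1" i] by (auto simp: i_def)
  ultimately show "isCont (track \<alpha>) x"
    using continuous_on_interior by blast
qed

lemma track_antiperiodic:
  assumes "\<alpha> \<in> \<Lambda>"
  shows "antiperiodic (track \<alpha>)"
  unfolding antiperiodic_def
proof (intro conjI allI)
  show "continuous_on UNIV (track \<alpha>)"
    by (rule track_cont[OF assms])
  show "track \<alpha> (x + pi) = - track \<alpha> x" for x
    using s_shift[OF less_n[OF assms], of "idx x" x] shift[OF assms, of "idx x"]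
    by (simp add: track_def idx_shift)
qed

lemma track_less_iff:
  assumes "\<alpha> \<in> \<Lambda>" "\<beta> \<in> \<Lambda>" "t i < x" "x < t (i + 1)"
  shows "track \<alpha> x < track \<beta> x \<longleftrightarrow> \<alpha> i < \<beta> i"
proof -
  have x: "x \<notin> range t"
    using assms(3,4) by (rule open_gap_not_t)
  have "track \<alpha> x = s (\<alpha> i) x" "track \<beta> x = s (\<beta> i) x"
    using track_on assms by auto
  then show ?thesis
    using s_less[OF _ less_n[OF assms(2)] x, of "\<alpha> i" i] s_less[OF _ less_n[OF assms(1)] x, of "\<beta> i" i]
    by (metis less_asym less_irrefl linorder_neqE_nat)
qed

lemma track_inj:
  assumes "\<alpha> \<in> \<Lambda>" "\<beta> \<in> \<Lambda>" "track \<alpha> = track \<beta>"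
  shows "\<alpha> = \<beta>"
proof
  fix i
  obtain x where "t i < x" "x < t (i + 1)"
    by (rule gap_point)
  then show "\<alpha> i = \<beta> i"
    using track_less_iff[OF assms(1,2), of i x] track_less_iff[OF assms(2,1), of i x] assms(3) by simp
qed

lemma curve_track_inj:
  assumes "\<alpha> \<in> \<Lambda>" "\<beta> \<in> \<Lambda>" "curve (track \<alpha>) = curve (track \<beta>)"
  shows "\<alpha> = \<beta>"
  using track_inj[OF assms(1,2)] curve_inj track_antiperiodic assms by blast

lemma near_t: "\<forall>\<^sub>F h in at_right 0. 0 < h \<and> t i + h < t (i + 1) \<and> t (i - 1) < t i - h"
  unfolding eventually_at_right_field
  by (rule exI[of _ "min (t (i + 1) - t i) (t i - t (i - 1))"]) (auto simp: t_less_iff)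

text \<open>On either side of \<open>t i\<close> the sign of the difference of two tracks is given
  by the order of the corresponding sections, so the product is negative exactly when this order
  changes.\<close>

lemma track_product:
  assumes "\<alpha> \<in> \<Lambda>" "\<beta> \<in> \<Lambda>" "\<alpha> \<noteq> \<beta>"
  defines "f \<equiv> \<lambda>h i. (track \<alpha> (t i - h) - track \<beta> (t i - h)) * (track \<alpha> (t i + h) - track \<beta> (t i + h))"
  shows "crosses_at \<alpha> \<beta> i \<Longrightarrow> \<forall>\<^sub>F h in at_right 0. f h i < 0"
    and "\<not> crosses_at \<alpha> \<beta> i \<Longrightarrow> \<forall>\<^sub>F h in at_right 0. f h i > 0"
proof -
  have ne: "\<alpha> j \<noteq> \<beta> j" for j
    using wire_unique[OF assms(1,2), of j] assms(3) by blast
  have fh: "(crosses_at \<alpha> \<beta> i \<longrightarrow> f h i < 0) \<and> (\<not> crosses_at \<alpha> \<beta> i \<longrightarrow> f h i > 0)"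
    if h: "0 < h \<and> t i + h < t (i + 1) \<and> t (i - 1) < t i - h" for h
  proof -
    have "track \<alpha> (t i + h) < track \<beta> (t i + h) \<longleftrightarrow> \<alpha> i < \<beta> i" "track \<beta> (t i + h) < track \<alpha> (t i + h) \<longleftrightarrow> \<beta> i < \<alpha> i"
      "track \<alpha> (t i - h) < track \<beta> (t i - h) \<longleftrightarrow> \<alpha> (i - 1) < \<beta> (i - 1)"
      "track \<beta> (t i - h) < track \<alpha> (t i - h) \<longleftrightarrow> \<beta> (i - 1) < \<alpha> (i - 1)"
      using h track_less_iff[OF assms(1,2), of i "t i + h"] track_less_iff[OF assms(2,1), of i "t i + h"]
        track_less_iff[OF assms(1,2), of "i - 1" "t i - h"] track_less_iff[OF assms(2,1), of "i - 1" "t i - h"]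
      by simp_all
    then show ?thesis
      using ne[of i] ne[of "i - 1"] unfolding crosses_at_def f_def
      by (auto simp: mult_less_0_iff zero_less_mult_iff)
  qed
  show "crosses_at \<alpha> \<beta> i \<Longrightarrow> \<forall>\<^sub>F h in at_right 0. f h i < 0"
    using near_t[of i] by (rule eventually_mono) (use fh in blast)
  show "\<not> crosses_at \<alpha> \<beta> i \<Longrightarrow> \<forall>\<^sub>F h in at_right 0. f h i > 0"
    using near_t[of i] by (rule eventually_mono) (use fh in blast)
qed

definition meet :: "(int \<Rightarrow> nat) \<Rightarrow> (int \<Rightarrow> nat) \<Rightarrow> int \<Rightarrow> bool" where
  "meet \<alpha> \<beta> i \<longleftrightarrow> (\<alpha> i = Suc (\<beta> i) \<or> \<beta> i = Suc (\<alpha> i)) \<and> (i, min (\<alpha> i) (\<beta> i)) \<in> W"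

lemma track_eq_iff:
  assumes "\<alpha> \<in> \<Lambda>" "\<beta> \<in> \<Lambda>" "\<alpha> \<noteq> \<beta>"
  shows "track \<alpha> x = track \<beta> x \<longleftrightarrow> (\<exists>i. x = t i \<and> meet \<alpha> \<beta> i)"
proof
  assume e: "track \<alpha> x = track \<beta> x"
  define i where "i = idx x"
  have "\<alpha> i \<noteq> \<beta> i"
    using wire_unique[OF assms(1,2), of i] assms(3) by blast
  then consider "\<alpha> i < \<beta> i" | "\<beta> i < \<alpha> i" by linarith
  then show "\<exists>i. x = t i \<and> meet \<alpha> \<beta> i"
  proof cases
    case 1
    obtain m where m: "x = t m" "\<beta> i = Suc (\<alpha> i)" "(m, \<alpha> i) \<in> W"
      using s_eq_imp[OF 1 less_n[OF assms(2)], of x] e unfolding track_def i_def by metis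
    moreover from m(1) have "m = i"
      by (simp add: i_def)
    ultimately show ?thesis
      unfolding meet_def by (intro exI[of _ i]) simp
  next
    case 2
    obtain m where m: "x = t m" "\<alpha> i = Suc (\<beta> i)" "(m, \<beta> i) \<in> W"
      using s_eq_imp[OF 2 less_n[OF assms(1)], of x] e unfolding track_def i_def by metis
    moreover from m(1) have "m = i"
      by (simp add: i_def)
    ultimately show ?thesis
      unfolding meet_def by (intro exI[of _ i]) simp
  qed
next
  assume "\<exists>i. x = t i \<and> meet \<alpha> \<beta> i"
  then show "track \<alpha> x = track \<beta> x"
    by (auto simp: meet_def W_def track_def min_def)
qed

lemma track_meet: "meet \<alpha> \<beta> i \<Longrightarrow> mproj (t i, track \<alpha> (t i)) = vert (i, min (\<alpha> i) (\<beta> i))"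
  by (auto simp: meet_def W_def track_def min_def vert_def)

lemma crosses_at_meet: "\<alpha> \<in> \<Lambda> \<Longrightarrow> \<beta> \<in> \<Lambda> \<Longrightarrow> crosses_at \<alpha> \<beta> i \<Longrightarrow> meet \<alpha> \<beta> i"
  unfolding meet_def using crosses_at_steps by blast

lemma crossing_point_track:
  assumes "\<alpha> \<in> \<Lambda>" "\<beta> \<in> \<Lambda>" "\<alpha> \<noteq> \<beta>"
  shows "crossing_point (curve (track \<alpha>)) (curve (track \<beta>)) p \<longleftrightarrow>
    (\<exists>i. crosses_at \<alpha> \<beta> i \<and> p = vert (i, min (\<alpha> i) (\<beta> i)))"
proof -
  let ?f = "\<lambda>x h. (track \<alpha> (x - h) - track \<beta> (x - h)) * (track \<alpha> (x + h) - track \<beta> (x + h))"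
  have "(\<forall>\<^sub>F h in at_right 0. ?f (t i) h < 0) \<longleftrightarrow> crosses_at \<alpha> \<beta> i" for i
  proof
    assume 1: "\<forall>\<^sub>F h in at_right 0. ?f (t i) h < 0"
    show "crosses_at \<alpha> \<beta> i"
    proof (rule ccontr)
      assume "\<not> crosses_at \<alpha> \<beta> i"
      from track_product(2)[OF assms this] 1 have "\<forall>\<^sub>F h in at_right (0::real). False"
        by eventually_elim simp
      then show False by simp
    qed
  qed (rule track_product(1)[OF assms])
  then have "crossing_point (curve (track \<alpha>)) (curve (track \<beta>)) p \<longleftrightarrow>
      (\<exists>i. p = mproj (t i, track \<alpha> (t i)) \<and> meet \<alpha> \<beta> i \<and> crosses_at \<alpha> \<beta> i)"
    unfolding crossing_point_curve_iff[OF track_antiperiodic[OF assms(1)] track_antiperiodic[OF assms(2)]]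
      track_eq_iff[OF assms] by auto
  also have "\<dots> \<longleftrightarrow> (\<exists>i. crosses_at \<alpha> \<beta> i \<and> p = vert (i, min (\<alpha> i) (\<beta> i)))"
    using crosses_at_meet[OF assms(1,2)] track_meet by metis
  finally show ?thesis .
qed

lemma contact_point_track:
  assumes "\<alpha> \<in> \<Lambda>" "\<beta> \<in> \<Lambda>" "\<alpha> \<noteq> \<beta>"
  shows "contact_point (curve (track \<alpha>)) (curve (track \<beta>)) p \<longleftrightarrow>
    (\<exists>i. meet \<alpha> \<beta> i \<and> \<not> crosses_at \<alpha> \<beta> i \<and> p = vert (i, min (\<alpha> i) (\<beta> i)))"
proof -
  let ?f = "\<lambda>x h. (track \<alpha> (x - h) - track \<beta> (x - h)) * (track \<alpha> (x + h) - track \<beta> (x + h))"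
  have "(\<forall>\<^sub>F h in at_right 0. ?f (t i) h > 0) \<longleftrightarrow> \<not> crosses_at \<alpha> \<beta> i" for i
  proof
    assume 1: "\<forall>\<^sub>F h in at_right 0. ?f (t i) h > 0"
    show "\<not> crosses_at \<alpha> \<beta> i"
    proof
      assume "crosses_at \<alpha> \<beta> i"
      from track_product(1)[OF assms this] 1 have "\<forall>\<^sub>F h in at_right (0::real). False"
        by eventually_elim simp
      then show False by simp
    qed
  qed (rule track_product(2)[OF assms])
  then have "contact_point (curve (track \<alpha>)) (curve (track \<beta>)) p \<longleftrightarrow>
      (\<exists>i. p = mproj (t i, track \<alpha> (t i)) \<and> meet \<alpha> \<beta> i \<and> \<not> crosses_at \<alpha> \<beta> i)"
    unfolding contact_point_curve_iff[OF track_antiperiodic[OF assms(1)] track_antiperiodic[OF assms(2)]]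
      track_eq_iff[OF assms] by auto
  also have "\<dots> \<longleftrightarrow> (\<exists>i. meet \<alpha> \<beta> i \<and> \<not> crosses_at \<alpha> \<beta> i \<and> p = vert (i, min (\<alpha> i) (\<beta> i)))"
    using track_meet by metis
  finally show ?thesis .
qed

lemma mproj_in_curve_track: "\<alpha> \<in> \<Lambda> \<Longrightarrow> mproj (x, y) \<in> curve (track \<alpha>) \<longleftrightarrow> y = track \<alpha> x"
  by (rule mproj_in_curve[OF track_antiperiodic])

lemma curves_inter:
  assumes "\<alpha> \<in> \<Lambda>" "\<beta> \<in> \<Lambda>" "\<alpha> \<noteq> \<beta>"
  shows "curve (track \<alpha>) \<inter> curve (track \<beta>) = {vert (i, min (\<alpha> i) (\<beta> i)) |i. meet \<alpha> \<beta> i}"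
proof (intro set_eqI iffI)
  fix v assume "v \<in> curve (track \<alpha>) \<inter> curve (track \<beta>)"
  moreover obtain x y where v: "v = mproj (x, y)" by (rule mproj_cases)
  ultimately have "y = track \<alpha> x" "y = track \<beta> x"
    by (simp_all add: mproj_in_curve_track assms)
  then obtain i where "x = t i" "meet \<alpha> \<beta> i"
    using track_eq_iff[OF assms, of x] by auto
  then show "v \<in> {vert (i, min (\<alpha> i) (\<beta> i)) |i. meet \<alpha> \<beta> i}"
    using track_meet[of \<alpha> \<beta> i] v \<open>y = track \<alpha> x\<close> by auto
next
  fix v assume "v \<in> {vert (i, min (\<alpha> i) (\<beta> i)) |i. meet \<alpha> \<beta> i}"
  then obtain i where i: "v = vert (i, min (\<alpha> i) (\<beta> i))" "meet \<alpha> \<beta> i" by blast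
  then have "v = mproj (t i, track \<alpha> (t i))" "track \<alpha> (t i) = track \<beta> (t i)"
    using track_meet track_eq_iff[OF assms] by auto
  then show "v \<in> curve (track \<alpha>) \<inter> curve (track \<beta>)"
    by (simp add: mproj_in_curve_track assms)
qed

lemma support_realize: "support (realize \<Lambda>) = graphs k"
proof (intro set_eqI)
  fix v
  obtain x y where v: "v = mproj (x, y)" by (rule mproj_cases)
  have "v \<in> support (realize \<Lambda>) \<longleftrightarrow> (\<exists>\<alpha>\<in>\<Lambda>. y = track \<alpha> x)"
    unfolding realize_def v using mproj_in_curve_track by auto
  also have "\<dots> \<longleftrightarrow> (\<exists>j. k \<le> j \<and> j < n - k \<and> y = s j x)"
  proof
    assume "\<exists>\<alpha>\<in>\<Lambda>. y = track \<alpha> x"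
    then show "\<exists>j. k \<le> j \<and> j < n - k \<and> y = s j x"
      using range unfolding track_def by blast
  next
    assume "\<exists>j. k \<le> j \<and> j < n - k \<and> y = s j x"
    then obtain j where j: "k \<le> j" "j < n - k" "y = s j x" by blast
    obtain \<alpha> where "\<alpha> \<in> \<Lambda>" "\<alpha> (idx x) = j"
      using obtain_wire[OF j(1,2)] by blast
    with j show "\<exists>\<alpha>\<in>\<Lambda>. y = track \<alpha> x"
      by (auto simp: track_def)
  qed
  finally show "v \<in> support (realize \<Lambda>) \<longleftrightarrow> v \<in> graphs k"
    by (simp add: v mproj_in_graphs)
qed

lemma finite_wires: "finite \<Lambda>"
proof -
  have "(\<lambda>\<alpha>. \<alpha> 0) ` \<Lambda> \<subseteq> {..<n}"
    using less_n by auto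
  moreover have "inj_on (\<lambda>\<alpha>. \<alpha> 0) \<Lambda>"
    using wire_unique by (auto intro: inj_onI)
  ultimately show ?thesis
    using finite_imageD finite_subset by blast
qed

lemma meet_shift:
  assumes "\<alpha> \<in> \<Lambda>" "\<beta> \<in> \<Lambda>"
  shows "meet \<alpha> \<beta> (i + r) \<longleftrightarrow> meet \<alpha> \<beta> i"
    and "meet \<alpha> \<beta> i \<Longrightarrow> vert (i + r, min (\<alpha> (i + r)) (\<beta> (i + r))) = vert (i, min (\<alpha> i) (\<beta> i))"
proof -
  let ?adj = "\<lambda>i. \<alpha> i = Suc (\<beta> i) \<or> \<beta> i = Suc (\<alpha> i)"
  have adj: "?adj (i + r) \<longleftrightarrow> ?adj i"
    using shift[OF assms(1), of i] shift[OF assms(2), of i] range[OF assms(1), of i] range[OF assms(2), of i] by auto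
  have W: "(i + r, min (\<alpha> (i + r)) (\<beta> (i + r))) \<in> W \<longleftrightarrow> (i, min (\<alpha> i) (\<beta> i)) \<in> W" if "?adj i"
    using shift_min(1)[OF assms that] that W_shift[of "min (\<alpha> i) (\<beta> i)" i]
      range[OF assms(1), of i] range[OF assms(2), of i] by (auto simp: min_def)
  show m: "meet \<alpha> \<beta> (i + r) \<longleftrightarrow> meet \<alpha> \<beta> i"
    using adj W unfolding meet_def by blast
  assume me: "meet \<alpha> \<beta> i"
  have "vert (i + r, min (\<alpha> (i + r)) (\<beta> (i + r))) = mproj (t i + pi, - track \<alpha> (t i))"
    using track_meet[of \<alpha> \<beta> "i + r"] m me track_antiperiodic[OF assms(1)]
    by (simp add: t_shift antiperiodic_def)
  also have "\<dots> = vert (i, min (\<alpha> i) (\<beta> i))"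
    using track_meet[OF me] by (simp add: mproj_shift)
  finally show "vert (i + r, min (\<alpha> (i + r)) (\<beta> (i + r))) = vert (i, min (\<alpha> i) (\<beta> i))" .
qed

lemma vert_class:
  assumes "\<alpha> \<in> \<Lambda>" "\<beta> \<in> \<Lambda>" "meet \<alpha> \<beta> p" "r dvd i - p"
  shows "vert (i, min (\<alpha> i) (\<beta> i)) = vert (p, min (\<alpha> p) (\<beta> p)) \<and> meet \<alpha> \<beta> i"
proof -
  let ?P = "\<lambda>i. vert (i, min (\<alpha> i) (\<beta> i)) = vert (p, min (\<alpha> p) (\<beta> p)) \<and> meet \<alpha> \<beta> i"
  have "?P (i + r) \<longleftrightarrow> ?P i" for i
    using meet_shift[OF assms(1,2), of i] by auto
  from periodic_dvd[of ?P, OF this assms(4)] assms(3) show ?thesis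
    by blast
qed

end

context levels_wires begin

text \<open>A pair meets with period \<open>r\<close>, hence in finitely many points of the strip,
  and its crossings form one residue class, hence one point. Three wires never meet, since three
  levels cannot be pairwise adjacent.\<close>

lemma simple_arrangement_realize: "simple_arrangement (realize \<Lambda>)"
proof -
  have pl: "pseudoline (curve (track \<alpha>))" if "\<alpha> \<in> \<Lambda>" for \<alpha>
    using track_antiperiodic[OF that] by (auto simp: pseudoline_def)
  have fin: "finite (curve (track \<alpha>) \<inter> curve (track \<beta>))" if L: "\<alpha> \<in> \<Lambda>" "\<beta> \<in> \<Lambda>" "\<alpha> \<noteq> \<beta>" for \<alpha> \<beta>
  proof -
    have "curve (track \<alpha>) \<inter> curve (track \<beta>) \<subseteq> (\<lambda>i. vert (i, min (\<alpha> i) (\<beta> i))) ` {0..<r}"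
    proof
      fix v assume "v \<in> curve (track \<alpha>) \<inter> curve (track \<beta>)"
      then obtain i where i: "v = vert (i, min (\<alpha> i) (\<beta> i))" "meet \<alpha> \<beta> i"
        unfolding curves_inter[OF L] by blast
      have dv: "r dvd i mod r - i"
        by (metis dvd_minus_mod dvd_diff_commute)
      have "v = vert (i mod r, min (\<alpha> (i mod r)) (\<beta> (i mod r)))"
        by (rule trans[OF i(1) conjunct1[OF vert_class[OF L(1,2) i(2) dv], symmetric]])
      then show "v \<in> (\<lambda>i. vert (i, min (\<alpha> i) (\<beta> i))) ` {0..<r}"
        using r_pos by auto
    qed
    then show ?thesis
      using finite_subset by blast
  qed
  have ex1: "\<exists>!p. crossing_point (curve (track \<alpha>)) (curve (track \<beta>)) p" if L: "\<alpha> \<in> \<Lambda>" "\<beta> \<in> \<Lambda>" "\<alpha> \<noteq> \<beta>" for \<alpha> \<beta>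
  proof -
    obtain c where c: "crosses_at \<alpha> \<beta> i \<longleftrightarrow> r dvd i - c" for i
      using crosses_once[OF L] by blast
    have m: "meet \<alpha> \<beta> c"
      using crosses_at_meet[OF L(1,2)] c[of c] by simp
    have "crossing_point (curve (track \<alpha>)) (curve (track \<beta>)) p \<longleftrightarrow> p = vert (c, min (\<alpha> c) (\<beta> c))" for p
    proof
      assume "crossing_point (curve (track \<alpha>)) (curve (track \<beta>)) p"
      then obtain i where i: "r dvd i - c" "p = vert (i, min (\<alpha> i) (\<beta> i))"
        unfolding crossing_point_track[OF L] c by blast
      show "p = vert (c, min (\<alpha> c) (\<beta> c))"
        by (rule trans[OF i(2) conjunct1[OF vert_class[OF L(1,2) m i(1)]]])
    next
      assume "p = vert (c, min (\<alpha> c) (\<beta> c))"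
      then show "crossing_point (curve (track \<alpha>)) (curve (track \<beta>)) p"
        unfolding crossing_point_track[OF L] c by (intro exI[of _ c]) simp
    qed
    then show ?thesis by simp
  qed
  have tri: "curve (track \<alpha>) \<inter> curve (track \<beta>) \<inter> curve (track \<gamma>) = {}"
    if L: "\<alpha> \<in> \<Lambda>" "\<beta> \<in> \<Lambda>" "\<gamma> \<in> \<Lambda>" and ne: "\<alpha> \<noteq> \<beta>" "\<alpha> \<noteq> \<gamma>" "\<beta> \<noteq> \<gamma>" for \<alpha> \<beta> \<gamma>
  proof (rule ccontr)
    assume "\<not> ?thesis"
    then obtain v where v: "v \<in> curve (track \<alpha>)" "v \<in> curve (track \<beta>)" "v \<in> curve (track \<gamma>)" by blast
    obtain x y where xy: "v = mproj (x, y)" by (rule mproj_cases)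
    have e: "track \<alpha> x = track \<beta> x" "track \<alpha> x = track \<gamma> x" "track \<beta> x = track \<gamma> x"
      using v by (simp_all add: xy mproj_in_curve_track L)
    obtain i where i: "x = t i" "meet \<alpha> \<beta> i"
      using e(1) track_eq_iff[OF L(1,2) ne(1)] by blast
    have "meet \<alpha> \<gamma> i" "meet \<beta> \<gamma> i"
      using e(2,3) i(1) track_eq_iff[OF L(1,3) ne(2)] track_eq_iff[OF L(2,3) ne(3)] t_eq_iff by metis+
    with i(2) have "\<alpha> i = Suc (\<beta> i) \<or> \<beta> i = Suc (\<alpha> i)" "\<alpha> i = Suc (\<gamma> i) \<or> \<gamma> i = Suc (\<alpha> i)"
      "\<beta> i = Suc (\<gamma> i) \<or> \<gamma> i = Suc (\<beta> i)"
      unfolding meet_def by blast+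
    then show False
      by (elim disjE) linarith+
  qed
  show ?thesis
    unfolding simple_arrangement_def arrangement_def realize_def
  proof (intro conjI ballI impI)
    show "finite ((\<lambda>\<alpha>. curve (track \<alpha>)) ` \<Lambda>)"
      using finite_wires by simp
  next
    fix l m assume "l \<in> (\<lambda>\<alpha>. curve (track \<alpha>)) ` \<Lambda>" "m \<in> (\<lambda>\<alpha>. curve (track \<alpha>)) ` \<Lambda>" "l \<noteq> m"
    then show "finite (l \<inter> m)" "\<exists>!p. crossing_point l m p"
      using fin ex1 by blast+
  next
    fix l m o' assume "l \<in> (\<lambda>\<alpha>. curve (track \<alpha>)) ` \<Lambda>" "m \<in> (\<lambda>\<alpha>. curve (track \<alpha>)) ` \<Lambda>"
      "o' \<in> (\<lambda>\<alpha>. curve (track \<alpha>)) ` \<Lambda>" "l \<noteq> m" "l \<noteq> o'" "m \<noteq> o'"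
    then show "l \<inter> m \<inter> o' = {}"
      using tri by blast
  qed (use pl in blast)
qed

end

context levels_prewires begin

lemma meet_levels:
  assumes "(i, j) \<in> vertices_in k"
  obtains \<alpha> \<beta> where "\<alpha> \<in> \<Lambda>" "\<beta> \<in> \<Lambda>" "\<alpha> \<noteq> \<beta>" "\<alpha> i = j" "\<beta> i = Suc j" "meet \<alpha> \<beta> i"
proof -
  have j: "k \<le> j" "j < n - k" "k \<le> Suc j" "Suc j < n - k" "(i, j) \<in> W"
    using assms by (auto simp: vertices_in_def)
  obtain \<alpha> where a: "\<alpha> \<in> \<Lambda>" "\<alpha> i = j" using obtain_wire[OF j(1,2)] by blast
  obtain \<beta> where b: "\<beta> \<in> \<Lambda>" "\<beta> i = Suc j" using obtain_wire[OF j(3,4)] by blast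
  show thesis
    using that[OF a(1) b(1) _ a(2) b(2)] a b j by (force simp: meet_def)
qed

lemma meet_vertices_in:
  assumes "\<alpha> \<in> \<Lambda>" "\<beta> \<in> \<Lambda>" "meet \<alpha> \<beta> i"
  shows "(i, min (\<alpha> i) (\<beta> i)) \<in> vertices_in k"
  using assms range[OF assms(1), of i] range[OF assms(2), of i] by (auto simp: meet_def vertices_in_def)

lemma meet_crossings_iff:
  assumes "\<alpha> \<in> \<Lambda>" "\<beta> \<in> \<Lambda>" "meet \<alpha> \<beta> i"
  shows "(i, min (\<alpha> i) (\<beta> i)) \<in> crossings \<Lambda> \<longleftrightarrow> crosses_at \<alpha> \<beta> i"
proof -
  have "\<alpha> \<noteq> \<beta>"
    using assms(3) by (auto simp: meet_def)
  then show ?thesis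
    using assms crossings_iff_crosses_at[OF assms(1,2), of i "\<alpha> i"] crossings_iff_crosses_at[OF assms(2,1), of i "\<beta> i"]
      crosses_at_sym[OF assms(1,2), of i] by (auto simp: meet_def min_def)
qed

lemma contacts_realize: "contacts (realize \<Lambda>) = vert ` wcontacts k \<Lambda>"
proof (intro set_eqI iffI)
  fix v assume "v \<in> contacts (realize \<Lambda>)"
  then obtain \<alpha> \<beta> where L: "\<alpha> \<in> \<Lambda>" "\<beta> \<in> \<Lambda>" "\<alpha> \<noteq> \<beta>" "contact_point (curve (track \<alpha>)) (curve (track \<beta>)) v"
    by (auto simp: contacts_def realize_def)
  then obtain i where i: "meet \<alpha> \<beta> i" "\<not> crosses_at \<alpha> \<beta> i" "v = vert (i, min (\<alpha> i) (\<beta> i))"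
    using contact_point_track by blast
  then have "(i, min (\<alpha> i) (\<beta> i)) \<in> wcontacts k \<Lambda>"
    using L meet_vertices_in meet_crossings_iff by (simp add: wcontacts_def)
  with i show "v \<in> vert ` wcontacts k \<Lambda>" by blast
next
  fix v assume "v \<in> vert ` wcontacts k \<Lambda>"
  then obtain i j where ij: "v = vert (i, j)" "(i, j) \<in> vertices_in k" "(i, j) \<notin> crossings \<Lambda>"
    by (auto simp: wcontacts_def)
  obtain \<alpha> \<beta> where L: "\<alpha> \<in> \<Lambda>" "\<beta> \<in> \<Lambda>" "\<alpha> \<noteq> \<beta>" "\<alpha> i = j" "\<beta> i = Suc j" "meet \<alpha> \<beta> i"
    using meet_levels[OF ij(2)] by blast
  have "min (\<alpha> i) (\<beta> i) = j"
    using L by simp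
  moreover have "\<not> crosses_at \<alpha> \<beta> i"
    using crossings_iff_crosses_at[OF L(1,2,4,5)] ij(3) by blast
  ultimately have "contact_point (curve (track \<alpha>)) (curve (track \<beta>)) v"
    using contact_point_track[OF L(1-3)] L(6) ij(1) by blast
  moreover have "curve (track \<alpha>) \<noteq> curve (track \<beta>)"
    using curve_track_inj[OF L(1,2)] L(3) by blast
  ultimately show "v \<in> contacts (realize \<Lambda>)"
    unfolding contacts_def realize_def
    by (intro CollectI bexI[of _ "curve (track \<alpha>)"] bexI[of _ "curve (track \<beta>)"] conjI imageI L(1,2))
qed

lemma vertices_realize: "vertices (realize \<Lambda>) = vert ` vertices_in k"
proof (intro set_eqI iffI)
  fix v assume "v \<in> vertices (realize \<Lambda>)"
  then obtain \<alpha> \<beta> where L: "\<alpha> \<in> \<Lambda>" "\<beta> \<in> \<Lambda>" "\<alpha> \<noteq> \<beta>" "v \<in> curve (track \<alpha>) \<inter> curve (track \<beta>)"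
    by (auto simp: vertices_def realize_def)
  then show "v \<in> vert ` vertices_in k"
    unfolding curves_inter[OF L(1-3)] using meet_vertices_in[OF L(1,2)] by blast
next
  fix v assume "v \<in> vert ` vertices_in k"
  then obtain i j where ij: "v = vert (i, j)" "(i, j) \<in> vertices_in k"
    by auto
  obtain \<alpha> \<beta> where L: "\<alpha> \<in> \<Lambda>" "\<beta> \<in> \<Lambda>" "\<alpha> \<noteq> \<beta>" "\<alpha> i = j" "\<beta> i = Suc j" "meet \<alpha> \<beta> i"
    using meet_levels[OF ij(2)] by blast
  then have "v \<in> curve (track \<alpha>) \<inter> curve (track \<beta>)"
    unfolding curves_inter[OF L(1-3)] using ij(1) by (intro CollectI exI[of _ i]) simp
  moreover have "curve (track \<alpha>) \<noteq> curve (track \<beta>)"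
    using curve_track_inj[OF L(1,2)] L(3) by blast
  ultimately show "v \<in> vertices (realize \<Lambda>)"
    unfolding vertices_def realize_def
    by (intro CollectI bexI[of _ "curve (track \<alpha>)"] bexI[of _ "curve (track \<beta>)"] conjI imageI L(1,2))
qed

end

section \<open>Arrangements on a kernel come from wirings\<close>

context levels begin

lemma closed_gap_eq:
  assumes "continuous_on UNIV g" "j < n" "\<And>x. t i < x \<Longrightarrow> x < t (i + 1) \<Longrightarrow> g x = s j x"
    and "t i \<le> x" "x \<le> t (i + 1)"
  shows "g x = s j x"
proof -
  have "closure {t i<..<t (i + 1)} \<subseteq> {x. g x = s j x}"
    using assms(1,3) s_cont[OF assms(2)] by (intro closure_minimal closed_Collect_eq) auto
  moreover have "closure {t i<..<t (i + 1)} = {t i..t (i + 1)}"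
    by (simp add: t_less_iff)
  ultimately show ?thesis
    using assms(4,5) by auto
qed

text \<open>To get from level \<open>a\<close> to a higher one within a gap, a continuous function
  has to cross the line midway between the levels \<open>a\<close> and \<open>a + 1\<close>, where
  no level runs.\<close>

lemma level_jump:
  assumes "continuous_on UNIV g" "\<And>x. \<exists>j<n. g x = s j x" "a < b" "b < n"
    and "t i < x" "x < t (i + 1)" "t i < y" "y < t (i + 1)" "g x = s a x" "g y = s b y"
  shows False
proof -
  define h where "h z = g z - (s a z + s (Suc a) z) / 2" for z
  have a: "a < n" "Suc a < n"
    using assms(3,4) by auto
  have hc: "continuous_on UNIV h"
    unfolding h_def using assms(1) s_cont a by (intro continuous_intros) auto
  have "connected (h ` {t i<..<t (i + 1)})"
    by (rule connected_continuous_image[OF continuous_on_subset[OF hc subset_UNIV]]) simp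
  moreover have "h x < 0"
    using s_less[of a "Suc a" x] a(2) open_gap_not_t[OF assms(5,6)] assms(9) by (simp add: h_def)
  moreover have "0 < h y"
    using s_less[of a "Suc a" y] s_mono[of "Suc a" b y] a(2) open_gap_not_t[OF assms(7,8)] assms(3,4,10)
    by (simp add: h_def)
  ultimately have "0 \<in> h ` {t i<..<t (i + 1)}"
    using connected_contains_Icc[of "h ` {t i<..<t (i + 1)}" "h x" "h y"] assms(5-8) by auto
  then obtain z where z: "t i < z" "z < t (i + 1)" "h z = 0"
    by auto
  obtain l where l: "l < n" "g z = s l z"
    using assms(2) by blast
  have "s a z < s (Suc a) z"
    using s_less[of a "Suc a" z] a(2) open_gap_not_t[OF z(1,2)] by simp
  then have "s a z < g z" "g z < s (Suc a) z"
    using z(3) by (simp_all add: h_def)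
  moreover have "s l z \<le> s a z \<or> s (Suc a) z \<le> s l z"
    using s_mono[of l a z] s_mono[of "Suc a" l z] l a by (cases "l \<le> a") auto
  ultimately show False
    using l by auto
qed

lemma level_ex:
  assumes "continuous_on UNIV g" "\<And>x. \<exists>j. k \<le> j \<and> j < n - k \<and> g x = s j x"
  shows "\<exists>j. k \<le> j \<and> j < n - k \<and> (\<forall>x. t i \<le> x \<and> x \<le> t (i + 1) \<longrightarrow> g x = s j x)"
proof -
  have ex: "\<exists>j<n. g x = s j x" for x
    using assms(2)[of x] by (meson diff_le_self less_le_trans)
  obtain x where x: "t i < x" "x < t (i + 1)"
    by (rule gap_point)
  obtain j where j: "k \<le> j" "j < n - k" "g x = s j x"
    using assms(2) by blast
  have jn: "j < n"
    using j(2) by simp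
  have "g y = s j y" if y: "t i < y" "y < t (i + 1)" for y
  proof -
    obtain l where l: "l < n" "g y = s l y"
      using ex by blast
    have "\<not> l < j" "\<not> j < l"
      using level_jump[OF assms(1) ex _ jn y x l(2) j(3)] level_jump[OF assms(1) ex _ l(1) x y j(3) l(2)] by blast+
    then have "l = j"
      by simp
    with l show ?thesis by simp
  qed
  then show ?thesis
    using closed_gap_eq[OF assms(1) jn] j by blast
qed

text \<open>Over each gap a curve follows one level (\<open>level_ex\<close>), and these levels form
  its wire. Two curves share no level over a gap because they meet in finitely many points, and
  every level is followed because the support is all of \<open>graphs k\<close>. Once the tracks are
  identified with the curves, the unique crossing point becomes a single residue class of
  crossings.\<close>

lemma realize_ex:
  assumes B: "simple_arrangement B" and S: "support B = graphs k"
  shows "\<exists>\<Lambda>. wiring k \<Lambda> \<and> B = realize \<Lambda>"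
proof -
  define G where "G = {g. antiperiodic g \<and> curve g \<in> B}"
  have arr: "\<And>l. l \<in> B \<Longrightarrow> pseudoline l"
    "\<And>l m. l \<in> B \<Longrightarrow> m \<in> B \<Longrightarrow> l \<noteq> m \<Longrightarrow> finite (l \<inter> m) \<and> (\<exists>!p. crossing_point l m p)"
    using B by (auto simp: simple_arrangement_def arrangement_def)
  have BG: "B = curve ` G"
    using arr(1) unfolding G_def pseudoline_def by auto
  have cont: "continuous_on UNIV g" "antiperiodic g" if "g \<in> G" for g
    using that by (auto simp: G_def antiperiodic_def)
  have onS: "\<exists>j. k \<le> j \<and> j < n - k \<and> g x = s j x" if "g \<in> G" for g x
  proof -
    have "mproj (x, g x) \<in> curve g"
      by (auto simp: curve_def)
    then have "mproj (x, g x) \<in> graphs k"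
      using that unfolding S[symmetric] BG by blast
    then show ?thesis by (simp add: mproj_in_graphs)
  qed
  define lev where "lev g i = (SOME j. k \<le> j \<and> j < n - k \<and> (\<forall>x. t i \<le> x \<and> x \<le> t (i + 1) \<longrightarrow> g x = s j x))" for g i
  have lev: "k \<le> lev g i" "lev g i < n - k" "\<And>x. t i \<le> x \<Longrightarrow> x \<le> t (i + 1) \<Longrightarrow> g x = s (lev g i) x"
    if "g \<in> G" for g i
    using someI_ex[OF level_ex[OF cont(1)[OF that] onS[OF that], of i]] unfolding lev_def by blast+
  have levn: "lev g i < n" if "g \<in> G" for g i
    using lev(2)[OF that, of i] by simp
  have lev_eq: "lev g i = j" if "g \<in> G" "j < n" "t i < x" "x < t (i + 1)" "g x = s j x" for g i j x
  proof (rule ccontr)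
    assume "lev g i \<noteq> j"
    moreover have "s (lev g i) x = s j x"
      using lev(3)[OF that(1), of i x] that by simp
    moreover have "x \<notin> range t"
      using that(3,4) by (rule open_gap_not_t)
    ultimately show False
      using s_less[of "lev g i" j x] s_less[of j "lev g i" x] that(2) levn[OF that(1), of i] by (metis less_irrefl linorder_neqE_nat)
  qed
  define \<Lambda> where "\<Lambda> = lev ` G"
  have tr: "track (lev g) = g" if "g \<in> G" for g
  proof
    show "track (lev g) x = g x" for x
      using lev(3)[OF that, of "idx x" x] idx[of x] by (simp add: track_def)
  qed
  have Rl: "B = realize \<Lambda>"
    unfolding BG realize_def \<Lambda>_def image_image by (rule image_cong) (simp_all add: tr)
  have uniq: "g = g'" if G: "g \<in> G" "g' \<in> G" and e: "lev g i = lev g' i" for g g' i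
  proof (rule ccontr)
    assume "g \<noteq> g'"
    then have "curve g \<noteq> curve g'"
      using curve_inj cont G by blast
    then have "finite (curve g \<inter> curve g')"
      using arr(2) G by (simp add: G_def)
    moreover have "(\<lambda>x. mproj (x, g x)) ` {t i<..<t (i + 1)} \<subseteq> curve g \<inter> curve g'"
    proof
      fix v assume "v \<in> (\<lambda>x. mproj (x, g x)) ` {t i<..<t (i + 1)}"
      then obtain x where x: "t i < x" "x < t (i + 1)" "v = mproj (x, g x)"
        by auto
      then have "g x = g' x"
        using lev(3)[OF G(1), of i x] lev(3)[OF G(2), of i x] e by simp
      then show "v \<in> curve g \<inter> curve g'"
        unfolding x(3) Int_iff mproj_in_curve[OF cont(2)[OF G(1)]] mproj_in_curve[OF cont(2)[OF G(2)]] by simp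
    qed
    \<comment> \<open>A gap is no longer than \<open>pi\<close>, so no two of its points are
      identified in the strip.\<close>
    moreover have "inj_on (\<lambda>x. mproj (x, g x)) {t i<..<t (i + 1)}"
    proof (rule inj_onI)
      fix x y assume xy: "x \<in> {t i<..<t (i + 1)}" "y \<in> {t i<..<t (i + 1)}" "mproj (x, g x) = mproj (y, g y)"
      then obtain q :: int where q: "y = x + of_int q * pi"
        unfolding mproj_eq_iff by blast
      have "t (i + 1) \<le> t (i + r)"
        using r_pos by (simp add: t_le_iff)
      then have "\<bar>of_int q * pi\<bar> < pi"
        using xy(1,2) q t_shift[of i] by auto
      then have "\<bar>of_int q\<bar> < (1::real)"
        by (simp add: abs_mult)
      then have "q = 0"
        by linarith
      with q show "x = y" by simp
    qed
    ultimately have "finite {t i<..<t (i + 1)}"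
      using finite_imageD finite_subset by blast
    then show False
      using infinite_Ioo[of "t i" "t (i + 1)"] t_less_iff[of i "i + 1"] by simp
  qed
  have pre: "prewiring k \<Lambda>"
    unfolding prewiring_def
  proof (intro conjI ballI allI impI)
    fix \<alpha> i assume "\<alpha> \<in> \<Lambda>"
    then obtain g where g: "g \<in> G" "\<alpha> = lev g" by (auto simp: \<Lambda>_def)
    show "k \<le> \<alpha> i" "\<alpha> i < n - k"
      using lev g by auto
    obtain x where x: "t i < x" "x < t (i + 1)"
      by (rule gap_point)
    have "g (x + pi) = - g x"
      using cont(2)[OF g(1)] by (simp add: antiperiodic_def)
    also have "\<dots> = s (n - 1 - lev g i) (x + pi)"
      using lev(3)[OF g(1), of i x] x s_shift[OF levn[OF g(1)], of i x] by simp
    finally show "\<alpha> (i + r) = n - 1 - \<alpha> i"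
      using lev_eq[OF g(1), of "n - 1 - lev g i" "i + r" "x + pi"] x t_shift[of i] t_shift[of "i + 1"] levn[OF g(1), of i] g(2)
      by (simp add: algebra_simps)
    have "s (lev g (i - 1)) (t i) = s (lev g i) (t i)"
      using lev(3)[OF g(1), of "i - 1" "t i"] lev(3)[OF g(1), of i "t i"] by (simp add: t_le_iff)
    moreover have "(i, a) \<in> W \<and> b = Suc a" if "a < b" "b < n" "s a (t i) = s b (t i)" for a b
      using s_eq_imp[OF that] t_eq_iff by metis
    ultimately show "\<alpha> i = \<alpha> (i - 1) \<or> \<alpha> i = Suc (\<alpha> (i - 1)) \<and> (i, \<alpha> (i - 1)) \<in> W \<or> \<alpha> (i - 1) = Suc (\<alpha> i) \<and> (i, \<alpha> i) \<in> W"
      using levn[OF g(1), of i] levn[OF g(1), of "i - 1"] unfolding g(2) by (metis linorder_neqE_nat)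
  next
    fix i j assume j: "k \<le> j \<and> j < n - k"
    obtain x where x: "t i < x" "x < t (i + 1)"
      by (rule gap_point)
    have "mproj (x, s j x) \<in> support B"
      unfolding S mproj_in_graphs using j by blast
    then obtain g where g: "g \<in> G" "mproj (x, s j x) \<in> curve g"
      unfolding BG by blast
    moreover have "j < n"
      using conjunct2[OF j] by simp
    ultimately have "lev g i = j"
      using lev_eq[OF g(1), of j i x] x mproj_in_curve[OF cont(2)[OF g(1)]] by simp
    with g show "\<exists>!\<alpha>. \<alpha> \<in> \<Lambda> \<and> \<alpha> i = j"
      unfolding \<Lambda>_def using uniq by blast
  qed
  interpret P: levels_prewires n s t r k \<Lambda>
    using pre by unfold_locales
  have "wiring k \<Lambda>"
    unfolding wiring_def
  proof (intro conjI ballI impI pre)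
    fix \<alpha> \<beta> assume ab: "\<alpha> \<in> \<Lambda>" "\<beta> \<in> \<Lambda>" "\<alpha> \<noteq> \<beta>"
    have "curve (track \<alpha>) \<noteq> curve (track \<beta>)"
      using P.curve_track_inj[OF ab(1,2)] ab(3) by blast
    then obtain p where p: "crossing_point (curve (track \<alpha>)) (curve (track \<beta>)) q \<longleftrightarrow> q = p" for q
      using arr(2)[of "curve (track \<alpha>)" "curve (track \<beta>)"] ab unfolding Rl realize_def by blast
    obtain c where c: "crosses_at \<alpha> \<beta> c" "p = vert (c, min (\<alpha> c) (\<beta> c))"
      using p[of p] P.crossing_point_track[OF ab] by blast
    have ne: "\<alpha> i \<noteq> \<beta> i" for i
      using P.wire_unique[OF ab(1,2), of i] ab(3) by blast
    have sh: "crosses_at \<alpha> \<beta> (i + r) \<longleftrightarrow> crosses_at \<alpha> \<beta> i" for i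
      using P.shift ab P.less_n by (intro crosses_at_shift ne) auto
    show "\<exists>c. \<forall>i. crosses_at \<alpha> \<beta> i \<longleftrightarrow> r dvd i - c"
    proof (intro exI[of _ c] allI iffI)
      fix i assume "crosses_at \<alpha> \<beta> i"
      then have "vert (i, min (\<alpha> i) (\<beta> i)) = p"
        using p P.crossing_point_track[OF ab] by blast
      then obtain q where "i = c + q * r"
        using vert_eq_imp c(2) by metis
      then show "r dvd i - c" by simp
    next
      fix i assume "r dvd i - c"
      then show "crosses_at \<alpha> \<beta> i"
        using periodic_dvd[of "crosses_at \<alpha> \<beta>" r i c] sh c(1) by blast
    qed
  qed
  with Rl show ?thesis by blast
qed

text \<open>The highest level \<open>n - 1 - k\<close> and the lowest level \<open>k\<close> are one
  curve in the strip, so removing one level there removes a level on each side of the lift.\<close>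

lemma first_level_graphs:
  assumes "k < n - k"
  shows "mproj (x, y) \<in> first_level (graphs k) \<longleftrightarrow> y = s k x \<or> y = s (n - 1 - k) x"
proof -
  define m where "m = n - 1 - k"
  have m: "m < n" "k \<le> m" "m < n - k" "n - 1 - m = k"
    using assms by (auto simp: m_def)
  have "first_level (graphs k) = range (\<lambda>x. mproj (x, s m x))"
  proof (rule first_level_top)
    show "continuous_on UNIV (s m)"
      using s_cont m by simp
    show "mproj (x, s m x) \<in> graphs k" for x
      using m by (auto simp: mproj_in_graphs)
    show "y \<le> s m x" if "mproj (x, y) \<in> graphs k" for x y
      using that s_mono[of _ m x] m by (auto simp: mproj_in_graphs m_def)
  qed
  moreover have "mproj (x, y) \<in> range (\<lambda>x. mproj (x, s m x)) \<longleftrightarrow> y = s m x \<or> y = s k x"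
  proof
    assume "mproj (x, y) \<in> range (\<lambda>x. mproj (x, s m x))"
    then obtain z where "mproj (x, y) = mproj (z, s m z)"
      by (rule rangeE)
    from this[symmetric] obtain q :: int where q: "x = z + of_int q * pi" "y = (if even q then s m z else - s m z)"
      unfolding mproj_eq_iff by blast
    then show "y = s m x \<or> y = s k x"
      using s_int[OF m(1), of q z] m(4) by (auto split: if_splits)
  next
    assume "y = s m x \<or> y = s k x"
    then show "mproj (x, y) \<in> range (\<lambda>x. mproj (x, s m x))"
    proof
      assume y: "y = s k x"
      have "s m (x + pi) = - s k x"
        using s_shift[of k x] assms by (simp add: m_def)
      then have "mproj (x, y) = mproj (x + pi, s m (x + pi))"
        using mproj_shift(1)[of x y] y by simp
      then show ?thesis by simp
    qed auto
  qed
  ultimately show ?thesis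
    by (auto simp: m_def)
qed

text \<open>Over a gap the levels are disjoint and only the outermost two disappear. The vertices
  that they share with the next levels disappear too, but these are limits of points over the gaps
  and return with the closure; the union of the inner levels is closed, so nothing else is
  added.\<close>

lemma kernel_step: "closure (graphs k - first_level (graphs k)) = graphs (Suc k)"
proof (cases "k < n - k")
  case False
  then have "graphs k = {}" "graphs (Suc k) = {}"
    by (auto simp: graphs_def)
  then show ?thesis by simp
next
  case True
  define P where "P = mproj -` (graphs k - first_level (graphs k))"
  have memP: "(x, y) \<in> P \<longleftrightarrow> (\<exists>j. k \<le> j \<and> j < n - k \<and> y = s j x) \<and> y \<noteq> s k x \<and> y \<noteq> s (n - 1 - k) x" for x y
    by (simp add: P_def mproj_in_graphs first_level_graphs[OF True])
  have memQ: "(x, y) \<in> mproj -` graphs (Suc k) \<longleftrightarrow> (\<exists>j\<in>{Suc k..<n - Suc k}. y = s j x)" for x y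
    by (auto simp: mproj_in_graphs)
  have "closure P = mproj -` graphs (Suc k)"
  proof
    show "closure P \<subseteq> mproj -` graphs (Suc k)"
    proof (rule closure_minimal)
      show "P \<subseteq> mproj -` graphs (Suc k)"
      proof
        fix p assume p: "p \<in> P"
        obtain x y where xy: "p = (x, y)" by (cases p)
        then obtain j where j: "k \<le> j" "j < n - k" "y = s j x" "y \<noteq> s k x" "y \<noteq> s (n - 1 - k) x"
          using p memP by auto
        then have "j \<noteq> k" "j \<noteq> n - 1 - k"
          by auto
        then have "j \<in> {Suc k..<n - Suc k}"
          using j by auto
        with j show "p \<in> mproj -` graphs (Suc k)"
          unfolding xy memQ by blast
      qed
      have "mproj -` graphs (Suc k) = (\<Union>j\<in>{Suc k..<n - Suc k}. {p. snd p = s j (fst p)})"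
      proof (rule set_eqI)
        fix p :: "real \<times> real"
        show "p \<in> mproj -` graphs (Suc k) \<longleftrightarrow> p \<in> (\<Union>j\<in>{Suc k..<n - Suc k}. {p. snd p = s j (fst p)})"
          using memQ[of "fst p" "snd p"] by simp
      qed
      moreover have "closed {p. snd p = s j (fst p)}" if "j \<in> {Suc k..<n - Suc k}" for j
        using that by (intro closed_Collect_eq continuous_intros continuous_on_compose2[OF s_cont]) auto
      ultimately show "closed (mproj -` graphs (Suc k))"
        by auto
    qed
    show "mproj -` graphs (Suc k) \<subseteq> closure P"
    proof
      fix p assume p: "p \<in> mproj -` graphs (Suc k)"
      obtain x y where xy: "p = (x, y)" by (cases p)
      then obtain j where j: "j \<in> {Suc k..<n - Suc k}" "y = s j x"
        using p memQ by blast
      have jn: "j < n"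
        using j by auto
      define i where "i = idx x"
      have "(\<lambda>z. (z, s j z)) ` closure {t i<..<t (i + 1)} \<subseteq> closure P"
      proof (rule image_closure_subset)
        show "continuous_on (closure {t i<..<t (i + 1)}) (\<lambda>z. (z, s j z))"
          by (intro continuous_intros continuous_on_subset[OF s_cont[OF jn]]) auto
        have "(z, s j z) \<in> P" if "t i < z" "z < t (i + 1)" for z
        proof -
          have "z \<notin> range t"
            using that by (rule open_gap_not_t)
          then have "s k z < s j z" "s j z < s (n - 1 - k) z"
            using j True by (auto intro!: s_less)
          with j show ?thesis
            unfolding memP by (intro conjI exI[of _ j]) auto
        qed
        then show "(\<lambda>z. (z, s j z)) ` {t i<..<t (i + 1)} \<subseteq> closure P"
          using closure_subset[of P] by auto
      qed simp
      moreover have "closure {t i<..<t (i + 1)} = {t i..t (i + 1)}"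
        by (simp add: t_less_iff)
      ultimately show "p \<in> closure P"
        using idx[of x] by (auto simp: xy j i_def image_subset_iff)
    qed
  qed
  then show ?thesis
    by (intro vimage_mproj_cancel) (simp add: vimage_closure P_def)
qed

lemma kernel_graphs: "kernel b (graphs a) = graphs (a + b)"
  by (induction b) (simp_all add: kernel_step)

text \<open>A vertex lies on a removed first level as soon as one of its two levels does. Being on
  none of them therefore means that both of its levels remain, which is the condition of
  \<open>vertices_in\<close>.\<close>

lemma kernel_contacts_realize:
  assumes "wiring a \<Lambda>"
  shows "kernel_contacts b (realize \<Lambda>) = vert ` (wcontacts a \<Lambda> \<inter> vertices_in (a + b))"
proof -
  interpret A: levels_wires n s t r a \<Lambda>
    using assms by unfold_locales
  have lev: "v \<in> (\<Union>j\<in>{1..b}. level j (graphs a)) \<longleftrightarrow> (\<exists>m. a \<le> m \<and> m < a + b \<and> v \<in> first_level (graphs m))" for v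
  proof
    assume "v \<in> (\<Union>j\<in>{1..b}. level j (graphs a))"
    then obtain j where "1 \<le> j" "j \<le> b" "v \<in> first_level (graphs (a + (j - 1)))"
      by (auto simp: level_def kernel_graphs)
    then show "\<exists>m. a \<le> m \<and> m < a + b \<and> v \<in> first_level (graphs m)"
      by (intro exI[of _ "a + (j - 1)"]) auto
  next
    assume "\<exists>m. a \<le> m \<and> m < a + b \<and> v \<in> first_level (graphs m)"
    then obtain m where "a \<le> m" "m < a + b" "v \<in> first_level (graphs m)" by blast
    then show "v \<in> (\<Union>j\<in>{1..b}. level j (graphs a))"
      by (intro UN_I[of "m - a + 1"]) (auto simp: level_def kernel_graphs)
  qed
  have kc: "kernel_contacts b (realize \<Lambda>) =
      vert ` wcontacts a \<Lambda> \<inter> (graphs a - {v. \<exists>m. a \<le> m \<and> m < a + b \<and> v \<in> first_level (graphs m)})"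
    unfolding kernel_contacts_def A.contacts_realize A.support_realize using lev by blast
  have key: "(\<exists>m. a \<le> m \<and> m < a + b \<and> vert (i, j) \<in> first_level (graphs m)) \<longleftrightarrow> (i, j) \<notin> vertices_in (a + b)"
    if v: "(i, j) \<in> vertices_in a" for i j
  proof -
    have "a \<le> j" "Suc j < n - a" "(i, j) \<in> W"
      using v by (auto simp: vertices_in_def)
    moreover from this have "s j (t i) = s (Suc j) (t i)"
      by (simp add: W_def)
    ultimately have W: "a \<le> j" "Suc j < n - a" "(i, j) \<in> W" "s j (t i) = s (Suc j) (t i)"
      by blast+
    have fl: "vert (i, j) \<in> first_level (graphs m) \<longleftrightarrow> s j (t i) = s m (t i) \<or> s j (t i) = s (n - 1 - m) (t i)"
      if "m < n - m" for m
      by (simp add: vert_def first_level_graphs[OF that])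
    show ?thesis
    proof
      assume "\<exists>m. a \<le> m \<and> m < a + b \<and> vert (i, j) \<in> first_level (graphs m)"
      then obtain m where m: "a \<le> m" "m < a + b" "vert (i, j) \<in> first_level (graphs m)" by blast
      show "(i, j) \<notin> vertices_in (a + b)"
      proof
        assume "(i, j) \<in> vertices_in (a + b)"
        then have j: "a + b \<le> j" "Suc j < n - (a + b)"
          by (auto simp: vertices_in_def)
        then have "s j (t i) = s m (t i) \<or> s j (t i) = s (n - 1 - m) (t i)"
          using fl[of m] m by simp
        moreover have "s m (t i) < s (Suc j) (t i)"
          using j m W by (intro s_less_two) auto
        moreover have "s j (t i) < s (n - 1 - m) (t i)"
          using j m by (intro s_less_two) auto
        ultimately show False
          using W(4) by simp
      qed
    next
      assume nv: "(i, j) \<notin> vertices_in (a + b)"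
      \<comment> \<open>The depth of level \<open>j + 1\<close> counted from above, as
        \<open>j\<close> is the depth of the lower level counted from below.\<close>
      define m where "m = n - 2 - j"
      have m: "a \<le> m" "n - 1 - m = Suc j" "n = m + j + 2"
        using W by (auto simp: m_def)
      have "\<not> (a + b \<le> j \<and> Suc j < n - (a + b))"
        using nv W(3) by (simp add: vertices_in_def)
      then have "j < a + b \<or> m < a + b"
        using m(3) by linarith
      then consider "j < a + b" "j < n - j" | "m < a + b" "m < n - m"
        using m(3) by linarith
      then show "\<exists>m. a \<le> m \<and> m < a + b \<and> vert (i, j) \<in> first_level (graphs m)"
      proof cases
        case 1
        then show ?thesis using fl[of j] W by blast
      next
        case 2
        then show ?thesis using fl[of m] W m by auto
      qed
    qed
  qed
  have inG: "vert (i, j) \<in> graphs a" if "(i, j) \<in> vertices_in a" for i j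
    using that by (auto simp: vert_def mproj_in_graphs vertices_in_def)
  show ?thesis
  proof (intro set_eqI iffI)
    fix v assume "v \<in> kernel_contacts b (realize \<Lambda>)"
    then obtain i j where "v = vert (i, j)" "(i, j) \<in> wcontacts a \<Lambda>"
      "\<not> (\<exists>m. a \<le> m \<and> m < a + b \<and> vert (i, j) \<in> first_level (graphs m))"
      unfolding kc by auto
    then show "v \<in> vert ` (wcontacts a \<Lambda> \<inter> vertices_in (a + b))"
      using key[of i j] by (auto simp: wcontacts_def)
  next
    fix v assume "v \<in> vert ` (wcontacts a \<Lambda> \<inter> vertices_in (a + b))"
    then obtain i j where ij: "v = vert (i, j)" "(i, j) \<in> wcontacts a \<Lambda>" "(i, j) \<in> vertices_in (a + b)"
      by auto
    then have "(i, j) \<in> vertices_in a"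
      by (auto simp: wcontacts_def)
    then show "v \<in> kernel_contacts b (realize \<Lambda>)"
      using ij key[of i j] inG[of i j] unfolding kc by blast
  qed
qed

end

section \<open>Cuts and sources\<close>

locale levels_cut = levels n s t r + cut_network n r "levels.W n s t" c for n s t r c +
  fixes F :: "(real \<times> real) set"
  assumes F_iff: "(i, j) \<in> W \<Longrightarrow> (t i, s j (t i)) \<in> F \<longleftrightarrow> c j \<le> i"
    and F_vertex: "p \<in> F \<Longrightarrow> \<exists>i j. (i, j) \<in> W \<and> p = (t i, s j (t i))"

section \<open>From filters to thresholds on the levels\<close>

context levels begin

lemma vertices_in_0: "vertices_in 0 = W"
  by (auto simp: vertices_in_def dest: W_less)

lemma mproj_in_vert_iff: "mproj (x, y) \<in> vert ` W \<longleftrightarrow> (\<exists>i j. (i, j) \<in> W \<and> x = t i \<and> y = s j (t i))"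
proof
  assume "mproj (x, y) \<in> vert ` W"
  then obtain i j where ij: "(i, j) \<in> W" "mproj (t i, s j (t i)) = mproj (x, y)"
    by (auto simp: vert_def)
  then obtain q :: int where q: "x = t i + of_int q * pi" "y = (if even q then s j (t i) else - s j (t i))"
    unfolding mproj_eq_iff by blast
  then show "\<exists>i j. (i, j) \<in> W \<and> x = t i \<and> y = s j (t i)"
    using W_int[OF ij(1), of q] t_int[of i q] by (intro exI[of _ "i + q * r"] exI[of _ "if even q then j else n - 2 - j"]) simp
qed (auto simp: vert_def intro!: image_eqI)

text \<open>A wire on the lowest level arrives on the highest one after a period, so on its way it
  passes between any two adjacent levels.\<close>

lemma W_ex:
  assumes "wiring 0 \<Lambda>" "Suc j < n"
  shows "\<exists>i. (i, j) \<in> W"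
proof (rule ccontr)
  assume no: "\<not> ?thesis"
  interpret A: wires n r W 0 \<Lambda>
    using assms(1) by unfold_locales
  obtain \<alpha> where a: "\<alpha> \<in> \<Lambda>" "\<alpha> 0 = 0"
    using A.obtain_wire[of 0 0] assms(2) by auto
  have "\<alpha> (int m) \<le> j" for m
  proof (induction m)
    case (Suc m)
    then show ?case
      using A.step[OF a(1), of "int (Suc m)"] no by (cases "\<alpha> (int m) = j") auto
  qed (use a in simp)
  from this[of "nat r"] have "\<alpha> r \<le> j"
    using r_pos by simp
  moreover have "\<alpha> r = n - 1"
    using A.shift[OF a(1), of 0] a(2) by simp
  ultimately show False
    using assms(2) by simp
qed

text \<open>Even translates of a vertex stay on its levels.\<close>

lemma W_unbounded:
  assumes "(i, j) \<in> W"
  shows "\<exists>i\<ge>b. (i, j) \<in> W" "\<exists>i\<le>b. (i, j) \<in> W"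
proof -
  have m: "m \<le> 2 * m * r" if "0 \<le> m" for m
    using mult_left_mono[of 1 r "2 * m"] r_pos that by simp
  define m where "m = \<bar>b\<bar> + \<bar>i\<bar>"
  have W2: "(i + 2 * m * r, j) \<in> W" "(i + 2 * (- m) * r, j) \<in> W"
    using W_int(2)[OF assms, of "2 * m"] W_int(2)[OF assms, of "2 * (- m)"] by simp_all
  have mr: "m \<le> 2 * m * r"
    by (rule m) (simp add: m_def)
  have nr: "i + 2 * (- m) * r = i - 2 * m * r"
    by simp
  have "b \<le> i + m" "i - m \<le> b"
    unfolding m_def by linarith+
  then have "b \<le> i + 2 * m * r" "i + 2 * (- m) * r \<le> b"
    using mr nr by linarith+
  then show "\<exists>i\<ge>b. (i, j) \<in> W" "\<exists>i\<le>b. (i, j) \<in> W"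
    using W2 by blast+
qed

lemma path_le_level:
  assumes "j < n" "i \<le> i'"
  shows "path_le (graphs 0) (t i, s j (t i)) (t i', s j (t i'))"
  unfolding path_le_def
proof (intro conjI exI[of _ "s j"])
  show "continuous_on {fst (t i, s j (t i))..fst (t i', s j (t i'))} (s j)"
    using s_cont[OF assms(1)] continuous_on_subset by blast
  show "\<forall>x\<in>{fst (t i, s j (t i))..fst (t i', s j (t i'))}. mproj (x, s j x) \<in> graphs 0"
    using assms(1) by (auto simp: mproj_in_graphs)
qed (use assms(2) in \<open>simp_all add: t_le_iff\<close>)

text \<open>A level is a directed path through all its vertices, so by upward closure those in
  \<open>F\<close> are the ones from some column \<open>c j\<close> on. The column exists because
  every level has vertices inside and outside \<open>F\<close>: adjacent levels meet arbitrarily far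
  on both sides, which spreads the nonemptiness and properness of \<open>F\<close> from one level to
  all of them.\<close>

lemma cut_thresholds:
  assumes L: "wiring 0 \<Lambda>" and cut: "cut_of (realize \<Lambda>) F"
  shows "\<exists>c. levels_cut n s t r c F"
proof -
  interpret A: levels_wires n s t r 0 \<Lambda>
    using L by unfold_locales
  define pt where "pt j i = (t i, s j (t i))" for j i
  have sup: "support (realize \<Lambda>) = graphs 0"
    by (rule A.support_realize)
  have vx: "vertices (realize \<Lambda>) = vert ` W"
    using A.vertices_realize vertices_in_0 by simp
  have lift: "p \<in> mproj -` vert ` W \<longleftrightarrow> (\<exists>i j. (i, j) \<in> W \<and> p = pt j i)" for p
    using mproj_in_vert_iff[of "fst p" "snd p"] by (auto simp: pt_def prod_eq_iff)
  have F: "F \<noteq> {}" "F \<subset> mproj -` vert ` W"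
    "\<And>p q. p \<in> F \<Longrightarrow> q \<in> mproj -` vert ` W \<Longrightarrow> path_le (graphs 0) p q \<Longrightarrow> q \<in> F"
    using cut unfolding cut_of_def vx sup by blast+
  define V where "V j i \<longleftrightarrow> (i, j) \<in> W \<or> 0 < j \<and> (i, j - 1) \<in> W" for j i
  have same: "pt (Suc j) i = pt j i" if "(i, j) \<in> W" for i j
    using that by (simp add: pt_def W_def)
  have VI: "V j i" "V (Suc j) i" if "(i, j) \<in> W" for i j
    using that by (simp_all add: V_def)
  have V_lift: "pt j i \<in> mproj -` vert ` W" if "V j i" for i j
    unfolding lift using that same[of i "j - 1"] unfolding V_def by (metis Suc_pred')
  have mono: "pt j i' \<in> F" if "pt j i \<in> F" "V j i'" "i \<le> i'" "j < n" for i i' j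
    using F(3)[OF that(1) V_lift[OF that(2)]] path_le_level[OF that(4,3)] by (simp add: pt_def)
  have propagate: "R j" if "R j0" "j0 < n" "\<And>j. R j \<Longrightarrow> Suc j < n \<Longrightarrow> R (Suc j)" "\<And>j. R (Suc j) \<Longrightarrow> Suc j < n \<Longrightarrow> R j" "j < n"
    for R :: "nat \<Rightarrow> bool" and j j0
  proof (cases "j0 \<le> j")
    case True
    then show ?thesis
      using that(5,1) by (induction j rule: dec_induct) (auto intro: that(3))
  next
    case False
    then have "j \<le> j0" by simp
    then show ?thesis
      using that(1,2)
    proof (induction j rule: inc_induct)
      case (step m)
      then show ?case
        using that(4)[of m] that(2) by simp
    qed
  qed
  have inF: "\<exists>i. V j i \<and> pt j i \<in> F" if "j < n" for j
  proof -
    obtain i0 j0 where 0: "(i0, j0) \<in> W" "pt j0 i0 \<in> F"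
    proof -
      obtain p where p: "p \<in> F"
        using F(1) by blast
      then have "p \<in> mproj -` vert ` W"
        using F(2) by blast
      with p that show thesis
        unfolding lift by blast
    qed
    show ?thesis
    proof (rule propagate[of "\<lambda>j. \<exists>i. V j i \<and> pt j i \<in> F" j0, OF _ _ _ _ that])
      show "\<exists>i. V j0 i \<and> pt j0 i \<in> F"
        using 0 VI by blast
      show "j0 < n"
        using 0 W_less by fastforce
    next
      fix j assume j: "\<exists>i. V j i \<and> pt j i \<in> F" "Suc j < n"
      then obtain i where i: "pt j i \<in> F" by blast
      obtain i' where i': "i \<le> i'" "(i', j) \<in> W"
        using W_ex[OF L j(2)] W_unbounded(1) by blast
      then have "pt j i' \<in> F"
        using mono[OF i] VI j(2) by simp
      then show "\<exists>i. V (Suc j) i \<and> pt (Suc j) i \<in> F"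
        using same[OF i'(2)] VI[OF i'(2)] by metis
    next
      fix j assume j: "\<exists>i. V (Suc j) i \<and> pt (Suc j) i \<in> F" "Suc j < n"
      then obtain i where i: "pt (Suc j) i \<in> F" by blast
      obtain i' where i': "i \<le> i'" "(i', j) \<in> W"
        using W_ex[OF L j(2)] W_unbounded(1) by blast
      then have "pt (Suc j) i' \<in> F"
        using mono[OF i] VI j(2) by simp
      then show "\<exists>i. V j i \<and> pt j i \<in> F"
        using same[OF i'(2)] VI[OF i'(2)] by metis
    qed
  qed
  have outF: "\<exists>i. V j i \<and> pt j i \<notin> F" if "j < n" for j
  proof -
    obtain i0 j0 where 0: "(i0, j0) \<in> W" "pt j0 i0 \<notin> F"
    proof -
      obtain p where p: "p \<notin> F" "p \<in> mproj -` vert ` W"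
        using F(2) by blast
      with that show thesis
        unfolding lift by blast
    qed
    show ?thesis
    proof (rule propagate[of "\<lambda>j. \<exists>i. V j i \<and> pt j i \<notin> F" j0, OF _ _ _ _ that])
      show "\<exists>i. V j0 i \<and> pt j0 i \<notin> F"
        using 0 VI by blast
      show "j0 < n"
        using 0 W_less by fastforce
    next
      fix j assume j: "\<exists>i. V j i \<and> pt j i \<notin> F" "Suc j < n"
      then obtain i where i: "V j i" "pt j i \<notin> F" by blast
      obtain i' where i': "i' \<le> i" "(i', j) \<in> W"
        using W_ex[OF L j(2)] W_unbounded(2) by blast
      then have "pt j i' \<notin> F"
        using mono[of j i' i] i j(2) by auto
      then show "\<exists>i. V (Suc j) i \<and> pt (Suc j) i \<notin> F"
        using same[OF i'(2)] VI[OF i'(2)] by metis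
    next
      fix j assume j: "\<exists>i. V (Suc j) i \<and> pt (Suc j) i \<notin> F" "Suc j < n"
      then obtain i where i: "V (Suc j) i" "pt (Suc j) i \<notin> F" by blast
      obtain i' where i': "i' \<le> i" "(i', j) \<in> W"
        using W_ex[OF L j(2)] W_unbounded(2) by blast
      then have "pt (Suc j) i' \<notin> F"
        using mono[of "Suc j" i' i] i j(2) by auto
      then show "\<exists>i. V j i \<and> pt j i \<notin> F"
        using same[OF i'(2)] VI[OF i'(2)] by metis
    qed
  qed
  have "\<exists>d. j < n \<longrightarrow> V j d \<and> (\<forall>i. V j i \<longrightarrow> (pt j i \<in> F \<longleftrightarrow> d \<le> i))" for j
  proof (cases "j < n")
    case True
    obtain a where a: "V j a" "pt j a \<in> F" using inF[OF True] by blast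
    obtain b where b: "V j b" "pt j b \<notin> F" using outF[OF True] by blast
    let ?D = "\<lambda>q. \<exists>i. V j i \<and> pt j i \<in> F \<and> i \<le> q"
    have D1: "?D a" using a by blast
    have D2: "\<not> ?D q" if "q < b" for q
      using mono[of j _ b] b True that by fastforce
    obtain q where q: "?D q" "\<not> ?D (q - 1)"
      by (rule int_first[of ?D a b, OF D1 D2])
    then obtain i where i: "V j i" "pt j i \<in> F" "i \<le> q" by blast
    have "\<not> i \<le> q - 1"
      using q(2) i by blast
    then have iq: "i = q"
      using i(3) by simp
    have "pt j i' \<in> F \<longleftrightarrow> q \<le> i'" if "V j i'" for i'
    proof
      assume "pt j i' \<in> F"
      then have "\<not> i' \<le> q - 1"
        using q(2) that by blast
      then show "q \<le> i'" by simp
    next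
      assume "q \<le> i'"
      then show "pt j i' \<in> F"
        using mono[OF i(2) that] True iq by simp
    qed
    with i iq show ?thesis by blast
  qed simp
  then obtain c where c: "\<And>j. j < n \<Longrightarrow> V j (c j)" "\<And>j i. j < n \<Longrightarrow> V j i \<Longrightarrow> pt j i \<in> F \<longleftrightarrow> c j \<le> i"
    by metis
  have "levels_cut n s t r c F"
  proof unfold_locales
    fix i j assume W: "(i, j) \<in> W"
    then have jn: "j < n" "Suc j < n"
      using W_less by fastforce+
    show "c j \<le> i \<longleftrightarrow> c (Suc j) \<le> i"
      using c(2)[OF jn(1) VI(1)[OF W]] c(2)[OF jn(2) VI(2)[OF W]] same[OF W] by simp
    show "(t i, s j (t i)) \<in> F \<longleftrightarrow> c j \<le> i"
      using c(2)[OF jn(1) VI(1)[OF W]] by (simp add: pt_def)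
  next
    fix j assume j: "j < n"
    define l where "l = n - 1 - j"
    have l: "l < n" "n - 1 - l = j"
      using j by (auto simp: l_def)
    define d where "d = c l"
    have d: "V l d" "pt l d \<in> F"
      using c(1)[OF l(1)] c(2)[OF l(1), of d] by (simp_all add: d_def)
    \<comment> \<open>The wire through the first vertex of \<open>F\<close> on level
      \<open>l\<close> is a directed path to the translate of this vertex, one period later on level
      \<open>j\<close>, so the translate belongs to \<open>F\<close> too.\<close>
    obtain \<alpha> where a: "\<alpha> \<in> \<Lambda>" "\<alpha> d = l"
      using A.obtain_wire[of l d] l by auto
    have tr: "track \<alpha> (t d) = s l (t d)"
      using a by (simp add: track_def)
    moreover have "track \<alpha> (t (d + r)) = s j (t (d + r))"
      using A.shift[OF a(1), of d] a(2) l by (simp add: track_def)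
    ultimately have "path_le (graphs 0) (pt l d) (pt j (d + r))"
      unfolding path_le_def pt_def
    proof (intro conjI exI[of _ "track \<alpha>"])
      show "continuous_on {fst (t d, s l (t d))..fst (t (d + r), s j (t (d + r)))} (track \<alpha>)"
        using A.track_cont[OF a(1)] continuous_on_subset by blast
      show "\<forall>x\<in>{fst (t d, s l (t d))..fst (t (d + r), s j (t (d + r)))}. mproj (x, track \<alpha> x) \<in> graphs 0"
        using a(1) A.mproj_in_curve_track unfolding sup[symmetric] realize_def by blast
    qed (use r_pos in \<open>simp_all add: t_le_iff\<close>)
    moreover have V': "V j (d + r)"
    proof -
      have "(d + r, n - 2 - l) \<in> W" if "(d, l) \<in> W"
        using W_shift[of l d] W_less that by blast
      moreover have "(d + r, n - 2 - (l - 1)) \<in> W" if "(d, l - 1) \<in> W"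
        using W_shift[of "l - 1" d] W_less that by blast
      moreover have "n - 2 - l = j - 1" "0 < j" if "(d, l) \<in> W"
        using W_less[OF that] l by auto
      moreover have "n - 2 - (l - 1) = j" if "0 < l"
        using l that by auto
      ultimately show ?thesis
        using d(1) unfolding V_def by metis
    qed
    ultimately have "pt j (d + r) \<in> F"
      using F(3)[OF d(2) V_lift[OF V']] by blast
    then show "c j \<le> c (n - 1 - j) + r"
      using c(2)[OF j V'] by (simp add: d_def l_def)
  next
    fix p assume "p \<in> F"
    then have "p \<in> mproj -` vert ` W"
      using F(2) by blast
    then show "\<exists>i j. (i, j) \<in> W \<and> p = (t i, s j (t i))"
      unfolding lift pt_def .
  qed
  then show ?thesis by blast
qed

end

context levels_wires begin

lemma crossings_int:
  assumes "(i, j) \<in> W"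
  shows "(i + q * r, if even q then j else n - 2 - j) \<in> crossings \<Lambda> \<longleftrightarrow> (i, j) \<in> crossings \<Lambda>"
proof -
  let ?J = "\<lambda>q::int. if even q then j else n - 2 - j"
  have J: "?J (q + 1) = n - 2 - ?J q" for q
    using W_less[OF assms] by auto
  have sh: "(i + (q + 1) * r, ?J (q + 1)) \<in> crossings \<Lambda> \<longleftrightarrow> (i + q * r, ?J q) \<in> crossings \<Lambda>" for q
  proof -
    have e: "i + (q + 1) * r = (i + q * r) + r"
      by (simp add: algebra_simps)
    show ?thesis
      unfolding J e by (rule crossings_shift[OF W_int(2)[OF assms]])
  qed
  show ?thesis
  proof (induction q rule: int_induct[where k = 0])
    case (step1 q)
    then show ?case using sh[of q] by blast
  next
    case (step2 q)
    then show ?case using sh[of "q - 1"] by simp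
  qed simp
qed

lemma crossings_vert:
  assumes "x \<in> W" "y \<in> W" "vert x = vert y"
  shows "x \<in> crossings \<Lambda> \<longleftrightarrow> y \<in> crossings \<Lambda>"
proof -
  obtain i j i' j' where xy: "x = (i, j)" "y = (i', j')"
    by fastforce
  obtain q where "i' = i + q * r" "j' = (if even q then j else n - 2 - j)"
    using vert_eq_iff[of i j i' j'] assms unfolding xy by blast
  then show ?thesis
    using crossings_int[of i j q] assms(1) unfolding xy by blast
qed

text \<open>Being a crossing does not depend on the chosen lift (\<open>crossings_vert\<close>), so
  contact sets may be compared in the strip instead of in the network.\<close>

lemma wcontacts_vert:
  assumes "x \<in> vertices_in k'" "k' \<ge> k" "vert x \<in> vert ` wcontacts k \<Lambda>"
  shows "x \<in> wcontacts k \<Lambda>"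
proof -
  obtain y where y: "y \<in> vertices_in k" "y \<notin> crossings \<Lambda>" "vert x = vert y"
    using assms(3) by (auto simp: wcontacts_def)
  have "x \<in> W" "y \<in> W" "x \<in> vertices_in k"
    using assms(1,2) y(1) by (auto simp: vertices_in_def)
  then show ?thesis
    using crossings_vert[of x y] y by (simp add: wcontacts_def)
qed

lemma class_iff:
  assumes "\<alpha> \<in> \<Lambda>" "\<beta> \<in> \<Lambda>" "meet \<alpha> \<beta> p" "x \<in> W"
  shows "x \<in> {(m, min (\<alpha> m) (\<beta> m)) |m. r dvd m - p} \<longleftrightarrow> vert x = vert (p, min (\<alpha> p) (\<beta> p))"
proof
  assume "x \<in> {(m, min (\<alpha> m) (\<beta> m)) |m. r dvd m - p}"
  then obtain m where m: "x = (m, min (\<alpha> m) (\<beta> m))" "r dvd m - p" by blast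
  show "vert x = vert (p, min (\<alpha> p) (\<beta> p))"
    unfolding m(1) using vert_class[OF assms(1-3) m(2)] by blast
next
  assume e: "vert x = vert (p, min (\<alpha> p) (\<beta> p))"
  obtain i j where x: "x = (i, j)" by fastforce
  obtain q where "i = p + q * r"
    using vert_eq_imp e unfolding x by metis
  then have d: "r dvd i - p" by simp
  have v: "vert (i, min (\<alpha> i) (\<beta> i)) = vert (i, j)" "(i, min (\<alpha> i) (\<beta> i)) \<in> W"
    using vert_class[OF assms(1-3) d] e x by (auto simp: meet_def)
  then obtain q' where q': "i = i + q' * r" "j = (if even q' then min (\<alpha> i) (\<beta> i) else n - 2 - min (\<alpha> i) (\<beta> i))"
    using vert_eq_iff[OF v(2), of i j] assms(4) x by blast
  then have "q' = 0"
    using r_pos by simp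
  with q'(2) d show "x \<in> {(m, min (\<alpha> m) (\<beta> m)) |m. r dvd m - p}"
    unfolding x by auto
qed

end

section \<open>Sources of the graph of increasing flips\<close>

context levels_cut begin

text \<open>On level \<open>j\<close> the image of \<open>F\<close> under \<open>tau\<close> begins
  at column \<open>c' j\<close>. Thus the representatives used by \<open>cut_less\<close> are
  exactly the vertices of the window.\<close>

lemma F_tau_iff:
  assumes "(i, j) \<in> W"
  shows "(t i, s j (t i)) \<in> F - tau ` F \<longleftrightarrow> (i, j) \<in> window"
proof -
  have e: "n - 2 - (n - 2 - j) = j" "Suc (n - 2 - j) = n - 1 - j"
    using W_less[OF assms] by auto
  have W': "(i - r, n - 2 - j) \<in> W"
    by (rule W_shift_back[OF assms])
  have "s j (t i) = - s (n - 2 - j) (t (i - r))" "t i = t (i - r) + pi"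
    using W_int(1)[OF W', of 1] t_shift[of "i - r"] unfolding e(1) by simp_all
  then have tp: "tau (t (i - r), s (n - 2 - j) (t (i - r))) = (t i, s j (t i))"
    by (simp add: tau_def)
  have inj: "tau p = tau p' \<Longrightarrow> p = p'" for p p'
    by (auto simp: tau_def prod_eq_iff)
  have "(t i, s j (t i)) \<in> tau ` F \<longleftrightarrow> (t (i - r), s (n - 2 - j) (t (i - r))) \<in> F"
  proof
    assume "(t i, s j (t i)) \<in> tau ` F"
    then obtain p where p: "p \<in> F" "tau p = (t i, s j (t i))"
      by (metis imageE)
    have "p = (t (i - r), s (n - 2 - j) (t (i - r)))"
      by (rule inj) (simp only: tp p(2))
    with p show "(t (i - r), s (n - 2 - j) (t (i - r))) \<in> F" by simp
  next
    assume "(t (i - r), s (n - 2 - j) (t (i - r))) \<in> F"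
    then show "(t i, s j (t i)) \<in> tau ` F"
      using tp imageI[of "(t (i - r), s (n - 2 - j) (t (i - r)))" F tau] by simp
  qed
  also have "\<dots> \<longleftrightarrow> c' j \<le> i"
    using F_iff[OF W'] c_W[OF W'] unfolding e(2) c'_def by auto
  finally show ?thesis
    using F_iff[OF assms] assms by (auto simp: window_def)
qed

lemma F_representative: "p \<in> F - tau ` F \<Longrightarrow> \<exists>i j. (i, j) \<in> window \<and> p = (t i, s j (t i))"
  using F_vertex[of p] F_tau_iff by blast

lemma window_past:
  assumes "(i, j) \<in> W" "c j \<le> i" "1 \<le> q"
  shows "c' (if even q then j else n - 2 - j) \<le> i + q * r"
  using assms(3)
proof (induction q rule: int_ge_induct)
  have once: "c' (n - 2 - j) \<le> i + r" if "(i, j) \<in> W" "c j \<le> i" for i j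
  proof -
    have "n - 1 - (n - 2 - j) = Suc j"
      using W_less[OF that(1)] by auto
    then show ?thesis
      using c_W[OF that(1)] that(2) by (simp add: c'_def)
  qed
  {
    case base
    show ?case using once[OF assms(1,2)] by simp
  next
    case (step q)
    let ?J = "if even q then j else n - 2 - j"
    have W': "(i + q * r, ?J) \<in> W"
      by (rule W_int(2)[OF assms(1)])
    have "?J < n"
      using W_less[OF W'] by simp
    then have "c ?J \<le> c' ?J"
      using c_le[of ?J] by (simp add: c'_def)
    then have "c' (n - 2 - ?J) \<le> i + q * r + r"
      using once[OF W'] step by simp
    moreover have "n - 2 - ?J = (if even (q + 1) then j else n - 2 - j)"
      using W_less[OF assms(1)] by auto
    ultimately show ?case by (simp add: algebra_simps)
  }
qed

text \<open>By \<open>window_past\<close> every positive translate of a window vertex has left the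
  window. Two different lifts of one vertex would be positive translates of each other in one
  direction.\<close>

lemma vert_inj_window: "inj_on vert window"
proof (rule inj_onI)
  fix x y assume xy: "x \<in> window" "y \<in> window" "vert x = vert y"
  obtain i j i' j' where e: "x = (i, j)" "y = (i', j')"
    by fastforce
  have W: "(i, j) \<in> W" "(i', j') \<in> W" "c j \<le> i" "c j' \<le> i'" "i < c' j" "i' < c' j'"
    using xy unfolding e by (auto simp: window_def)
  obtain q where q: "i' = i + q * r" "j' = (if even q then j else n - 2 - j)"
    using vert_eq_iff[OF W(1,2)] xy(3) unfolding e by blast
  obtain q' where q': "i = i' + q' * r" "j = (if even q' then j' else n - 2 - j')"
    using vert_eq_iff[OF W(2,1)] xy(3) unfolding e by (metis)
  have "\<not> 1 \<le> q"
    using window_past[OF W(1,3), of q] q W(6) by auto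
  moreover have "\<not> 1 \<le> q'"
    using window_past[OF W(2,4), of q'] q' W(5) by auto
  moreover have "(q + q') * r = 0"
    using q(1) q'(1) by (simp add: algebra_simps)
  then have "q + q' = 0"
    using r_pos by simp
  ultimately have "q = 0"
    by linarith
  with q e show "x = y" by simp
qed

lemma finite_window: "finite window"
proof -
  have "window \<subseteq> {Min (c ` {..<n})..rim} \<times> {..<n}"
  proof
    fix x assume x: "x \<in> window"
    obtain i j where ij: "x = (i, j)" by fastforce
    have j: "j < n" "c j \<le> i" "i < rim"
      using x W_less[of i j] window_less_rim[of i j] by (auto simp: ij window_def)
    have "Min (c ` {..<n}) \<le> c j"
      using j(1) by (intro Min_le) auto
    then have "Min (c ` {..<n}) \<le> i"
      using j(2) by linarith
    then show "x \<in> {Min (c ` {..<n})..rim} \<times> {..<n}"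
      unfolding ij mem_Times_iff fst_conv snd_conv atLeastAtMost_iff lessThan_iff using j by linarith
  qed
  then show ?thesis
    by (rule finite_subset) simp
qed

text \<open>It guarantees that the contact gained by a flip has not been counted before in the
  potential of \<open>source_ex\<close>.\<close>

lemma crossing_not_contact:
  assumes "A \<in> arrangements_on (graphs k) V" "l \<in> A" "m \<in> A" "l \<noteq> m" "crossing_point l m w"
  shows "w \<notin> contacts A"
proof
  assume w: "w \<in> contacts A"
  obtain \<Lambda> where L: "wiring k \<Lambda>" "A = realize \<Lambda>"
    using realize_ex[of A k] assms(1) by (auto simp: arrangements_on_def)
  interpret A: levels_wires n s t r k \<Lambda>
    using L(1) by unfold_locales
  obtain \<alpha> \<beta> where ab: "\<alpha> \<in> \<Lambda>" "\<beta> \<in> \<Lambda>" "l = curve (track \<alpha>)" "m = curve (track \<beta>)"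
    using assms(2,3) unfolding L(2) realize_def by blast
  then obtain i where i: "crosses_at \<alpha> \<beta> i" "w = vert (i, min (\<alpha> i) (\<beta> i))"
    using A.crossing_point_track[of \<alpha> \<beta> w] assms(4,5) by auto
  have m: "A.meet \<alpha> \<beta> i"
    using A.crosses_at_meet[OF ab(1,2) i(1)] .
  have "(i, min (\<alpha> i) (\<beta> i)) \<in> wcontacts k \<Lambda>"
    using A.wcontacts_vert[OF A.meet_vertices_in[OF ab(1,2) m]] w i(2) unfolding L(2) A.contacts_realize by simp
  then show False
    using A.meet_crossings_iff[OF ab(1,2) m] i(1) by (simp add: wcontacts_def)
qed

text \<open>The sum of the columns of the contacts in the window is a potential: an increasing flip
  replaces one contact by another in a later column. The window being finite, it takes finitely many
  values, and an arrangement of least potential is a source.\<close>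

lemma source_ex:
  assumes "arrangements_on (graphs k) V \<noteq> {}"
  shows "\<exists>B. is_source F (graphs k) V B"
proof -
  define N where "N B = {x \<in> window. vert x \<in> contacts B}" for B
  define \<Phi> where "\<Phi> B = sum fst (N B)" for B
  have "\<Phi> ` arrangements_on (graphs k) V \<subseteq> sum fst ` Pow window"
    by (auto simp: \<Phi>_def N_def)
  then have fin: "finite (\<Phi> ` arrangements_on (graphs k) V)"
    using finite_window finite_subset by blast
  then obtain B where B: "B \<in> arrangements_on (graphs k) V" "\<Phi> B = Min (\<Phi> ` arrangements_on (graphs k) V)"
    using Min_in[OF fin] assms by (metis (no_types, lifting) imageE image_is_empty)
  have "\<not> increasing_flip F (graphs k) A B" if A: "A \<in> arrangements_on (graphs k) V" for A
  proof
    assume "increasing_flip F (graphs k) A B"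
    then obtain v w where fl: "flip A v w B" and cl: "cut_less F (graphs k) v w"
      by (auto simp: increasing_flip_def)
    obtain l m where lm: "l \<in> A" "m \<in> A" "l \<noteq> m" "contact_point l m v" "crossing_point l m w"
      and con: "contacts B = contacts A - {v} \<union> {w}"
      using fl unfolding flip_def by blast
    have v: "v \<in> contacts A"
      using lm by (auto simp: contacts_def)
    have w: "w \<notin> contacts A"
      by (rule crossing_not_contact[OF A lm(1-3,5)])
    obtain p q where pq: "p \<in> F - tau ` F" "q \<in> F - tau ` F" "mproj p = v" "mproj q = w" "path_le (graphs k) p q" "v \<noteq> w"
      using cl unfolding cut_less_def by blast
    obtain i j where ij: "(i, j) \<in> window" "p = (t i, s j (t i))"
      using F_representative[OF pq(1)] by blast
    obtain i' j' where ij': "(i', j') \<in> window" "q = (t i', s j' (t i'))"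
      using F_representative[OF pq(2)] by blast
    have vv: "v = vert (i, j)" "w = vert (i', j')"
      using pq ij ij' by (auto simp: vert_def)
    have "i \<le> i'"
      using pq(5) by (simp add: path_le_def ij ij' t_le_iff)
    moreover have "i \<noteq> i'"
    proof
      assume "i = i'"
      then have "p = q"
        using pq(5) by (auto simp: path_le_def ij ij')
      with pq show False by simp
    qed
    ultimately have lt: "i < i'" by simp
    have NB: "N B = insert (i', j') (N A - {(i, j)})"
    proof -
      have 1: "vert x = v \<longleftrightarrow> x = (i, j)" if "x \<in> window" for x
        using inj_onD[OF vert_inj_window, of x "(i, j)"] that ij vv by blast
      have 2: "vert x = w \<longleftrightarrow> x = (i', j')" if "x \<in> window" for x
        using inj_onD[OF vert_inj_window, of x "(i', j')"] that ij' vv by blast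
      have "x \<in> N B \<longleftrightarrow> x \<in> insert (i', j') (N A - {(i, j)})" for x
        using 1[of x] 2[of x] ij'(1) unfolding N_def con by blast
      then show ?thesis by blast
    qed
    have finN: "finite (N A)"
      unfolding N_def using finite_window by simp
    have "(i, j) \<in> N A" "(i', j') \<notin> N A"
      using v w ij vv by (auto simp: N_def)
    then have "\<Phi> B = \<Phi> A - i + i'"
      unfolding \<Phi>_def NB using finN by (simp add: sum_diff1)
    moreover have "\<Phi> B \<le> \<Phi> A"
      unfolding B(2) using fin A by (intro Min_le) auto
    ultimately show False
      using lt by simp
  qed
  then show ?thesis
    using B(1) unfolding is_source_def by blast
qed

text \<open>If a contact outside \<open>V\<close> violated greediness, the exchange in
  \<open>not_greedy_swap\<close> would give another arrangement that still has all of
  \<open>V\<close> among its contacts, and undoing the exchange would be an increasing flip into the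
  source.\<close>

lemma source_greedy:
  assumes src: "is_source F (graphs k) V B"
  shows "\<exists>\<Lambda>. wiring k \<Lambda> \<and> B = realize \<Lambda> \<and> V \<subseteq> vert ` wcontacts k \<Lambda> \<and> greedy_wiring k (vert -` V) \<Lambda>"
proof -
  have B: "simple_arrangement B" "support B = graphs k" "V \<subseteq> contacts B"
    using src by (auto simp: is_source_def arrangements_on_def)
  obtain \<Lambda> where L: "wiring k \<Lambda>" "B = realize \<Lambda>"
    using realize_ex[OF B(1,2)] by blast
  interpret A: levels_wires n s t r k \<Lambda>
    using L(1) by unfold_locales
  interpret C: cut_wires n r W c k \<Lambda>
    using L(1) by unfold_locales
  have "greedy_wiring k (vert -` V) \<Lambda>"
  proof (rule ccontr)
    assume "\<not> ?thesis"
    then obtain i j where ij: "(i, j) \<in> wcontacts k \<Lambda>" "(i, j) \<in> window" "vert (i, j) \<notin> V"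
      and ns: "\<not> state (steps \<Lambda>) (nat (rim - 1 - i)) (Suc j) < state (steps \<Lambda>) (nat (rim - 1 - i)) j"
      unfolding greedy_wiring_def by blast
    obtain \<Lambda>' \<alpha> \<beta> p where sw: "wiring k \<Lambda>'" "\<alpha> \<in> \<Lambda>'" "\<beta> \<in> \<Lambda>'" "crosses_at \<alpha> \<beta> i" "min (\<alpha> i) (\<beta> i) = j"
      "\<not> crosses_at \<alpha> \<beta> p" "\<alpha> p = Suc (\<beta> p) \<or> \<beta> p = Suc (\<alpha> p)" "(p, min (\<alpha> p) (\<beta> p)) \<in> window" "p < i"
      "(p, min (\<alpha> p) (\<beta> p)) \<in> crossings \<Lambda>"
      "crossings \<Lambda>' = crossings \<Lambda> - {(m, min (\<alpha> m) (\<beta> m)) |m. r dvd m - p} \<union>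
         {(m, min (\<alpha> m) (\<beta> m)) |m. r dvd m - i}"
      by (rule C.not_greedy_swap[OF ij(1,2) ns])
    interpret A': levels_wires n s t r k \<Lambda>'
      using sw(1) by unfold_locales
    define v w where "v = vert (p, min (\<alpha> p) (\<beta> p))" and "w = vert (i, j)"
    have ne: "\<alpha> \<noteq> \<beta>"
      using sw(4) by (auto simp: crosses_at_def)
    have pW: "(p, min (\<alpha> p) (\<beta> p)) \<in> W" "(i, j) \<in> W"
      using sw(8) ij(2) by (auto simp: window_def)
    have mp: "A'.meet \<alpha> \<beta> p"
      using sw(7) pW by (simp add: A'.meet_def)
    have mi: "A'.meet \<alpha> \<beta> i"
      by (rule A'.crosses_at_meet[OF sw(2-4)])
    have X': "x \<in> crossings \<Lambda>' \<longleftrightarrow> x \<in> crossings \<Lambda> \<and> vert x \<noteq> v \<or> vert x = w" if "x \<in> W" for x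
      unfolding sw(11) Un_iff Diff_iff A'.class_iff[OF sw(2,3) mp that] A'.class_iff[OF sw(2,3) mi that]
      by (simp add: v_def w_def sw(5))
    have vW: "x \<in> W" if "x \<in> vertices_in k" for x
      using that by (auto simp: vertices_in_def)
    have vw: "v \<noteq> w"
      using inj_onD[OF vert_inj_window _ sw(8) ij(2)] sw(9) by (auto simp: v_def w_def)
    have vX: "x \<in> crossings \<Lambda>" if "x \<in> W" "vert x = v" for x
      using A.crossings_vert[OF that(1) pW(1)] that(2) sw(10) by (simp add: v_def)
    have wX: "x \<notin> crossings \<Lambda>" if "x \<in> W" "vert x = w" for x
      using A.crossings_vert[OF that(1) pW(2)] that(2) ij(1) by (simp add: w_def wcontacts_def)
    have cA: "contacts (realize \<Lambda>') = vert ` (vertices_in k - crossings \<Lambda>')"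
      using A'.contacts_realize by (simp add: wcontacts_def)
    have cB: "contacts B = vert ` (vertices_in k - crossings \<Lambda>)"
      using A.contacts_realize L(2) by (simp add: wcontacts_def)
    have con: "contacts B = contacts (realize \<Lambda>') - {v} \<union> {w}"
    proof (intro set_eqI iffI)
      fix y assume "y \<in> contacts B"
      then obtain x where x: "x \<in> vertices_in k" "x \<notin> crossings \<Lambda>" "y = vert x"
        unfolding cB by blast
      then show "y \<in> contacts (realize \<Lambda>') - {v} \<union> {w}"
        using X'[OF vW[OF x(1)]] vX[OF vW[OF x(1)]] unfolding cA by (cases "vert x = w") auto
    next
      fix y assume "y \<in> contacts (realize \<Lambda>') - {v} \<union> {w}"
      then consider "y = w" | "y \<in> contacts (realize \<Lambda>')" "y \<noteq> v" by blast
      then show "y \<in> contacts B"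
      proof cases
        case 1
        then show ?thesis
          using ij(1) unfolding cB w_def wcontacts_def by blast
      next
        case 2
        then obtain x where x: "x \<in> vertices_in k" "x \<notin> crossings \<Lambda>'" "y = vert x"
          unfolding cA by blast
        then show ?thesis
          using X'[OF vW[OF x(1)]] 2(2) unfolding cB by blast
      qed
    qed
    have "V \<subseteq> contacts (realize \<Lambda>')"
      using B(3) ij(3) unfolding con w_def by blast
    then have Aon: "realize \<Lambda>' \<in> arrangements_on (graphs k) V"
      using A'.simple_arrangement_realize A'.support_realize by (simp add: arrangements_on_def)
    have "flip (realize \<Lambda>') v w B"
      unfolding flip_def
    proof (intro conjI con B(1))
      show "support B = support (realize \<Lambda>')"
        using B(2) A'.support_realize by simp
      have "curve (track \<alpha>) \<noteq> curve (track \<beta>)"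
        using A'.curve_track_inj[OF sw(2,3)] ne by blast
      moreover have "contact_point (curve (track \<alpha>)) (curve (track \<beta>)) v"
        unfolding A'.contact_point_track[OF sw(2,3) ne] v_def using mp sw(6) by blast
      moreover have "crossing_point (curve (track \<alpha>)) (curve (track \<beta>)) w"
        unfolding A'.crossing_point_track[OF sw(2,3) ne] w_def using sw(4,5) by blast
      ultimately show "\<exists>l\<in>realize \<Lambda>'. \<exists>m\<in>realize \<Lambda>'. l \<noteq> m \<and> contact_point l m v \<and> crossing_point l m w"
        unfolding realize_def using sw(2,3) by blast
    qed
    moreover have "cut_less F (graphs k) v w"
    proof -
      let ?p = "(t p, s (min (\<alpha> p) (\<beta> p)) (t p))" and ?q = "(t i, s j (t i))"
      have "?p \<in> F - tau ` F" "?q \<in> F - tau ` F"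
        using F_tau_iff[OF pW(1)] F_tau_iff[OF pW(2)] sw(8) ij(2) by blast+
      moreover have "mproj ?p = v" "mproj ?q = w"
        by (simp_all add: v_def w_def vert_def)
      moreover have tr: "track \<alpha> (t p) = s (min (\<alpha> p) (\<beta> p)) (t p)" "track \<alpha> (t i) = s j (t i)"
        using mp mi sw(5) unfolding A'.meet_def by (auto simp: track_def W_def min_def split: if_splits)
      moreover have "path_le (graphs k) ?p ?q"
        unfolding path_le_def
      proof (intro conjI exI[of _ "track \<alpha>"])
        show "continuous_on {fst ?p..fst ?q} (track \<alpha>)"
          using A'.track_cont[OF sw(2)] continuous_on_subset by blast
        show "\<forall>x\<in>{fst ?p..fst ?q}. mproj (x, track \<alpha> x) \<in> graphs k"
          using sw(2) A'.mproj_in_curve_track unfolding A'.support_realize[symmetric] realize_def by blast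
      qed (use tr sw(9) in \<open>simp_all add: t_le_iff\<close>)
      ultimately show ?thesis
        unfolding cut_less_def using vw by blast
    qed
    ultimately have "increasing_flip F (graphs k) (realize \<Lambda>') B"
      unfolding increasing_flip_def by blast
    then show False
      using src Aon by (auto simp: is_source_def)
  qed
  moreover have "V \<subseteq> vert ` wcontacts k \<Lambda>"
    using B(3) A.contacts_realize L(2) by simp
  ultimately show ?thesis
    using L by blast
qed

lemma source_unique:
  assumes "is_source F (graphs k) V B" "is_source F (graphs k) V B'"
  shows "B = B'"
proof -
  obtain \<Lambda> where L: "wiring k \<Lambda>" "B = realize \<Lambda>" "V \<subseteq> vert ` wcontacts k \<Lambda>" "greedy_wiring k (vert -` V) \<Lambda>"
    using source_greedy[OF assms(1)] by blast
  obtain \<Lambda>' where L': "wiring k \<Lambda>'" "B' = realize \<Lambda>'" "V \<subseteq> vert ` wcontacts k \<Lambda>'" "greedy_wiring k (vert -` V) \<Lambda>'"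
    using source_greedy[OF assms(2)] by blast
  interpret A: levels_wires n s t r k \<Lambda>
    using L(1) by unfold_locales
  interpret A': levels_wires n s t r k \<Lambda>'
    using L'(1) by unfold_locales
  have "vert -` V \<inter> window \<inter> vertices_in k \<subseteq> wcontacts k \<Lambda>"
    using A.wcontacts_vert L(3) by blast
  moreover have "vert -` V \<inter> window \<inter> vertices_in k \<subseteq> wcontacts k \<Lambda>'"
    using A'.wcontacts_vert L'(3) by blast
  ultimately have "\<Lambda> = \<Lambda>'"
    using greedy_wiring_unique[OF L(1) L'(1) L(4) L'(4)] by blast
  with L L' show ?thesis by simp
qed

text \<open>Resolves the definite description: \<open>wiring_restrict_ex\<close> provides an
  admissible arrangement, \<open>source_ex\<close> and \<open>source_unique\<close> make the source
  well defined, and \<open>source_greedy\<close> gives its wiring. The starting depth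
  \<open>a\<close> is arbitrary so that the lemma applies to its own result.\<close>

lemma greedy_realize:
  assumes "wiring a \<Lambda>"
  obtains \<Lambda>' where "greedy F b (realize \<Lambda>) = realize \<Lambda>'" "wiring (a + b) \<Lambda>'"
    "wcontacts a \<Lambda> \<inter> vertices_in (a + b) \<subseteq> wcontacts (a + b) \<Lambda>'"
    "greedy_wiring (a + b) (wcontacts a \<Lambda>) \<Lambda>'"
proof -
  interpret A: levels_wires n s t r a \<Lambda>
    using assms by unfold_locales
  define V where "V = vert ` (wcontacts a \<Lambda> \<inter> vertices_in (a + b))"
  have gr: "greedy F b (realize \<Lambda>) = (THE B. is_source F (graphs (a + b)) V B)"
    by (simp add: greedy_def greedy_on_def V_def A.support_realize kernel_graphs kernel_contacts_realize[OF assms])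
  obtain \<Lambda>0 where L0: "wiring (a + b) \<Lambda>0" "wcontacts a \<Lambda> \<inter> vertices_in (a + b) \<subseteq> wcontacts (a + b) \<Lambda>0"
    using wiring_restrict_ex[OF assms, of "a + b"] by auto
  interpret A0: levels_wires n s t r "a + b" \<Lambda>0
    using L0(1) by unfold_locales
  have "realize \<Lambda>0 \<in> arrangements_on (graphs (a + b)) V"
    using A0.simple_arrangement_realize A0.support_realize A0.contacts_realize L0(2)
    unfolding arrangements_on_def V_def by auto
  then obtain B where B: "is_source F (graphs (a + b)) V B"
    using source_ex by blast
  have "greedy F b (realize \<Lambda>) = B"
    unfolding gr by (rule the_equality) (rule B, rule source_unique[OF _ B])
  moreover obtain \<Lambda>' where L': "wiring (a + b) \<Lambda>'" "B = realize \<Lambda>'" "V \<subseteq> vert ` wcontacts (a + b) \<Lambda>'"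
    "greedy_wiring (a + b) (vert -` V) \<Lambda>'"
    using source_greedy[OF B] by blast
  interpret A': levels_wires n s t r "a + b" \<Lambda>'
    using L'(1) by unfold_locales
  have "wcontacts a \<Lambda> \<inter> vertices_in (a + b) \<subseteq> wcontacts (a + b) \<Lambda>'"
  proof
    fix x assume x: "x \<in> wcontacts a \<Lambda> \<inter> vertices_in (a + b)"
    then have "vert x \<in> vert ` wcontacts (a + b) \<Lambda>'"
      using L'(3) unfolding V_def by blast
    then show "x \<in> wcontacts (a + b) \<Lambda>'"
      using A'.wcontacts_vert[of x "a + b"] x by blast
  qed
  moreover have "greedy_wiring (a + b) (wcontacts a \<Lambda>) \<Lambda>'"
    unfolding greedy_wiring_def
  proof (intro allI impI)
    fix i j assume ij: "(i, j) \<in> wcontacts (a + b) \<Lambda>'" "(i, j) \<in> window" "(i, j) \<notin> wcontacts a \<Lambda>"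
    have v: "(i, j) \<in> vertices_in (a + b)"
      using ij(1) by (simp add: wcontacts_def)
    have "vert (i, j) \<notin> V"
      using A.wcontacts_vert[OF v] ij(3) unfolding V_def by auto
    then show "state (steps \<Lambda>') (nat (rim - 1 - i)) (Suc j) < state (steps \<Lambda>') (nat (rim - 1 - i)) j"
      using L'(4) ij unfolding greedy_wiring_def by blast
  qed
  ultimately show thesis
    using that L' by blast
qed

text \<open>Both sides are wirings of the same levels that are greedy with respect to the contacts
  of the original wiring, the iterated one by \<open>greedy_wiring_trans\<close>; so
  \<open>greedy_wiring_unique\<close> identifies them.\<close>

lemma greedy_add:
  assumes "wiring 0 \<Lambda>"
  shows "greedy F (a + b) (realize \<Lambda>) = greedy F b (greedy F a (realize \<Lambda>))"
proof -
  obtain \<Lambda>1 where L1: "greedy F a (realize \<Lambda>) = realize \<Lambda>1" "wiring (0 + a) \<Lambda>1"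
    "wcontacts 0 \<Lambda> \<inter> vertices_in (0 + a) \<subseteq> wcontacts (0 + a) \<Lambda>1" "greedy_wiring (0 + a) (wcontacts 0 \<Lambda>) \<Lambda>1"
    by (rule greedy_realize[OF assms])
  note L1 = L1[unfolded add_0]
  obtain \<Lambda>2 where L2: "greedy F b (realize \<Lambda>1) = realize \<Lambda>2" "wiring (a + b) \<Lambda>2"
    "wcontacts a \<Lambda>1 \<inter> vertices_in (a + b) \<subseteq> wcontacts (a + b) \<Lambda>2" "greedy_wiring (a + b) (wcontacts a \<Lambda>1) \<Lambda>2"
    by (rule greedy_realize[OF L1(2)])
  obtain \<Lambda>3 where L3: "greedy F (a + b) (realize \<Lambda>) = realize \<Lambda>3" "wiring (0 + (a + b)) \<Lambda>3"
    "wcontacts 0 \<Lambda> \<inter> vertices_in (0 + (a + b)) \<subseteq> wcontacts (0 + (a + b)) \<Lambda>3"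
    "greedy_wiring (0 + (a + b)) (wcontacts 0 \<Lambda>) \<Lambda>3"
    by (rule greedy_realize[OF assms])
  note L3 = L3[unfolded add_0]
  have g2: "greedy_wiring (a + b) (wcontacts 0 \<Lambda>) \<Lambda>2"
    using greedy_wiring_trans[OF L1(2) L2(2) _ L1(4) L2(4,3)] by simp
  have "vertices_in (a + b) \<subseteq> vertices_in a"
    by (auto simp: vertices_in_def)
  then have "wcontacts 0 \<Lambda> \<inter> window \<inter> vertices_in (a + b) \<subseteq> wcontacts (a + b) \<Lambda>2"
    using L1(3) L2(3) by blast
  moreover have "wcontacts 0 \<Lambda> \<inter> window \<inter> vertices_in (a + b) \<subseteq> wcontacts (a + b) \<Lambda>3"
    using L3(3) by blast
  ultimately have "\<Lambda>2 = \<Lambda>3"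
    using greedy_wiring_unique[OF L2(2) L3(2) g2 L3(4)] by blast
  then show ?thesis
    using L1(1) L2(1) L3(1) by simp
qed

end

section \<open>The levels of an arrangement\<close>

text \<open>The \<open>j\<close>-th smallest value, counted from 0 and with multiplicity. Applied to
  the heights of all curves over one abscissa it defines the levels.\<close>

definition order_stat :: "('a \<Rightarrow> real) \<Rightarrow> 'a set \<Rightarrow> nat \<Rightarrow> real" where
  "order_stat v A j = Min {y \<in> v ` A. Suc j \<le> card {a \<in> A. v a \<le> y}}"

lemma order_stat_cong:
  assumes "\<And>a. a \<in> A \<Longrightarrow> v a = w a"
  shows "order_stat v A j = order_stat w A j"
proof -
  have "{a \<in> A. v a \<le> y} = {a \<in> A. w a \<le> y}" for y
    using assms by auto
  moreover have "v ` A = w ` A"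
    using assms by (rule image_cong[OF refl])
  ultimately show ?thesis
    unfolding order_stat_def by simp
qed

lemma order_stat_mem:
  assumes "finite A" "j < card A"
  shows "order_stat v A j \<in> v ` A" "Suc j \<le> card {a \<in> A. v a \<le> order_stat v A j}"
    "\<And>y. y \<in> v ` A \<Longrightarrow> Suc j \<le> card {a \<in> A. v a \<le> y} \<Longrightarrow> order_stat v A j \<le> y"
proof -
  let ?S = "{y \<in> v ` A. Suc j \<le> card {a \<in> A. v a \<le> y}}"
  have fin: "finite ?S" using assms by simp
  have "A \<noteq> {}" using assms by auto
  then have "Max (v ` A) \<in> v ` A" using assms by (intro Max_in) auto
  moreover have "{a \<in> A. v a \<le> Max (v ` A)} = A" using assms by auto
  ultimately have "Max (v ` A) \<in> ?S" using assms by simp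
  then have "?S \<noteq> {}" by blast
  from Min_in[OF fin this] show "order_stat v A j \<in> v ` A" "Suc j \<le> card {a \<in> A. v a \<le> order_stat v A j}"
    unfolding order_stat_def by blast+
  show "order_stat v A j \<le> y" if "y \<in> v ` A" "Suc j \<le> card {a \<in> A. v a \<le> y}" for y
    unfolding order_stat_def using fin that by (intro Min_le) auto
qed

text \<open>Together with \<open>order_stat_less_iff\<close> it replaces the minimum by a count, the
  form in which continuity, reflection and multiplicity are proved.\<close>

lemma order_stat_le_iff:
  assumes "finite A" "j < card A"
  shows "order_stat v A j \<le> y \<longleftrightarrow> Suc j \<le> card {a \<in> A. v a \<le> y}"
proof
  assume "order_stat v A j \<le> y"
  then have "card {a \<in> A. v a \<le> order_stat v A j} \<le> card {a \<in> A. v a \<le> y}"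
    using assms by (intro card_mono) auto
  then show "Suc j \<le> card {a \<in> A. v a \<le> y}"
    using order_stat_mem(2)[OF assms, of v] by simp
next
  assume c: "Suc j \<le> card {a \<in> A. v a \<le> y}"
  define B where "B = {a \<in> A. v a \<le> y}"
  have "0 < card B"
    using c by (simp add: B_def)
  then have B: "finite B" "B \<noteq> {}"
    by (simp_all add: card_gt_0_iff)
  then have m: "Max (v ` B) \<in> v ` B"
    by (intro Max_in) auto
  have "card B \<le> card {a \<in> A. v a \<le> Max (v ` B)}"
    using B(1) assms(1) by (intro card_mono) (auto simp: B_def)
  moreover have "Max (v ` B) \<in> v ` A" "Max (v ` B) \<le> y"
    using m by (auto simp: B_def)
  ultimately show "order_stat v A j \<le> y"
    using order_stat_mem(3)[OF assms, of "Max (v ` B)" v] c by (force simp: B_def)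
qed

lemma order_stat_less_iff:
  assumes "finite A" "j < card A"
  shows "order_stat v A j < y \<longleftrightarrow> Suc j \<le> card {a \<in> A. v a < y}"
proof
  assume "order_stat v A j < y"
  then have "card {a \<in> A. v a \<le> order_stat v A j} \<le> card {a \<in> A. v a < y}"
    using assms by (intro card_mono) auto
  then show "Suc j \<le> card {a \<in> A. v a < y}"
    using order_stat_mem(2)[OF assms, of v] by simp
next
  assume c: "Suc j \<le> card {a \<in> A. v a < y}"
  define B where "B = {a \<in> A. v a < y}"
  have "0 < card B"
    using c by (simp add: B_def)
  then have B: "finite B" "B \<noteq> {}"
    by (simp_all add: card_gt_0_iff)
  then have m: "Max (v ` B) \<in> v ` B"
    by (intro Max_in) auto
  then have "Max (v ` B) < y"
    by (auto simp: B_def)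
  moreover have "card B \<le> card {a \<in> A. v a \<le> Max (v ` B)}"
    using B(1) assms(1) by (intro card_mono) (auto simp: B_def)
  then have "order_stat v A j \<le> Max (v ` B)"
    unfolding order_stat_le_iff[OF assms] using c by (simp add: B_def)
  ultimately show "order_stat v A j < y"
    by simp
qed

lemma card_compl_eq:
  assumes "finite A"
  shows "card {a \<in> A. \<not> P a} = card A - card {a \<in> A. P a}"
proof -
  have "{a \<in> A. \<not> P a} = A - {a \<in> A. P a}" by auto
  then show ?thesis using assms by (simp add: card_Diff_subset)
qed

lemma order_stat_surj:
  assumes "finite A" "a \<in> A"
  shows "\<exists>j<card A. v a = order_stat v A j"
proof -
  define j where "j = card {b \<in> A. v b < v a}"
  have "{b \<in> A. v b < v a} \<subset> {b \<in> A. v b \<le> v a}"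
    using assms(2) by force
  then have 1: "j < card {b \<in> A. v b \<le> v a}"
    unfolding j_def using assms(1) by (intro psubset_card_mono) auto
  also have "\<dots> \<le> card A"
    using assms(1) by (intro card_mono) auto
  finally have j: "j < card A" .
  have "order_stat v A j \<le> v a"
    using order_stat_le_iff[OF assms(1) j] 1 by simp
  moreover have "\<not> order_stat v A j < v a"
    using order_stat_less_iff[OF assms(1) j] by (simp add: j_def)
  ultimately show ?thesis
    using j by force
qed

text \<open>Coinciding order statistics mean that several curves pass through one point. With two
  curves this gives a vertex, with three it contradicts simplicity.\<close>

lemma order_stat_eq_card:
  assumes "finite A" "j \<le> l" "l < card A" "order_stat v A j = y" "order_stat v A l = y"
  shows "Suc (l - j) \<le> card {a \<in> A. v a = y}"
proof -
  have "Suc l \<le> card {a \<in> A. v a \<le> y}"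
    using order_stat_le_iff[OF assms(1,3), of v y] assms(5) by simp
  moreover have "card {a \<in> A. v a < y} \<le> j"
    using order_stat_less_iff[of A j v y] assms by simp
  moreover have "{a \<in> A. v a \<le> y} = {a \<in> A. v a < y} \<union> {a \<in> A. v a = y}"
    by auto
  then have "card {a \<in> A. v a \<le> y} \<le> card {a \<in> A. v a < y} + card {a \<in> A. v a = y}"
    using card_Un_le[of "{a \<in> A. v a < y}" "{a \<in> A. v a = y}"] by simp
  ultimately show ?thesis
    using assms(2) by linarith
qed

lemma open_card_ge:
  fixes P :: "'a \<Rightarrow> real \<Rightarrow> bool"
  assumes "finite A" "\<And>a. a \<in> A \<Longrightarrow> open {x. P a x}"
  shows "open {x. m \<le> card {a \<in> A. P a x}}"
proof -
  have "{x. m \<le> card {a \<in> A. P a x}} = (\<Union>T\<in>{T. T \<subseteq> A \<and> card T = m}. \<Inter>a\<in>T. {x. P a x})"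
  proof (intro set_eqI iffI)
    fix x assume "x \<in> {x. m \<le> card {a \<in> A. P a x}}"
    then obtain T where "T \<subseteq> {a \<in> A. P a x}" "card T = m"
      using obtain_subset_with_card_n[of m "{a \<in> A. P a x}"] by auto
    then show "x \<in> (\<Union>T\<in>{T. T \<subseteq> A \<and> card T = m}. \<Inter>a\<in>T. {x. P a x})"
      by (intro UN_I[of T]) auto
  next
    fix x assume "x \<in> (\<Union>T\<in>{T. T \<subseteq> A \<and> card T = m}. \<Inter>a\<in>T. {x. P a x})"
    then obtain T where T: "T \<subseteq> A" "card T = m" "\<forall>a\<in>T. P a x"
      by auto
    have "card T \<le> card {a \<in> A. P a x}"
      using T assms(1) by (intro card_mono) auto
    with T show "x \<in> {x. m \<le> card {a \<in> A. P a x}}" by simp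
  qed
  moreover have "open (\<Inter>a\<in>T. {x. P a x})" if "T \<subseteq> A" for T
    using that assms finite_subset by (intro open_INT) auto
  ultimately show ?thesis
    by auto
qed

text \<open>Strict bounds on an order statistic say that at least so many of finitely many open
  conditions hold, which is again open (\<open>open_card_ge\<close>).\<close>

lemma order_stat_continuous:
  fixes v :: "real \<Rightarrow> 'a \<Rightarrow> real"
  assumes "finite A" "j < card A" "\<And>a. a \<in> A \<Longrightarrow> continuous_on UNIV (\<lambda>x. v x a)"
  shows "continuous_on UNIV (\<lambda>x. order_stat (v x) A j)"
proof -
  have lt: "open {x. order_stat (v x) A j < y}" for y
    unfolding order_stat_less_iff[OF assms(1,2)]
    by (intro open_card_ge assms(1) open_Collect_less assms(3) continuous_on_const)
  have gt: "open {x. y < order_stat (v x) A j}" for y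
  proof -
    have "y < order_stat (v x) A j \<longleftrightarrow> card A - j \<le> card {a \<in> A. y < v x a}" for x
    proof -
      have "card {a \<in> A. y < v x a} = card A - card {a \<in> A. v x a \<le> y}"
        using card_compl_eq[OF assms(1), of "\<lambda>a. v x a \<le> y"] by (simp add: not_le)
      moreover have "y < order_stat (v x) A j \<longleftrightarrow> \<not> Suc j \<le> card {a \<in> A. v x a \<le> y}"
        using order_stat_le_iff[OF assms(1,2), of "v x" y] by auto
      ultimately show ?thesis
        using assms(2) by linarith
    qed
    then show ?thesis
      by (simp only:) (intro open_card_ge assms(1) open_Collect_less assms(3) continuous_on_const)
  qed
  have "isCont (\<lambda>x. order_stat (v x) A j) x" for x
    unfolding isCont_def
  proof (rule order_tendstoI)
    fix y assume "y < order_stat (v x) A j"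
    then show "\<forall>\<^sub>F z in at x. y < order_stat (v z) A j"
      using gt[of y] unfolding eventually_at_topological by (intro exI[of _ "{x. y < order_stat (v x) A j}"]) auto
  next
    fix y assume "order_stat (v x) A j < y"
    then show "\<forall>\<^sub>F z in at x. order_stat (v z) A j < y"
      using lt[of y] unfolding eventually_at_topological by (intro exI[of _ "{x. order_stat (v x) A j < y}"]) auto
  qed
  then show ?thesis
    by (simp add: continuous_at_imp_continuous_on)
qed

lemma order_stat_reflect:
  assumes "finite A" "j < card A"
  shows "order_stat (\<lambda>a. - v a) A (card A - 1 - j) = - order_stat v A j"
proof -
  have j': "card A - 1 - j < card A"
    using assms(2) by auto
  have "order_stat (\<lambda>a. - v a) A (card A - 1 - j) \<le> y \<longleftrightarrow> - order_stat v A j \<le> y" for y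
  proof -
    have "card {a \<in> A. - v a \<le> y} = card A - card {a \<in> A. v a < - y}"
      using card_compl_eq[OF assms(1), of "\<lambda>a. v a < - y"] by (simp add: not_less minus_le_iff)
    moreover have "card {a \<in> A. v a < - y} \<le> card A"
      using assms(1) by (intro card_mono) auto
    moreover have "- order_stat v A j \<le> y \<longleftrightarrow> \<not> Suc j \<le> card {a \<in> A. v a < - y}"
      using order_stat_less_iff[OF assms, of v "- y"] by linarith
    ultimately show ?thesis
      unfolding order_stat_le_iff[OF assms(1) j'] using assms(2) by linarith
  qed
  from this[of "- order_stat v A j"] this[of "order_stat (\<lambda>a. - v a) A (card A - 1 - j)"] show ?thesis
    by simp
qed

lemma strict_mono_int_step:
  fixes f :: "int \<Rightarrow> real"
  assumes "\<And>i. f i < f (i + 1)"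
  shows "strict_mono f"
proof (rule strict_monoI)
  fix i j :: int assume "i < j"
  have "f i < f (i + 1 + int m)" for m
  proof (induction m)
    case 0
    show ?case using assms[of i] by simp
  next
    case (Suc m)
    have "i + 1 + int (Suc m) = i + 1 + int m + 1"
      by simp
    then show ?case
      using Suc assms[of "i + 1 + int m"] by (metis less_trans)
  qed
  from this[of "nat (j - i - 1)"] \<open>i < j\<close> show "f i < f j"
    by simp
qed

text \<open>The elements of \<open>Z\<close> are sorted, \<open>r\<close> is their number, and index
  \<open>i\<close> denotes entry \<open>i mod r\<close> moved by \<open>i div r\<close>
  periods.\<close>

lemma periodic_enumeration:
  assumes "finite Z" "Z \<noteq> {}" "Z \<subseteq> {0..<pi}"
  obtains t :: "int \<Rightarrow> real" and r where "0 < r" "strict_mono t" "\<And>i. t (i + r) = t i + pi"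
    "\<forall>z\<in>Z. \<forall>q::int. z + of_int q * pi \<in> range t"
proof -
  define zs where "zs = sorted_list_of_set Z"
  define r where "r = int (card Z)"
  define t where "t i = zs ! nat (i mod r) + of_int (i div r) * pi" for i
  have r: "0 < r" "int (length zs) = r" "set zs = Z"
    using assms by (auto simp: r_def zs_def card_gt_0_iff)
  have inc: "zs ! a < zs ! b" if "a < b" "b < length zs" for a b
    using sorted_wrt_nth_less[OF strict_sorted_list_of_set, of a b Z] that by (simp add: zs_def)
  have rng: "0 \<le> zs ! a" "zs ! a < pi" if "a < length zs" for a
    using nth_mem[OF that] assms(3) r(3) by auto
  have step: "t i < t (i + 1)" for i
  proof -
    define q m where "q = i div r" and "m = i mod r"
    have m: "0 \<le> m" "m < r" "i = r * q + m"
      using r(1) by (simp_all add: q_def m_def)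
    show ?thesis
    proof (cases "m + 1 < r")
      case True
      have "(i + 1) div r = q" "(i + 1) mod r = m + 1"
        using m True by (auto intro!: int_div_pos_eq int_mod_pos_eq)
      moreover have "zs ! nat m < zs ! nat (m + 1)"
        using m True r(2) by (intro inc) auto
      ultimately show ?thesis
        by (simp add: t_def flip: q_def m_def)
    next
      case False
      then have "i + 1 = r * (q + 1) + 0"
        using m by (simp add: algebra_simps)
      then have "(i + 1) div r = q + 1" "(i + 1) mod r = 0"
        using r(1) by (auto intro!: int_div_pos_eq int_mod_pos_eq)
      moreover have "zs ! nat m < pi" "0 \<le> zs ! 0"
        using m r by (auto intro!: rng)
      ultimately show ?thesis
        by (simp add: t_def algebra_simps flip: q_def m_def)
    qed
  qed
  show thesis
  proof (rule that[of r t])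
    show "0 < r" by (rule r(1))
    show "strict_mono t" by (rule strict_mono_int_step) (rule step)
    show "t (i + r) = t i + pi" for i
    proof -
      have "(i + r) div r = i div r + 1"
        using r(1) by (intro div_add_self2) simp
      then show ?thesis by (simp add: t_def algebra_simps)
    qed
    show "\<forall>z\<in>Z. \<forall>q::int. z + of_int q * pi \<in> range t"
    proof (intro ballI allI)
      fix z and q :: int assume "z \<in> Z"
      then obtain a where a: "a < length zs" "zs ! a = z"
        using r(3) by (metis in_set_conv_nth)
      have "(int a + q * r) div r = q" "(int a + q * r) mod r = int a"
        using a(1) r(2) by (auto intro!: int_div_pos_eq int_mod_pos_eq simp: mult.commute)
      then have "t (int a + q * r) = z + of_int q * pi"
        using a(2) by (simp add: t_def)
      then show "z + of_int q * pi \<in> range t"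
        by (metis rangeI)
    qed
  qed
qed

text \<open>Levels coincide only where two of the finitely many curve functions agree. Two curves
  meet finitely often, so there are finitely many such abscissae per period, and they can be
  enumerated as the columns.\<close>

lemma levels_of_arrangement:
  assumes L: "simple_arrangement L"
  shows "\<exists>n s t r. levels n s t r \<and> (\<forall>x y. mproj (x, y) \<in> support L \<longleftrightarrow> (\<exists>j<n. y = s j x))"
proof -
  define \<Phi> where "\<Phi> = {f. antiperiodic f \<and> curve f \<in> L}"
  have arr: "finite L" "\<And>l. l \<in> L \<Longrightarrow> pseudoline l" "\<And>l m. l \<in> L \<Longrightarrow> m \<in> L \<Longrightarrow> l \<noteq> m \<Longrightarrow> finite (l \<inter> m)"
    "\<And>l m o'. l \<in> L \<Longrightarrow> m \<in> L \<Longrightarrow> o' \<in> L \<Longrightarrow> l \<noteq> m \<Longrightarrow> l \<noteq> o' \<Longrightarrow> m \<noteq> o' \<Longrightarrow> l \<inter> m \<inter> o' = {}"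
    using L by (auto simp: simple_arrangement_def arrangement_def)
  have ap: "antiperiodic f" "curve f \<in> L" if "f \<in> \<Phi>" for f
    using that by (auto simp: \<Phi>_def)
  have inj: "curve f \<noteq> curve g" if "f \<in> \<Phi>" "g \<in> \<Phi>" "f \<noteq> g" for f g
    using curve_inj[OF ap(1)[OF that(1)] ap(1)[OF that(2)]] that(3) by blast
  have fin: "finite \<Phi>"
  proof (rule inj_on_finite[of curve \<Phi> L])
    show "inj_on curve \<Phi>"
      by (intro inj_onI) (use inj in blast)
  qed (use arr ap in auto)
  have supp: "mproj (x, y) \<in> support L \<longleftrightarrow> (\<exists>f\<in>\<Phi>. y = f x)" for x y
  proof
    assume "mproj (x, y) \<in> support L"
    then obtain l where l: "l \<in> L" "mproj (x, y) \<in> l" by blast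
    then obtain f where "antiperiodic f" "l = curve f"
      using arr(2) by (auto simp: pseudoline_def)
    with l show "\<exists>f\<in>\<Phi>. y = f x"
      using mproj_in_curve by (auto simp: \<Phi>_def)
  next
    assume "\<exists>f\<in>\<Phi>. y = f x"
    then show "mproj (x, y) \<in> support L"
      using ap mproj_in_curve by blast
  qed
  define T where "T = {x. \<exists>f\<in>\<Phi>. \<exists>g\<in>\<Phi>. f \<noteq> g \<and> f x = g x}"
  have T_shift: "x + of_int q * pi \<in> T" if xT: "x \<in> T" for x q
  proof -
    obtain f g where fg: "f \<in> \<Phi>" "g \<in> \<Phi>" "f \<noteq> g" "f x = g x"
      using xT unfolding T_def by blast
    have "f (x + of_int q * pi) = g (x + of_int q * pi)"
      using antiperiodic_int[OF ap(1)[OF fg(1)], of x q] antiperiodic_int[OF ap(1)[OF fg(2)], of x q] fg(4) by simp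
    with fg show ?thesis
      unfolding T_def by blast
  qed
  have "finite (T \<inter> {0..<pi})"
  proof -
    have "finite {x \<in> {0..<pi}. f x = g x}" if fg: "f \<in> \<Phi>" "g \<in> \<Phi>" "f \<noteq> g" for f g
    proof (rule inj_on_finite[of "\<lambda>x. mproj (x, f x)" _ "curve f \<inter> curve g"])
      show "inj_on (\<lambda>x. mproj (x, f x)) {x \<in> {0..<pi}. f x = g x}"
      proof (rule inj_onI)
        fix x y assume xy: "x \<in> {x \<in> {0..<pi}. f x = g x}" "y \<in> {x \<in> {0..<pi}. f x = g x}" "mproj (x, f x) = mproj (y, f y)"
        then obtain q :: int where q: "y = x + of_int q * pi"
          unfolding mproj_eq_iff by blast
        then have "\<bar>of_int q * pi\<bar> < pi"
          using xy(1,2) by auto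
        then have "\<bar>of_int q\<bar> < (1::real)"
          by (simp add: abs_mult)
        then have "q = 0"
          by linarith
        with q show "x = y" by simp
      qed
      show "(\<lambda>x. mproj (x, f x)) ` {x \<in> {0..<pi}. f x = g x} \<subseteq> curve f \<inter> curve g"
        using mproj_in_curve ap(1) fg by auto
      show "finite (curve f \<inter> curve g)"
        by (rule arr(3)[OF ap(2)[OF fg(1)] ap(2)[OF fg(2)] inj[OF fg]])
    qed
    then have "finite (\<Union>f\<in>\<Phi>. \<Union>g\<in>\<Phi> - {f}. {x \<in> {0..<pi}. f x = g x})"
      using fin by auto
    moreover have "T \<inter> {0..<pi} \<subseteq> (\<Union>f\<in>\<Phi>. \<Union>g\<in>\<Phi> - {f}. {x \<in> {0..<pi}. f x = g x})"
    proof
      fix x assume x: "x \<in> T \<inter> {0..<pi}"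
      then obtain f g where "f \<in> \<Phi>" "g \<in> \<Phi> - {f}" "f x = g x"
        unfolding T_def by blast
      with x show "x \<in> (\<Union>f\<in>\<Phi>. \<Union>g\<in>\<Phi> - {f}. {x \<in> {0..<pi}. f x = g x})"
        by (intro UN_I[of f] UN_I[of g]) auto
    qed
    ultimately show ?thesis
      by (rule finite_subset[rotated])
  qed
  \<comment> \<open>Abscissa 0 is added so that a period has at least one column even if there are
    no vertices.\<close>
  then have Z: "finite (insert 0 (T \<inter> {0..<pi}))" "insert 0 (T \<inter> {0..<pi}) \<noteq> {}" "insert 0 (T \<inter> {0..<pi}) \<subseteq> {0..<pi}"
    by auto
  obtain t :: "int \<Rightarrow> real" and r where t: "0 < r" "strict_mono t" "\<And>i. t (i + r) = t i + pi"
    "\<forall>z\<in>insert 0 (T \<inter> {0..<pi}). \<forall>q::int. z + of_int q * pi \<in> range t"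
    by (rule periodic_enumeration[OF Z]) (rule that; assumption)
  have T_t: "T \<subseteq> range t"
  proof
    fix x assume x: "x \<in> T"
    define q where "q = \<lfloor>x / pi\<rfloor>"
    have "of_int q * pi \<le> x" "x < (of_int q + 1) * pi"
      unfolding q_def by (simp_all flip: pos_le_divide_eq pos_divide_less_eq)
    moreover have "x + of_int (- q) * pi \<in> T"
      by (rule T_shift[OF x])
    ultimately have "x - of_int q * pi \<in> insert 0 (T \<inter> {0..<pi})"
      by (auto simp: algebra_simps)
    then have "x - of_int q * pi + of_int q * pi \<in> range t"
      using t(4) by blast
    then show "x \<in> range t"
      by simp
  qed
  define n where "n = card \<Phi>"
  define s where "s j x = order_stat (\<lambda>f. f x) \<Phi> j" for j x
  have "levels n s t r"
  proof
    fix j x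
    show "0 < r" "strict_mono t" "t (i + r) = t i + pi" for i
      by (rule t)+
    show "continuous_on UNIV (s j)" if "j < n"
      unfolding s_def using fin that ap(1) by (intro order_stat_continuous) (auto simp: n_def antiperiodic_def)
    show le: "s j x \<le> s (Suc j) x" if "Suc j < n"
      using order_stat_le_iff[OF fin, of j "\<lambda>f. f x" "s (Suc j) x"] order_stat_le_iff[OF fin, of "Suc j" "\<lambda>f. f x" "s (Suc j) x"] that
      by (simp add: s_def n_def)
    show "s j x < s (Suc j) x" if "Suc j < n" "x \<notin> range t"
    proof (rule ccontr)
      assume "\<not> s j x < s (Suc j) x"
      then have e: "s j x = s (Suc j) x"
        using le that(1) by simp
      have "Suc (Suc j - j) \<le> card {f \<in> \<Phi>. f x = s j x}"
        by (rule order_stat_eq_card[OF fin, of j "Suc j" "\<lambda>f. f x" "s j x", OF _ _ s_def[symmetric] trans[OF s_def[symmetric] e[symmetric]]])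
          (use that(1) in \<open>simp_all add: n_def\<close>)
      then have "2 \<le> card {f \<in> \<Phi>. f x = s j x}"
        by simp
      then obtain S where S: "S \<subseteq> {f \<in> \<Phi>. f x = s j x}" "card S = 2"
        by (rule obtain_subset_with_card_n)
      then obtain f g where "S = {f, g}" "f \<noteq> g"
        by (auto simp: card_2_iff)
      with S(1) have "f \<in> \<Phi>" "g \<in> \<Phi>" "f \<noteq> g" "f x = g x"
        by auto
      then have "x \<in> T"
        unfolding T_def by blast
      then show False
        using T_t that(2) by blast
    qed
    show "s j x < s (Suc (Suc j)) x" if j: "Suc (Suc j) < n"
    proof (rule ccontr)
      assume nl: "\<not> s j x < s (Suc (Suc j)) x"
      have "s j x \<le> s (Suc (Suc j)) x"
        using order_stat_le_iff[OF fin, of j "\<lambda>f. f x" "s (Suc (Suc j)) x"]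
          order_stat_le_iff[OF fin, of "Suc (Suc j)" "\<lambda>f. f x" "s (Suc (Suc j)) x"] j by (simp add: s_def n_def)
      with nl have e: "s j x = s (Suc (Suc j)) x"
        by simp
      have "Suc (Suc (Suc j) - j) \<le> card {f \<in> \<Phi>. f x = s j x}"
        by (rule order_stat_eq_card[OF fin, of j "Suc (Suc j)" "\<lambda>f. f x" "s j x", OF _ _ s_def[symmetric] trans[OF s_def[symmetric] e[symmetric]]])
          (use j in \<open>simp_all add: n_def\<close>)
      then have "3 \<le> card {f \<in> \<Phi>. f x = s j x}"
        by simp
      then obtain S where S: "S \<subseteq> {f \<in> \<Phi>. f x = s j x}" "card S = 3"
        by (rule obtain_subset_with_card_n)
      then obtain f g h where fgh: "S = {f, g, h}" "f \<noteq> g" "f \<noteq> h" "g \<noteq> h"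
        by (auto simp: card_3_iff)
      then have P: "f \<in> \<Phi>" "g \<in> \<Phi>" "h \<in> \<Phi>" "f x = s j x" "g x = s j x" "h x = s j x"
        using S(1) by auto
      then have "mproj (x, s j x) \<in> curve f \<inter> curve g \<inter> curve h"
        using mproj_in_curve[OF ap(1)] by simp
      then show False
        using arr(4)[OF ap(2)[OF P(1)] ap(2)[OF P(2)] ap(2)[OF P(3)] inj[OF P(1,2) fgh(2)] inj[OF P(1,3) fgh(3)]
            inj[OF P(2,3) fgh(4)]] by blast
    qed
    show "s (n - 1 - j) (x + pi) = - s j x" if "j < n"
    proof -
      have "order_stat (\<lambda>f. f (x + pi)) \<Phi> (n - 1 - j) = order_stat (\<lambda>f. - f x) \<Phi> (n - 1 - j)"
        using ap(1) by (intro order_stat_cong) (simp add: antiperiodic_def)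
      then show ?thesis
        using order_stat_reflect[OF fin, of j "\<lambda>f. f x"] that by (simp add: s_def n_def)
    qed
  qed
  moreover have "mproj (x, y) \<in> support L \<longleftrightarrow> (\<exists>j<n. y = s j x)" for x y
    unfolding supp
  proof
    assume "\<exists>f\<in>\<Phi>. y = f x"
    then show "\<exists>j<n. y = s j x"
      using order_stat_surj[OF fin, of _ "\<lambda>f. f x"] by (auto simp: s_def n_def)
  next
    assume "\<exists>j<n. y = s j x"
    then show "\<exists>f\<in>\<Phi>. y = f x"
      using order_stat_mem(1)[OF fin, of _ "\<lambda>f. f x"] by (auto simp: s_def n_def)
  qed
  ultimately show ?thesis by blast
qed

theorem theorem36:
  fixes L :: "mobius set set" and F :: "(real \<times> real) set"
  assumes "simple_arrangement L"
    and "cut_of L F"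
  shows "(\<forall>a b. 0 < a \<longrightarrow> 0 < b \<longrightarrow> greedy F (a + b) L = greedy F b (greedy F a L)) \<and>
         (\<forall>k. 0 < k \<longrightarrow> greedy F k L = (greedy F 1 ^^ k) L)"
proof -
  obtain n s t r where N: "levels n s t r"
    and supp: "\<And>x y. mproj (x, y) \<in> support L \<longleftrightarrow> (\<exists>j<n. y = s j x)"
    using levels_of_arrangement[OF assms(1)] by blast
  interpret levels n s t r
    by (rule N)
  have "mproj -` support L = mproj -` graphs 0"
  proof (rule set_eqI)
    fix p :: "real \<times> real"
    obtain x y where p: "p = (x, y)" by fastforce
    show "p \<in> mproj -` support L \<longleftrightarrow> p \<in> mproj -` graphs 0"
      unfolding p vimage_eq supp mproj_in_graphs by simp
  qed
  then have supp0: "support L = graphs 0"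
    by (rule vimage_mproj_cancel)
  obtain \<Lambda> where L: "wiring 0 \<Lambda>" "L = realize \<Lambda>"
    using realize_ex[OF assms(1) supp0] by blast
  have cut: "cut_of (realize \<Lambda>) F"
    using assms(2) unfolding L(2) .
  obtain c where "levels_cut n s t r c F"
    using cut_thresholds[OF L(1) cut] by blast
  then interpret C: levels_cut n s t r c F .
  have add: "greedy F (a + b) L = greedy F b (greedy F a L)" for a b
    unfolding L(2) by (rule C.greedy_add[OF L(1)])
  have iter: "greedy F k L = (greedy F 1 ^^ k) L" if "0 < k" for k
    using that
  proof (induction k rule: nat_induct_non_zero)
    case 1
    show ?case by simp
  next
    case (Suc k)
    have "greedy F (Suc k) L = greedy F 1 (greedy F k L)"
      using add[of k 1] by (simp only: add_Suc_right add_0_right One_nat_def)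
    also have "\<dots> = (greedy F 1 ^^ Suc k) L"
      unfolding Suc.IH by (simp only: funpow.simps comp_apply)
    finally show ?case .
  qed
  show ?thesis
    by (intro conjI allI impI) (rule add, rule iter)
qed

end
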